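(* Page-Laminar Paging with cache size $k$ and a laminar requestable family of height $h$ admits the following polynomial-time algorithms: a deterministic $hk$-competitive online algorithm, a randomized $hH_k$-competitive online algorithm, and an offline $h$-approximation algorithm. Here $H_k=\sum_{i=1}^k 1/i$.
   Context: Page-Laminar Paging: an instance consists of $k$ cache slots, a laminar family $\mathcal{P}$ of sets of pages (any two members are disjoint or nested), and a request sequence $\pi=(P_1,\dots,P_T)$ with each $P_t\in\mathcal{P}$. A configuration assigns to each slot a single page or nothing. A solution is a sequence of configurations $C_1,\dots,C_T$ such that $C_t$ assigns at least one page of $P_t$ to some slot. The cost is the number of retrievals (page $p$ retrieved in slot $s$ at time $t$ if $C_t$ assigns $p$ to $s$ but $C_{t-1}$ does not, or $t=1$). The height $h$ of $\mathcal{P}$ is the maximum $h$ such that $\mathcal{P}$ contains $h$ strictly nested sets $R_1\subsetneq\dots\subsetneq R_h$. An algorithm is a $c$-approximation if its (expected) cost is at most $c\cdot\mathrm{OPT}(\pi)+b$ for every instance, with $b$ a constant independent of $\pi$ ($b=0$ required for offline algorithms); an online algorithm (deciding $C_t$ knowing only $P_1,\dots,P_t$) that is a $c$-approximation is called $c$-competitive. *)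

theory Defs
  imports
    "HOL-Probability.Probability"
    "HOL-Computational_Algebra.Polynomial"
begin

section \<open>Page-Laminar Paging\<close>

text \<open>Pages are natural numbers. The slots are \<open>0, \<dots>, k - 1\<close>, times are counted from \<open>0\<close>.\<close>

type_synonym config = "nat option list"

definition laminar :: "'a set set \<Rightarrow> bool" where
  "laminar \<P> \<longleftrightarrow> (\<forall>P\<in>\<P>. \<forall>Q\<in>\<P>. P \<inter> Q = {} \<or> P \<subseteq> Q \<or> Q \<subseteq> P)"

definition height :: "'a set set \<Rightarrow> nat" where
  "height \<P> = Max {length Rs | Rs. set Rs \<subseteq> \<P> \<and> sorted_wrt (\<subset>) Rs}"

text \<open>A request to an empty set, or any request when \<open>k = 0\<close>, cannot be served; both are excluded.\<close>

definition pl_instance :: "nat \<Rightarrow> nat set set \<Rightarrow> nat set list \<Rightarrow> bool" where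
  "pl_instance k \<P> \<pi> \<longleftrightarrow>
     k \<ge> 1 \<and> finite \<P> \<and> (\<forall>P\<in>\<P>. finite P \<and> P \<noteq> {}) \<and> laminar \<P> \<and> set \<pi> \<subseteq> \<P>"

definition is_solution :: "nat \<Rightarrow> nat set list \<Rightarrow> config list \<Rightarrow> bool" where
  "is_solution k \<pi> Cs \<longleftrightarrow>
     length Cs = length \<pi> \<and>
     (\<forall>t<length \<pi>. length (Cs ! t) = k \<and> (\<exists>s<k. \<exists>p\<in>\<pi> ! t. Cs ! t ! s = Some p))"

definition cost :: "nat \<Rightarrow> config list \<Rightarrow> nat" where
  "cost k Cs = card {(t, s, p). t < length Cs \<and> s < k \<and> Cs ! t ! s = Some p \<and>
                                (t = 0 \<or> Cs ! (t - 1) ! s \<noteq> Some p)}"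

definition opt :: "nat \<Rightarrow> nat set list \<Rightarrow> nat" where
  "opt k \<pi> = (INF Cs \<in> {Cs. is_solution k \<pi> Cs}. cost k Cs)"


section \<open>A machine model with a running time\<close>

text \<open>
  The model is the first-order functional language F of Jones (\<^emph>\<open>Computability and Complexity
  from a Programming Perspective\<close>) over binary trees, evaluated call-by-value, extended by a random
  choice. All basic operations have unit cost, which is realistic because values are only built by
  sharing; time is polynomially related to that of Turing machines. A program is a list of bodies of
  one-argument functions, which call each other by index; the entry point is function \<open>0\<close>.
  As a condition, \<open>VNil\<close> counts as false and all other values as true.
  \<open>Choose e\<close> selects a uniformly random element of the list that \<open>e\<close> evaluates to,
  at a cost proportional to the length of that list.
\<close>

datatype val = VNil | VCons val val

fun vhd :: "val \<Rightarrow> val" where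
  "vhd VNil = VNil"
| "vhd (VCons u v) = u"

fun vtl :: "val \<Rightarrow> val" where
  "vtl VNil = VNil"
| "vtl (VCons u v) = v"

fun vsize :: "val \<Rightarrow> nat" where
  "vsize VNil = 1"
| "vsize (VCons u v) = 1 + vsize u + vsize v"

fun list_of_val :: "val \<Rightarrow> val list" where
  "list_of_val VNil = []"
| "list_of_val (VCons u v) = u # list_of_val v"

datatype expr =
    Arg
  | Nl
  | Cns expr expr
  | Hd expr
  | Tl expr
  | Ite expr expr expr
  | Call nat expr
  | Choose expr

type_synonym program = "expr list"

text \<open>\<open>eval F x e\<close> is the joint distribution of the value of \<open>e\<close> and the number of evaluation
  steps, when the formal parameter has the value \<open>x\<close>. Divergence, calls of undefined functions and
  choices from the empty list show up as missing probability mass.\<close>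

partial_function (spmf) eval :: "program \<Rightarrow> val \<Rightarrow> expr \<Rightarrow> (val \<times> nat) spmf" where
  "eval F x e = (case e of
     Arg \<Rightarrow> return_spmf (x, 1)
   | Nl \<Rightarrow> return_spmf (VNil, 1)
   | Cns a b \<Rightarrow> do {
       (u, i) \<leftarrow> eval F x a;
       (v, j) \<leftarrow> eval F x b;
       return_spmf (VCons u v, i + j + 1) }
   | Hd a \<Rightarrow> do {
       (u, i) \<leftarrow> eval F x a;
       return_spmf (vhd u, i + 1) }
   | Tl a \<Rightarrow> do {
       (u, i) \<leftarrow> eval F x a;
       return_spmf (vtl u, i + 1) }
   | Ite a b c \<Rightarrow> do {
       (u, i) \<leftarrow> eval F x a;
       (v, j) \<leftarrow> (if u \<noteq> VNil then eval F x b else eval F x c);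
       return_spmf (v, i + j + 1) }
   | Call f a \<Rightarrow> do {
       (u, i) \<leftarrow> eval F x a;
       (v, j) \<leftarrow> (if f < length F then eval F u (F ! f) else return_pmf None);
       return_spmf (v, i + j + 1) }
   | Choose a \<Rightarrow> do {
       (u, i) \<leftarrow> eval F x a;
       n \<leftarrow> spmf_of_set {..<length (list_of_val u)};
       return_spmf (list_of_val u ! n, i + length (list_of_val u) + 1) })"

definition exec :: "program \<Rightarrow> val \<Rightarrow> (val \<times> nat) spmf" where
  "exec F x = eval F x (Call 0 Arg)"

fun choice_free :: "expr \<Rightarrow> bool" where
  "choice_free Arg \<longleftrightarrow> True"
| "choice_free Nl \<longleftrightarrow> True"
| "choice_free (Cns a b) \<longleftrightarrow> choice_free a \<and> choice_free b"
| "choice_free (Hd a) \<longleftrightarrow> choice_free a"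
| "choice_free (Tl a) \<longleftrightarrow> choice_free a"
| "choice_free (Ite a b c) \<longleftrightarrow> choice_free a \<and> choice_free b \<and> choice_free c"
| "choice_free (Call f a) \<longleftrightarrow> choice_free a"
| "choice_free (Choose a) \<longleftrightarrow> False"

definition deterministic :: "program \<Rightarrow> bool" where
  "deterministic F \<longleftrightarrow> (\<forall>e\<in>set F. choice_free e)"


section \<open>Encoding of instances and configurations\<close>

definition val_of_list :: "val list \<Rightarrow> val" where
  "val_of_list vs = foldr VCons vs VNil"

text \<open>Pages are encoded in binary (least significant bit first). The number of slots is encoded in
  unary, since a configuration has one entry for every slot.\<close>

fun enc_page :: "nat \<Rightarrow> val" where
  "enc_page n = (if n = 0 then VNil
     else VCons (if odd n then VCons VNil VNil else VNil) (enc_page (n div 2)))"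

declare enc_page.simps [simp del]

definition enc_slots :: "nat \<Rightarrow> val" where
  "enc_slots k = val_of_list (replicate k VNil)"

definition enc_request :: "nat set \<Rightarrow> val" where
  "enc_request P = val_of_list (map enc_page (sorted_list_of_set P))"

definition enc_input :: "nat \<Rightarrow> nat set list \<Rightarrow> val" where
  "enc_input k \<pi> = VCons (enc_slots k) (val_of_list (map enc_request \<pi>))"

fun enc_slot_content :: "nat option \<Rightarrow> val" where
  "enc_slot_content None = VNil"
| "enc_slot_content (Some p) = VCons (enc_page p) VNil"

definition enc_config :: "config \<Rightarrow> val" where
  "enc_config C = val_of_list (map enc_slot_content C)"


section \<open>Offline and online algorithms\<close>

text \<open>The behaviour of an algorithm: for each \<open>k\<close> and \<open>\<pi>\<close> the joint distribution of the
  sequence of (encoded) configurations and the total running time.\<close>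

type_synonym behaviour = "nat \<Rightarrow> nat set list \<Rightarrow> (val list \<times> nat) spmf"

definition offline :: "program \<Rightarrow> behaviour" where
  "offline A k \<pi> = map_spmf (\<lambda>(v, i). (list_of_val v, i)) (exec A (enc_input k \<pi>))"

text \<open>An online algorithm is executed once per request. It receives its current memory and the
  request, and returns its new memory and the next configuration; initially the memory holds \<open>k\<close>.\<close>

fun online_run :: "program \<Rightarrow> val \<Rightarrow> nat set list \<Rightarrow> (val list \<times> nat) spmf" where
  "online_run A m [] = return_spmf ([], 0)"
| "online_run A m (P # \<pi>) = do {
     (v, i) \<leftarrow> exec A (VCons m (enc_request P));
     (vs, j) \<leftarrow> online_run A (vhd v) \<pi>;
     return_spmf (vtl v # vs, i + j) }"

definition online :: "program \<Rightarrow> behaviour" where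
  "online A k \<pi> = online_run A (enc_slots k) \<pi>"

definition poly_time :: "behaviour \<Rightarrow> bool" where
  "poly_time B \<longleftrightarrow> (\<exists>q :: nat poly. \<forall>k \<P> \<pi>. pl_instance k \<P> \<pi> \<longrightarrow>
     (\<forall>(vs, i) \<in> set_spmf (B k \<pi>). i \<le> poly q (vsize (enc_input k \<pi>))))"

text \<open>The first conjunct forces termination with probability \<open>1\<close>; \<open>D\<close> is the output distribution.\<close>

definition solves_within :: "behaviour \<Rightarrow> nat \<Rightarrow> nat set list \<Rightarrow> real \<Rightarrow> bool" where
  "solves_within B k \<pi> r \<longleftrightarrow> (\<exists>D :: config list pmf.
     map_spmf fst (B k \<pi>) = spmf_of_pmf (map_pmf (map enc_config) D) \<and>
     (\<forall>Cs\<in>set_pmf D. is_solution k \<pi> Cs) \<and>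
     measure_pmf.expectation D (\<lambda>Cs. real (cost k Cs)) \<le> r)"

text \<open>The ratio \<open>c k h\<close> depends on the cache size and the height.\<close>

definition competitive :: "program \<Rightarrow> (nat \<Rightarrow> nat \<Rightarrow> real) \<Rightarrow> bool" where
  "competitive A c \<longleftrightarrow> (\<forall>k \<P>. \<exists>b. \<forall>\<pi>. pl_instance k \<P> \<pi> \<longrightarrow>
     solves_within (online A) k \<pi> (c k (height \<P>) * real (opt k \<pi>) + b))"

definition offline_approximation :: "program \<Rightarrow> (nat \<Rightarrow> nat \<Rightarrow> real) \<Rightarrow> bool" where
  "offline_approximation A c \<longleftrightarrow> (\<forall>k \<P> \<pi>. pl_instance k \<P> \<pi> \<longrightarrow>
     solves_within (offline A) k \<pi> (c k (height \<P>) * real (opt k \<pi>)))"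

end

theory Submission
  imports Defs
begin

text \<open>
  Requests are resolved online to single pages: a request \<open>P\<close> is answered with the page that answered
  the most recent request to a subset of \<open>P\<close>. A solution \<open>C\<close> of the original instance yields a paging
  solution of the resolved sequence of at most \<open>h\<close> times the cost: every set that \<open>C\<close> meets is owned by
  a page of \<open>C\<close> inside it, and the paging solution keeps, for each owner, the current answer of the
  largest set that it owns. The number of pairs (owner, answer), minus the number of roots met by \<open>C\<close>,
  is a potential: loading a page creates at most \<open>h\<close> new pairs, and each fault of the paging solution
  destroys one.

  For paging, the configurations of optimal offline solutions form the bases of a matroid of rank at
  most \<open>k\<close>. A request to a loop costs every solution one and truncates the matroid; any other request
  is free for the optimum and contracts the matroid. All three algorithms keep the greedy basis with
  respect to some order of the pages, and only this order distinguishes them. With the order of the next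
  requests, only loops cause faults. For an arbitrary order, each further fault creates a coloop, so
  there are at most \<open>k\<close> faults per loop request. For a random order, a page belongs to the greedy basis
  with probability its Shapley value in the rank function, so that the Hart--Mas-Colell potential
  accounts exactly for the free requests; a truncation raises it by at most \<open>H\<^sub>k - 1\<close>.
\<close>

section \<open>Greedy bases of the matroid of optimal configurations\<close>

text \<open>The matroid is never stored: its rank function is replayed from the marked history with
  one recursive call per entry, which makes the greedy basis computable in polynomial time. A
  requested page stays in the ground set as a coloop, so the rank function describes configurations
  that contain it, and its position in the order is immaterial. A request can expel other pages from
  the greedy basis but never admit them; hence the cache only has to contain the basis, and at most
  the requested page is loaded.

  The rank function also yields the lower bound: through the nullity of an offline cache, loop
  requests are charged to every paging solution at once. The paging solution built from a solution
  of the set instance therefore serves the analysis only; the algorithms see just the resolved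
  sequence. The obstacle in that reduction is that one cached page may serve nested sets with
  different current answers. Only the answer of the largest owned set fits into the cache; whenever
  a new answer has to be cached for an owner, the pair of this owner with its old top answer is
  lost.\<close>

definition rank_fun :: "('a set \<Rightarrow> nat) \<Rightarrow> bool" where
  "rank_fun r \<longleftrightarrow> r {} = 0 \<and> (\<forall>A B. A \<subseteq> B \<longrightarrow> r A \<le> r B) \<and>
     (\<forall>A e. r (insert e A) \<le> r A + 1) \<and>
     (\<forall>A B e. A \<subseteq> B \<longrightarrow> r (insert e B) + r A \<le> r (insert e A) + r B)"

lemma rank_fun_empty: "rank_fun r \<Longrightarrow> r {} = 0"
  and rank_fun_mono: "rank_fun r \<Longrightarrow> A \<subseteq> B \<Longrightarrow> r A \<le> r B"
  and rank_fun_unit: "rank_fun r \<Longrightarrow> r (insert e A) \<le> r A + 1"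
  and rank_fun_submod: "rank_fun r \<Longrightarrow> A \<subseteq> B \<Longrightarrow> r (insert e B) + r A \<le> r (insert e A) + r B"
  by (simp_all add: rank_fun_def)

lemma rank_fun_insert_ge: "rank_fun r \<Longrightarrow> r A \<le> r (insert e A)"
  by (rule rank_fun_mono) auto

lemma rank_fun_loop:
  assumes "rank_fun r" "r {p} = 0"
  shows "r (insert p A) = r A"
proof -
  have "r (insert p A) + r {} \<le> r (insert p {}) + r A"
    by (rule rank_fun_submod[OF assms(1)]) auto
  then show ?thesis
    using assms rank_fun_insert_ge[OF assms(1), of A p] by simp
qed

lemma rank_fun_nonloop: "rank_fun r \<Longrightarrow> r {p} \<noteq> 0 \<Longrightarrow> r {p} = 1"
  using rank_fun_unit[of r p "{}"] rank_fun_empty[of r] by simp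

text \<open>The direct sum of the contraction by \<open>p\<close> and a coloop \<open>p\<close>.
  Because \<open>p\<close> is not a loop, \<open>r (insert p A)\<close> is at least 1 and the
  natural subtraction never cuts off.\<close>

lemma rank_fun_contract:
  assumes r: "rank_fun r" and p: "r {p} \<noteq> 0"
  shows "rank_fun (\<lambda>A. r (insert p A) - 1 + (if p \<in> A then 1 else 0))"
proof -
  have ge1: "1 \<le> r (insert p A)" for A
    using rank_fun_mono[OF r, of "{p}" "insert p A"] p by auto
  have unit: "r (insert p (insert e A)) \<le> r (insert p A) + 1" for e A
    using rank_fun_unit[OF r, of e "insert p A"] by (simp add: insert_commute)
  have sub: "r (insert p (insert e B)) + r (insert p A) \<le> r (insert p (insert e A)) + r (insert p B)"
    if "A \<subseteq> B" for A B e
    using rank_fun_submod[OF r, of "insert p A" "insert p B" e] that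
    by (auto simp: insert_commute)
  show ?thesis
    unfolding rank_fun_def
  proof (intro conjI allI impI)
    show "r {p} - 1 + (if p \<in> {} then 1 else 0) = 0"
      using rank_fun_nonloop[OF r p] by simp
  next
    fix A B :: "'a set" assume "A \<subseteq> B"
    then have "r (insert p A) \<le> r (insert p B)"
      by (intro rank_fun_mono[OF r]) auto
    then show "r (insert p A) - 1 + (if p \<in> A then 1 else 0)
        \<le> r (insert p B) - 1 + (if p \<in> B then 1 else 0)"
      using \<open>A \<subseteq> B\<close> by auto
  next
    fix A e
    show "r (insert p (insert e A)) - 1 + (if p \<in> insert e A then 1 else 0)
        \<le> r (insert p A) - 1 + (if p \<in> A then 1 else 0) + 1"
      using unit[of e A] ge1[of A] by (cases "e = p") (auto simp: insert_absorb)
  next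
    fix A B :: "'a set" and e assume "A \<subseteq> B"
    then show "r (insert p (insert e B)) - 1 + (if p \<in> insert e B then 1 else 0) +
          (r (insert p A) - 1 + (if p \<in> A then 1 else 0))
        \<le> r (insert p (insert e A)) - 1 + (if p \<in> insert e A then 1 else 0) +
          (r (insert p B) - 1 + (if p \<in> B then 1 else 0))"
      using sub[OF \<open>A \<subseteq> B\<close>, of e] ge1[of A] ge1[of B] ge1[of "insert e A"] ge1[of "insert e B"]
      by (cases "e = p") auto
  qed
qed

text \<open>Truncation to rank \<open>m\<close>, plus \<open>p\<close> as a coloop. Submodularity
  survives the cap because a larger set reaches it no later than a smaller one; the first summand
  ignores \<open>p\<close>, a loop of \<open>r\<close>.\<close>

lemma rank_fun_truncate:
  assumes r: "rank_fun r" and p: "r {p} = 0"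
  shows "rank_fun (\<lambda>A. min (r A) m + (if p \<in> A then 1 else 0))"
proof -
  note loop = rank_fun_loop[OF r p]
  show ?thesis
    unfolding rank_fun_def
  proof (intro conjI allI impI)
    show "min (r {}) m + (if p \<in> {} then 1 else 0) = 0"
      using rank_fun_empty[OF r] by simp
  next
    fix A B :: "'a set" assume "A \<subseteq> B"
    then show "min (r A) m + (if p \<in> A then 1 else 0) \<le> min (r B) m + (if p \<in> B then 1 else 0)"
      using rank_fun_mono[OF r \<open>A \<subseteq> B\<close>] by auto
  next
    fix A e
    show "min (r (insert e A)) m + (if p \<in> insert e A then 1 else 0)
        \<le> min (r A) m + (if p \<in> A then 1 else 0) + 1"
      using rank_fun_unit[OF r, of e A] loop[of A] by (cases "e = p") auto
  next
    fix A B :: "'a set" and e assume "A \<subseteq> B"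
    then show "min (r (insert e B)) m + (if p \<in> insert e B then 1 else 0) +
          (min (r A) m + (if p \<in> A then 1 else 0))
        \<le> min (r (insert e A)) m + (if p \<in> insert e A then 1 else 0) +
          (min (r B) m + (if p \<in> B then 1 else 0))"
      using rank_fun_submod[OF r \<open>A \<subseteq> B\<close>, of e] rank_fun_mono[OF r \<open>A \<subseteq> B\<close>]
        rank_fun_insert_ge[OF r, of A e] rank_fun_insert_ge[OF r, of B e] loop[of A] loop[of B]
      by (cases "e = p") (auto simp: min_def)
  qed
qed

text \<open>By submodularity, an element that raises the rank of \<open>A\<close> also raises the
  rank of a basis \<open>V\<close> of \<open>A\<close>, so a basis can be extended along with the
  set.\<close>

lemma rank_fun_basis:
  assumes r: "rank_fun r" and "finite A"
  shows "\<exists>V\<subseteq>A. card V = r A \<and> r V = r A"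
  using assms(2)
proof (induction A rule: finite_induct)
  case empty
  then show ?case using rank_fun_empty[OF r] by auto
next
  case (insert x A)
  then obtain V where V: "V \<subseteq> A" "card V = r A" "r V = r A" by blast
  show ?case
  proof (cases "r (insert x A) = r A")
    case True
    then show ?thesis using V by (intro exI[of _ V]) auto
  next
    case False
    then have "r (insert x A) = r A + 1"
      using rank_fun_unit[OF r, of x A] rank_fun_insert_ge[OF r, of A x] by simp
    moreover have "r (insert x A) + r V \<le> r (insert x V) + r A"
      by (rule rank_fun_submod[OF r V(1)])
    ultimately have "r (insert x V) = r A + 1"
      using V rank_fun_unit[OF r, of x V] by simp
    moreover have "card (insert x V) = r A + 1"
      using V insert finite_subset[OF V(1)] by (subst card_insert_disjoint) auto
    ultimately show ?thesis
      using V \<open>r (insert x A) = r A + 1\<close> by (intro exI[of _ "insert x V"]) auto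
  qed
qed

lemma rank_fun_le_add_card:
  assumes r: "rank_fun r" and "finite B"
  shows "r (A \<union> B) \<le> r A + card B"
  using assms(2)
proof (induction B rule: finite_induct)
  case (insert x B)
  then show ?case using rank_fun_unit[OF r, of x "A \<union> B"] by simp
qed simp

section \<open>The matroid after a sequence of page requests\<close>

text \<open>The history lists the requested pages, latest first, and marks those that were not loops. \<open>rk k h\<close>
  is the rank function after \<open>h\<close>: contract a non-loop (and add it back as a coloop), or truncate to rank
  \<open>k - 1\<close> and add the loop as a coloop.\<close>

fun rk :: "nat \<Rightarrow> ('a \<times> bool) list \<Rightarrow> 'a set \<Rightarrow> nat" where
  "rk k [] A = 0"
| "rk k ((p, b) # h) A =
     (if b then rk k h (insert p A) - 1 else min (rk k h A) (k - 1)) + (if p \<in> A then 1 else 0)"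

fun valid_hist :: "nat \<Rightarrow> ('a \<times> bool) list \<Rightarrow> bool" where
  "valid_hist k [] \<longleftrightarrow> True"
| "valid_hist k ((p, b) # h) \<longleftrightarrow> valid_hist k h \<and> (b \<longleftrightarrow> rk k h {p} \<noteq> 0)"

definition mark :: "nat \<Rightarrow> ('a \<times> bool) list \<Rightarrow> 'a \<Rightarrow> ('a \<times> bool) list" where
  "mark k h p = (p, rk k h {p} \<noteq> 0) # h"

lemma valid_hist_mark [simp]: "valid_hist k (mark k h p) \<longleftrightarrow> valid_hist k h"
  by (simp add: mark_def)

lemma fst_set_mark [simp]: "fst ` set (mark k h p) = insert p (fst ` set h)"
  by (simp add: mark_def)

lemma rank_fun_rk: "valid_hist k h \<Longrightarrow> rank_fun (rk k h)"
proof (induction h)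
  case Nil
  then show ?case by (simp add: rank_fun_def)
next
  case (Cons x h)
  obtain p b where x: "x = (p, b)" by (cases x)
  from Cons x have r: "rank_fun (rk k h)" and b: "b \<longleftrightarrow> rk k h {p} \<noteq> 0" by auto
  show ?case
  proof (cases b)
    case True
    with rank_fun_contract[OF r] b show ?thesis by (simp add: x)
  next
    case False
    with rank_fun_truncate[OF r] b show ?thesis by (simp add: x)
  qed
qed

lemma rk_le: "k \<ge> 1 \<Longrightarrow> rk k h A \<le> k"
  by (induction k h A rule: rk.induct) auto

text \<open>A page gains rank only through the coloop term of its own request.\<close>

lemma rk_loop: "e \<notin> fst ` set h \<Longrightarrow> rk k h (insert e A) = rk k h A"
  by (induction k h A rule: rk.induct) (auto simp: insert_commute)

lemma rk_nonloop_mem: "rk k h {p} \<noteq> 0 \<Longrightarrow> valid_hist k h \<Longrightarrow> p \<in> fst ` set h"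
  using rk_loop[of p h k "{}"] rank_fun_empty[OF rank_fun_rk] by force

lemma rk_mark_coloop:
  assumes "valid_hist k h" "p \<notin> A"
  shows "rk k (mark k h p) (insert p A) = rk k (mark k h p) A + 1"
  using assms rank_fun_loop[OF rank_fun_rk[OF assms(1)]] by (auto simp: mark_def)

text \<open>Both operations only shrink the marginals of other pages: contraction by submodularity,
  truncation because a cap can only suppress an increase. Hence no page other than \<open>p\<close>
  enters the greedy basis at a request to \<open>p\<close>.\<close>

lemma rk_mark_diff:
  assumes h: "valid_hist k h" and e: "e \<noteq> p"
    and lt: "rk k (mark k h p) A < rk k (mark k h p) (insert e A)"
  shows "rk k h A < rk k h (insert e A)"
proof (cases "rk k h {p} = 0")
  case True
  then show ?thesis using lt e by (auto simp: mark_def split: if_splits)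
next
  case False
  then have "rk k h (insert p A) < rk k h (insert e (insert p A))"
    using lt e by (auto simp: mark_def insert_commute split: if_splits)
  moreover have "rk k h (insert e (insert p A)) + rk k h A \<le> rk k h (insert e A) + rk k h (insert p A)"
    by (rule rank_fun_submod[OF rank_fun_rk[OF h]]) auto
  ultimately show ?thesis by simp
qed

section \<open>Greedy bases, and a lazy cache that contains them\<close>

definition in_greedy :: "('a set \<Rightarrow> nat) \<Rightarrow> 'a list \<Rightarrow> 'a \<Rightarrow> bool" where
  "in_greedy r xs e \<longleftrightarrow>
     r (set (takeWhile (\<lambda>x. x \<noteq> e) xs)) < r (insert e (set (takeWhile (\<lambda>x. x \<noteq> e) xs)))"

lemma takeWhile_snoc_mem: "e \<in> set xs \<Longrightarrow> takeWhile (\<lambda>x. x \<noteq> e) (xs @ ys) = takeWhile (\<lambda>x. x \<noteq> e) xs"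
  by (induction xs) auto

text \<open>Each accepted page raises the rank of its prefix by at least one. The induction appends
  pages on the right, since later pages do not influence earlier decisions.\<close>

lemma card_in_greedy_le:
  assumes r: "rank_fun r"
  shows "card {e \<in> set xs. in_greedy r xs e} \<le> r (set xs)"
proof (induction xs rule: rev_induct)
  case Nil
  then show ?case by simp
next
  case (snoc x xs)
  have eq: "in_greedy r (xs @ [x]) e \<longleftrightarrow> in_greedy r xs e" if "e \<in> set xs" for e
    using that by (simp add: in_greedy_def takeWhile_snoc_mem)
  show ?case
  proof (cases "x \<in> set xs")
    case True
    then have "{e \<in> set (xs @ [x]). in_greedy r (xs @ [x]) e} = {e \<in> set xs. in_greedy r xs e}"
      using eq by auto
    then show ?thesis using snoc True by (simp add: insert_absorb)
  next
    case False
    then have tw: "takeWhile (\<lambda>y. y \<noteq> x) (xs @ [x]) = xs" 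
      by (subst takeWhile_append2) auto
    have "{e \<in> set (xs @ [x]). in_greedy r (xs @ [x]) e} =
        (if in_greedy r (xs @ [x]) x then {x} else {}) \<union> {e \<in> set xs. in_greedy r xs e}"
      using eq by auto
    moreover have "card (\<dots>) \<le> (if in_greedy r (xs @ [x]) x then 1 else 0) + card {e \<in> set xs. in_greedy r xs e}"
      by (rule order_trans[OF card_Un_le]) simp
    moreover have "(if in_greedy r (xs @ [x]) x then 1 else 0) + r (set xs) \<le> r (set (xs @ [x]))"
      using rank_fun_insert_ge[OF r, of "set xs" x] by (simp add: in_greedy_def tw)
    ultimately show ?thesis using snoc by simp
  qed
qed

fun place :: "('a \<Rightarrow> bool) \<Rightarrow> 'a \<Rightarrow> 'a option list \<Rightarrow> 'a option list" where
  "place Q p [] = []"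
| "place Q p (c # cs) = (if c = None \<or> \<not> Q (the c) then Some p # cs else c # place Q p cs)"

text \<open>The test combines the matroid after the request with the order before it. This is sound
  because only \<open>p\<close> may move in the order, and the test for another page does not depend
  on the place of \<open>p\<close>.\<close>

definition serve :: "nat \<Rightarrow> ('a \<times> bool) list \<Rightarrow> 'a list \<Rightarrow> 'a \<Rightarrow> 'a option list \<Rightarrow> 'a option list" where
  "serve k h xs p s =
     (if Some p \<in> set s then s else place (in_greedy (rk k (mark k h p)) xs) p s)"

text \<open>Containment of the greedy basis, instead of equality, makes the cache lazy: a page that
  leaves the basis stays until its slot is needed.\<close>

definition cache_inv :: "nat \<Rightarrow> 'a option list \<Rightarrow> ('a \<times> bool) list \<Rightarrow> 'a list \<Rightarrow> bool" where
  "cache_inv k s h xs \<longleftrightarrow> k \<ge> 1 \<and> length s = k \<and> valid_hist k h \<and> fst ` set h \<subseteq> set xs \<and>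
     distinct (filter (\<lambda>c. c \<noteq> None) s) \<and> (\<forall>e. Some e \<in> set s \<longrightarrow> e \<in> set xs) \<and>
     (\<forall>e\<in>set xs. in_greedy (rk k h) xs e \<longrightarrow> Some e \<in> set s)"

text \<open>The only page that may move is the one just requested; it is a coloop, so the greedy basis does not
  depend on its position.\<close>

definition reorder :: "'a \<Rightarrow> 'a list \<Rightarrow> 'a list \<Rightarrow> bool" where
  "reorder p xs ys \<longleftrightarrow> set ys = insert p (set xs) \<and>
     (\<forall>e. e \<noteq> p \<longrightarrow> set (takeWhile (\<lambda>x. x \<noteq> e) ys) - {p} = set (takeWhile (\<lambda>x. x \<noteq> e) xs) - {p})"

lemma place_split:
  assumes "\<exists>c\<in>set s. c = None \<or> \<not> Q (the c)"
  shows "\<exists>s1 c s2. s = s1 @ c # s2 \<and> (c = None \<or> \<not> Q (the c)) \<and> place Q p s = s1 @ Some p # s2"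
  using assms
proof (induction s)
  case (Cons a s)
  show ?case
  proof (cases "a = None \<or> \<not> Q (the a)")
    case True
    then show ?thesis by (intro exI[of _ "[]"]) auto
  next
    case False
    then obtain s1 c s2 where "s = s1 @ c # s2" "c = None \<or> \<not> Q (the c)" "place Q p s = s1 @ Some p # s2"
      using Cons by auto
    with False show ?thesis by (intro exI[of _ "a # s1"]) auto
  qed
qed simp

lemma in_greedy_reorder:
  assumes h: "valid_hist k h" and re: "reorder p xs ys" and e: "e \<noteq> p"
  shows "in_greedy (rk k (mark k h p)) ys e \<longleftrightarrow> in_greedy (rk k (mark k h p)) xs e"
proof -
  let ?r = "rk k (mark k h p)"
  \<comment> \<open>Deleting the coloop \<open>p\<close> from a prefix lowers both ranks by one, so
    the test for \<open>e\<close> does not see it.\<close>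
  have aux: "?r A < ?r (insert e A) \<longleftrightarrow> ?r (A - {p}) < ?r (insert e (A - {p}))" for A
  proof (cases "p \<in> A")
    case True
    then obtain A' where A: "A = insert p A'" "p \<notin> A'" by (metis Set.set_insert)
    have "?r A = ?r A' + 1" "?r (insert e A) = ?r (insert e A') + 1"
      using rk_mark_coloop[OF h, of p A'] rk_mark_coloop[OF h, of p "insert e A'"] A e
      by (auto simp: insert_commute)
    moreover have "A - {p} = A'" using A by auto
    ultimately show ?thesis by simp
  qed simp
  show ?thesis
    unfolding in_greedy_def
    using re e aux[of "set (takeWhile (\<lambda>x. x \<noteq> e) xs)"] aux[of "set (takeWhile (\<lambda>x. x \<noteq> e) ys)"]
    by (simp add: reorder_def)
qed

lemma in_greedy_mark_self:
  assumes h: "valid_hist k h"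
  shows "in_greedy (rk k (mark k h p)) xs p"
proof -
  have "p \<notin> set (takeWhile (\<lambda>x. x \<noteq> p) xs)" by (auto dest: set_takeWhileD)
  then show ?thesis
    using rk_mark_coloop[OF h] by (simp add: in_greedy_def)
qed

lemma serve_cases:
  assumes I: "cache_inv k s h xs" and p: "Some p \<notin> set s"
  shows "\<exists>s1 c s2. s = s1 @ c # s2 \<and> (c = None \<or> \<not> in_greedy (rk k (mark k h p)) xs (the c)) \<and>
           serve k h xs p s = s1 @ Some p # s2"
proof -
  let ?Q = "in_greedy (rk k (mark k h p)) xs"
  have h: "valid_hist k h" and k: "k \<ge> 1" "length s = k" and sub: "\<And>e. Some e \<in> set s \<Longrightarrow> e \<in> set xs"
    and dist: "distinct (filter (\<lambda>c. c \<noteq> None) s)"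
    using I by (auto simp: cache_inv_def)
  have h': "valid_hist k (mark k h p)" using h by simp
  have "\<exists>c\<in>set s. c = None \<or> \<not> ?Q (the c)"
  proof (rule ccontr)
    assume "\<not> ?thesis"
    then have all: "\<And>c. c \<in> set s \<Longrightarrow> c \<noteq> None \<and> ?Q (the c)" by auto
    \<comment> \<open>If no slot could be reused, \<open>p\<close> and the \<open>k\<close> cached
      pages would all be greedy, exceeding the rank bound \<open>k\<close>. Appending
      \<open>p\<close> ensures that it is counted even if the order lacks it; prefixes of pages in
      \<open>xs\<close> stay the same.\<close>
    let ?B = "{e \<in> set (xs @ [p]). in_greedy (rk k (mark k h p)) (xs @ [p]) e}"
    have "filter (\<lambda>c. c \<noteq> None) s = s" using all by (simp add: filter_id_conv)
    with dist have "card (set s) = k" using k by (simp add: distinct_card)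
    moreover have "inj_on the (set s)" using all by (intro inj_onI) (metis option.expand)
    ultimately have "card (the ` set s) = k" by (simp add: card_image)
    moreover have "p \<notin> the ` set s" using p all by (metis imageE option.collapse)
    ultimately have c: "card (insert p (the ` set s)) = k + 1" by simp
    have "insert p (the ` set s) \<subseteq> ?B"
    proof (intro subsetI)
      fix e assume e: "e \<in> insert p (the ` set s)"
      show "e \<in> ?B"
      proof (cases "e = p")
        case True
        then show ?thesis using in_greedy_mark_self[OF h] by simp
      next
        case False
        with e obtain c where c: "c \<in> set s" "e = the c" by auto
        then have "?Q e" "e \<in> set xs" using all[OF c(1)] sub[of e] by auto
        then show ?thesis by (simp add: in_greedy_def takeWhile_snoc_mem)
      qed
    qed
    then have "card (insert p (the ` set s)) \<le> card ?B" by (intro card_mono) auto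
    then have "k + 1 \<le> card ?B" using c by simp
    also have "\<dots> \<le> k"
      using card_in_greedy_le[OF rank_fun_rk[OF h'], of "xs @ [p]"] rk_le[OF k(1)] order_trans by blast
    finally show False by simp
  qed
  from place_split[OF this, of p] p show ?thesis by (auto simp: serve_def)
qed

lemma length_place [simp]: "length (place Q p s) = length s"
  by (induction s) auto

lemma length_serve [simp]: "length (serve k h xs p s) = length s"
  by (simp add: serve_def)

lemma serve_mem:
  assumes I: "cache_inv k s h xs"
  shows "Some p \<in> set (serve k h xs p s)"
proof (cases "Some p \<in> set s")
  case False
  from serve_cases[OF I this] show ?thesis by auto
qed (simp add: serve_def)

text \<open>By \<open>rk_mark_diff\<close>, a page other than \<open>p\<close> in the new basis was
  in the old one and hence cached; the evicted page lies outside the new basis.\<close>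

lemma cache_inv_serve:
  assumes I: "cache_inv k s h xs" and re: "reorder p xs ys"
  shows "cache_inv k (serve k h xs p s) (mark k h p) ys"
proof -
  let ?Q = "in_greedy (rk k (mark k h p)) xs"
  have h: "valid_hist k h" and k: "k \<ge> 1" "length s = k" and sub: "\<And>e. Some e \<in> set s \<Longrightarrow> e \<in> set xs"
    and dist: "distinct (filter (\<lambda>c. c \<noteq> None) s)" and hx: "fst ` set h \<subseteq> set xs"
    and gr: "\<And>e. e \<in> set xs \<Longrightarrow> in_greedy (rk k h) xs e \<Longrightarrow> Some e \<in> set s"
    using I by (auto simp: cache_inv_def)
  have ys: "set ys = insert p (set xs)" using re by (simp add: reorder_def)
  have stay: "Some e \<in> set s" if "e \<in> set ys" "e \<noteq> p" "in_greedy (rk k (mark k h p)) ys e" for e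
  proof -
    have "?Q e" using that in_greedy_reorder[OF h re] by simp
    then have "in_greedy (rk k h) xs e"
      unfolding in_greedy_def using rk_mark_diff[OF h that(2)] by blast
    then show ?thesis using gr that ys by simp
  qed
  show ?thesis
  proof (cases "Some p \<in> set s")
    case True
    then have "serve k h xs p s = s" by (simp add: serve_def)
    moreover have "Some e \<in> set s" if "e \<in> set ys" "in_greedy (rk k (mark k h p)) ys e" for e
      using that True by (cases "e = p") (simp_all add: stay)
    ultimately show ?thesis
      unfolding cache_inv_def using k h hx ys sub dist by auto
  next
    case False
    from serve_cases[OF I this] obtain s1 c s2 where
      s: "s = s1 @ c # s2" "c = None \<or> \<not> ?Q (the c)" "serve k h xs p s = s1 @ Some p # s2" by blast
    have "Some e \<in> set (s1 @ Some p # s2)" if "e \<in> set ys" "in_greedy (rk k (mark k h p)) ys e" for e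
    proof (cases "e = p")
      case False
      then have "Some e \<in> set s" using stay that by simp
      moreover have "c \<noteq> Some e"
        using s(2) that(2) in_greedy_reorder[OF h re False] by auto
      ultimately show ?thesis using s(1) by auto
    qed simp
    moreover have "distinct (filter (\<lambda>c. c \<noteq> None) (s1 @ Some p # s2))"
      using dist False s(1) by (auto split: if_splits)
    ultimately show ?thesis
      unfolding cache_inv_def s(3) using k h hx ys sub s(1) by auto
  qed
qed

lemma serve_fault_not_greedy:
  "cache_inv k s h xs \<Longrightarrow> Some p \<notin> set s \<Longrightarrow> p \<in> set xs \<Longrightarrow> \<not> in_greedy (rk k h) xs p"
  by (auto simp: cache_inv_def)

definition retrievals :: "nat \<Rightarrow> 'a option list \<Rightarrow> 'a option list \<Rightarrow> nat" where
  "retrievals k s s' = card {i. i < k \<and> s' ! i \<noteq> None \<and> s ! i \<noteq> s' ! i}"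

lemma retrievals_serve:
  assumes I: "cache_inv k s h xs"
  shows "retrievals k s (serve k h xs p s) \<le> (if Some p \<in> set s then 0 else 1)"
proof (cases "Some p \<in> set s")
  case True
  then show ?thesis by (simp add: serve_def retrievals_def)
next
  case False
  from serve_cases[OF I this] obtain s1 c s2 where
    s: "s = s1 @ c # s2" "serve k h xs p s = s1 @ Some p # s2" by blast
  have "{i. i < k \<and> (s1 @ Some p # s2) ! i \<noteq> None \<and> (s1 @ c # s2) ! i \<noteq> (s1 @ Some p # s2) ! i} \<subseteq> {length s1}"
    by (auto simp: nth_append nth_Cons' split: if_splits)
  from card_mono[OF _ this] show ?thesis using False s by (simp add: retrievals_def)
qed

section \<open>The lower bound on offline paging\<close>

text \<open>This concerns the nullity \<open>card D - rk k h D\<close> of an offline cache \<open>D\<close>, with the terms moved so that no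
  subtraction occurs.\<close>

lemma nullity_step:
  assumes h: "valid_hist k h" and D: "finite D" and D': "finite D'" "card D' \<le> k" "p \<in> D'"
  shows "card D' + (if rk k h {p} = 0 then 1 else 0) + rk k h D
     \<le> card D + rk k (mark k h p) D' + card (D' - D)"
proof -
  note r = rank_fun_rk[OF h]
  have "rk k h D \<le> rk k h ((D \<inter> D') \<union> (D - D'))"
    by (rule rank_fun_mono[OF r]) auto
  also have "\<dots> \<le> rk k h (D \<inter> D') + card (D - D')"
    using D by (intro rank_fun_le_add_card[OF r]) auto
  also have "rk k h (D \<inter> D') \<le> rk k h D'"
    by (rule rank_fun_mono[OF r]) auto
  finally have 1: "rk k h D \<le> rk k h D' + card (D - D')" by simp
  have "card D = card (D - D') + card (D \<inter> D')"
    using card_Int_Diff[OF D, of D'] by simp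
  moreover have "card D' = card (D' - D) + card (D \<inter> D')"
    using card_Int_Diff[OF D'(1), of D] by (simp add: Int_commute)
  ultimately have 2: "card D' + card (D - D') = card D + card (D' - D)" by simp
  \<comment> \<open>Contraction preserves the rank of a set containing \<open>p\<close>. For a loop
    the rank grows by one, and here the capacity enters: \<open>D' - {p}\<close> has at most
    \<open>k - 1\<close> pages, so the cap of the truncation does not bite.\<close>
  have 3: "rk k (mark k h p) D' + (if rk k h {p} = 0 then 0 else 1) = rk k h D' + 1"
  proof (cases "rk k h {p} = 0")
    case True
    have "rk k h D' = rk k h (insert p (D' - {p}))" using D'(3) by (simp add: insert_absorb)
    also have "\<dots> = rk k h (D' - {p})" by (rule rank_fun_loop[OF r True])
    also have "\<dots> \<le> card (D' - {p})"
      using rank_fun_le_add_card[OF r, of "D' - {p}" "{}"] rank_fun_empty[OF r] D' by simp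
    also have "\<dots> \<le> k - 1" using D' by simp
    finally show ?thesis using True D'(3) by (simp add: mark_def)
  next
    case False
    then have "1 \<le> rk k h D'"
      using rank_fun_mono[OF r, of "{p}" D'] D'(3) by auto
    with False D'(3) show ?thesis by (simp add: mark_def insert_absorb)
  qed
  show ?thesis using 1 2 3 by (auto split: if_splits)
qed

section \<open>The Hart--Mas-Colell potential of a rank function\<close>

text \<open>The Shapley weight of a coalition of size \<open>s\<close> among \<open>n\<close>
  players. For \<open>s = 0\<close> the natural subtraction gives the value 1; this is harmless
  because every function summed against it vanishes on the empty set.\<close>

definition wt :: "nat \<Rightarrow> nat \<Rightarrow> real" where
  "wt n s = fact (s - 1) * fact (n - s) / fact n"

lemma wt_nonneg: "0 \<le> wt n s"
  by (simp add: wt_def)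

text \<open>When one more element joins a random order, the suffix starting at a fixed element
  either contains the newcomer or does not.\<close>

lemma wt_Suc:
  assumes "1 \<le> s" "s \<le> n"
  shows "wt (Suc n) s + wt (Suc n) (Suc s) = wt n s"
proof -
  obtain t where t: "s = Suc t" using assms by (cases s) auto
  have f: "Suc n - s = Suc (n - s)" using assms by simp
  have "wt (Suc n) s + wt (Suc n) (Suc s) =
      (real (Suc (n - s)) * fact t * fact (n - s) + real (Suc t) * fact t * fact (n - s)) / fact (Suc n)"
    unfolding wt_def f using t by (simp add: add_divide_distrib algebra_simps)
  also have "real (Suc (n - s)) * fact t * fact (n - s) + real (Suc t) * fact t * fact (n - s) =
      real (Suc n) * (fact t * fact (n - s))"
  proof -
    have "real (Suc (n - s)) + real (Suc t) = real (Suc n)" using assms t by simp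
    then show ?thesis by (metis distrib_right mult.assoc)
  qed
  also have "\<dots> / fact (Suc n) = fact t * fact (n - s) / fact n"
    by (simp add: field_simps del: of_nat_Suc)
  finally show ?thesis by (simp add: wt_def t)
qed

text \<open>The dummy player property: an element that \<open>f\<close> does not notice can be
  removed from the ground set.\<close>

lemma sum_wt_insert:
  fixes f :: "'a set \<Rightarrow> real"
  assumes A: "finite A" "a \<notin> A" and f0: "f {} = 0" and fa: "\<And>S. S \<subseteq> A \<Longrightarrow> f (insert a S) = f S"
  shows "(\<Sum>S\<in>Pow (insert a A). wt (card (insert a A)) (card S) * f S) =
         (\<Sum>S\<in>Pow A. wt (card A) (card S) * f S)"
proof -
  have inj: "inj_on (insert a) (Pow A)"
    using A by (intro inj_onI) (metis Pow_iff insert_ident subsetD)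
  have "(\<Sum>S\<in>Pow (insert a A). wt (card (insert a A)) (card S) * f S) =
      (\<Sum>S\<in>Pow A. wt (Suc (card A)) (card S) * f S) +
      (\<Sum>S\<in>insert a ` Pow A. wt (Suc (card A)) (card S) * f S)"
    using A unfolding Pow_insert by (subst sum.union_disjoint) auto
  also have "(\<Sum>S\<in>insert a ` Pow A. wt (Suc (card A)) (card S) * f S) =
      (\<Sum>S\<in>Pow A. wt (Suc (card A)) (Suc (card S)) * f S)"
  proof (subst sum.reindex[OF inj], rule sum.cong)
    fix S assume "S \<in> Pow A"
    moreover from this have "card (insert a S) = Suc (card S)"
      using A finite_subset[of S A] by (subst card_insert_disjoint) auto
    ultimately show "((\<lambda>S. wt (Suc (card A)) (card S) * f S) \<circ> insert a) S = wt (Suc (card A)) (Suc (card S)) * f S"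
      using fa by simp
  qed simp
  also have "(\<Sum>S\<in>Pow A. wt (Suc (card A)) (card S) * f S) + (\<Sum>S\<in>Pow A. wt (Suc (card A)) (Suc (card S)) * f S) =
      (\<Sum>S\<in>Pow A. wt (card A) (card S) * f S)"
    unfolding sum.distrib[symmetric]
  proof (rule sum.cong)
    fix S assume S: "S \<in> Pow A"
    show "wt (Suc (card A)) (card S) * f S + wt (Suc (card A)) (Suc (card S)) * f S = wt (card A) (card S) * f S"
    proof (cases "S = {}")
      case False
      then have "1 \<le> card S" "card S \<le> card A"
        using S A finite_subset[of S A] card_mono[of A S] by (auto simp: Suc_le_eq card_gt_0_iff)
      from wt_Suc[OF this] show ?thesis by (simp add: distrib_right[symmetric])
    qed (simp add: f0)
  qed simp
  finally show ?thesis .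
qed

text \<open>In a uniformly random order of \<open>A\<close>, the suffix that starts at \<open>x\<close> equals \<open>S\<close> with probability
  \<open>wt (card A) (card S)\<close> (for \<open>x \<in> S\<close>); so this is the probability that \<open>x\<close> comes after all of \<open>X\<close>.\<close>

lemma sum_wt_last:
  assumes "finite A" "X \<subseteq> A" "x \<in> A" "x \<notin> X"
  shows "(\<Sum>S\<in>Pow A. wt (card A) (card S) * (if x \<in> S \<and> S \<inter> X = {} then 1 else 0)) = 1 / real (card X + 1)"
proof -
  \<comment> \<open>All elements outside \<open>insert x X\<close> are dummies and are added one by
    one. Over \<open>insert x X\<close> itself only \<open>S = {x}\<close> contributes.\<close>
  have "(\<Sum>S\<in>Pow (insert x X \<union> B). wt (card (insert x X \<union> B)) (card S) * (if x \<in> S \<and> S \<inter> X = {} then 1 else 0))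
      = 1 / real (card X + 1)" if "finite B" "B \<inter> insert x X = {}" for B
    using that
  proof (induction B rule: finite_induct)
    case empty
    have fX: "finite X" using assms finite_subset by blast
    have "(\<Sum>S\<in>Pow (insert x X). wt (card (insert x X)) (card S) * (if x \<in> S \<and> S \<inter> X = {} then 1 else 0)) =
        (\<Sum>S\<in>{{x}}. wt (card (insert x X)) (card S) * (if x \<in> S \<and> S \<inter> X = {} then 1 else 0))"
      using fX by (intro sum.mono_neutral_right) auto
    also have "\<dots> = 1 / real (card X + 1)"
      using fX assms by (simp add: wt_def)
    finally show ?case by simp
  next
    case (insert b B)
    then have "finite (insert x X \<union> B)" "b \<notin> insert x X \<union> B"
      using assms finite_subset by auto
    from sum_wt_insert[OF this, of "\<lambda>S. if x \<in> S \<and> S \<inter> X = {} then 1 else 0"] insert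
    show ?case by auto
  qed
  from this[of "A - insert x X"] have "(\<Sum>S\<in>Pow (insert x X \<union> (A - insert x X)). wt (card (insert x X \<union> (A - insert x X))) (card S) *
      (if x \<in> S \<and> S \<inter> X = {} then 1 else 0)) = 1 / real (card X + 1)"
    using assms by auto
  moreover have "insert x X \<union> (A - insert x X) = A" using assms by auto
  ultimately show ?thesis by simp
qed

text \<open>Enlarging \<open>X\<close> by \<open>x\<close> adds exactly the sets that contain
  \<open>x\<close> and miss \<open>X\<close>, of total weight \<open>1 / (card X + 1)\<close>. This
  is the source of the harmonic number in the competitive ratio.\<close>

lemma sum_wt_hit:
  assumes A: "finite A" and X: "X \<subseteq> A"
  shows "(\<Sum>S\<in>Pow A. wt (card A) (card S) * (if S \<inter> X = {} then 0 else 1)) = harm (card X)"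
proof -
  have "finite X" using A X finite_subset by blast
  then show ?thesis using X
  proof (induction X rule: finite_induct)
    case empty
    then show ?case by (simp add: harm_def)
  next
    case (insert x X)
    have "(\<Sum>S\<in>Pow A. wt (card A) (card S) * (if S \<inter> insert x X = {} then 0 else 1)) =
        (\<Sum>S\<in>Pow A. wt (card A) (card S) * (if S \<inter> X = {} then 0 else 1) +
           wt (card A) (card S) * (if x \<in> S \<and> S \<inter> X = {} then 1 else 0))"
      by (intro sum.cong) auto
    also have "\<dots> = harm (card X) + 1 / real (card X + 1)"
      using insert sum_wt_last[OF A, of X x] by (simp add: sum.distrib)
    finally show ?case using insert by (simp add: harm_Suc inverse_eq_divide)
  qed
qed

text \<open>Up to a constant, this is the Hart--Mas-Colell potential of the dual rank function. Unrequested pages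
  are loops and do not contribute, so the ground set may grow over time.\<close>

definition pot :: "'a set \<Rightarrow> ('a set \<Rightarrow> nat) \<Rightarrow> real" where
  "pot A r = real (r A) - (\<Sum>S\<in>Pow A. wt (card A) (card S) * (real (r A) - real (r (A - S))))"

lemma pot_insert_loop:
  assumes "finite A" and loop: "\<And>X. r (insert a X) = r X"
  shows "pot (insert a A) r = pot A r"
proof (cases "a \<in> A")
  case False
  have "(\<Sum>S\<in>Pow (insert a A). wt (card (insert a A)) (card S) * (real (r A) - real (r (A - S)))) =
         (\<Sum>S\<in>Pow A. wt (card A) (card S) * (real (r A) - real (r (A - S))))"
  proof (rule sum_wt_insert[OF assms(1) False])
    fix S assume "S \<subseteq> A"
    have "A - insert a S = A - S" using False by auto
    then show "real (r A) - real (r (A - insert a S)) = real (r A) - real (r (A - S))" by simp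
  qed simp
  moreover have "r (insert a A - S) = r (A - S)" for S
    using loop[of "A - S"] False by (cases "a \<in> S") (auto simp: insert_Diff_if)
  ultimately show ?thesis by (simp add: pot_def loop)
qed (simp add: insert_absorb)

text \<open>A crude bound suffices, because it only enters the additive constant: there are
  \<open>2 ^ card A\<close> terms, each at most \<open>k\<close>.\<close>

lemma pot_ge:
  assumes A: "finite A" and le: "\<And>X. r X \<le> k"
  shows "- (real k * 2 ^ card A) \<le> pot A r"
proof -
  have wt1: "wt (card A) (card S) \<le> 1" if "S \<in> Pow A" for S
  proof (cases "card S = 0")
    case False
    then obtain t where t: "card S = Suc t" by (cases "card S") auto
    have c: "card S \<le> card A" using that A by (simp add: card_mono)
    have "fact t * fact (card A - Suc t) \<le> (fact (t + (card A - Suc t)) :: nat)"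
      by (meson dvd_imp_le fact_fact_dvd_fact fact_gt_zero)
    also have "\<dots> \<le> fact (card A)" using c t by (intro fact_mono) simp
    finally have "real (fact t * fact (card A - Suc t)) \<le> real (fact (card A))"
      by (simp only: of_nat_le_iff)
    then show ?thesis by (simp add: wt_def t)
  qed (simp add: wt_def)
  have "(\<Sum>S\<in>Pow A. wt (card A) (card S) * (real (r A) - real (r (A - S)))) \<le> (\<Sum>S\<in>Pow A. real k)"
  proof (rule sum_mono)
    fix S assume S: "S \<in> Pow A"
    have "wt (card A) (card S) * (real (r A) - real (r (A - S))) \<le> wt (card A) (card S) * real k"
      using le[of A] by (intro mult_left_mono wt_nonneg) linarith
    also have "\<dots> \<le> 1 * real k" by (intro mult_right_mono wt1[OF S]) simp
    finally show "wt (card A) (card S) * (real (r A) - real (r (A - S))) \<le> real k" by simp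
  qed
  also have "\<dots> = real k * 2 ^ card A" using A by (simp add: card_Pow)
  finally show ?thesis by (simp add: pot_def)
qed

text \<open>Only terms with \<open>p\<close> in \<open>S\<close> change: there the contraction
  lowers the rank of \<open>A - S\<close> by one unless \<open>p\<close> adds rank to it. The sum is
  the probability that a random order leaves \<open>p\<close> out of the greedy basis; see
  \<open>greedy_miss_probability\<close>.\<close>

lemma pot_contract:
  assumes r: "rank_fun r" and A: "finite A" "p \<in> A" and p: "r {p} \<noteq> 0"
    and r': "\<And>X. r' X = r (insert p X) - 1 + (if p \<in> X then 1 else 0)"
  shows "pot A r - pot A r' =
    (\<Sum>S\<in>Pow A. wt (card A) (card S) * (if p \<in> S \<and> r (insert p (A - S)) = r (A - S) then 1 else 0))"
proof -
  have ge1: "1 \<le> r (insert p X)" for X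
    using rank_fun_mono[OF r, of "{p}" "insert p X"] p by auto
  have rA: "r' A = r A" using A ge1[of A] by (simp add: r' insert_absorb)
  have "(real (r' A) - real (r' (A - S))) - (real (r A) - real (r (A - S))) =
      (if p \<in> S \<and> r (insert p (A - S)) = r (A - S) then 1 else 0)" for S
  proof (cases "p \<in> S")
    case True
    moreover have "r (insert p (A - S)) = r (A - S) \<or> r (insert p (A - S)) = r (A - S) + 1"
      using rank_fun_unit[OF r, of p "A - S"] rank_fun_insert_ge[OF r, of "A - S" p] by linarith
    ultimately show ?thesis unfolding rA using ge1[of "A - S"] by (auto simp: r'[of "A - S"] of_nat_diff)
  next
    case False
    then have "p \<in> A - S" using A by simp
    then show ?thesis unfolding rA using ge1[of "A - S"] False by (simp add: r'[of "A - S"] insert_absorb)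
  qed
  then have "(\<Sum>S\<in>Pow A. wt (card A) (card S) * (if p \<in> S \<and> r (insert p (A - S)) = r (A - S) then 1 else 0))
     = (\<Sum>S\<in>Pow A. wt (card A) (card S) * ((real (r' A) - real (r' (A - S))) - (real (r A) - real (r (A - S)))))"
    by (intro sum.cong) auto
  also have "\<dots> = pot A r - pot A r'"
    by (simp add: pot_def rA right_diff_distrib sum_subtractf)
  finally show ?thesis by simp
qed

text \<open>At rank \<open>k\<close>, the loss \<open>r A - r (A - S)\<close> changes by the
  indicator of \<open>p\<close> in \<open>S\<close> minus that of \<open>r (A - S) < k\<close>. The
  latter forces \<open>S\<close> to meet a fixed basis \<open>V\<close>, so by
  \<open>sum_wt_hit\<close> the total change is at least \<open>1 - harm k\<close>. Below rank
  \<open>k\<close> the cap is idle, and the new coloop raises both parts of the potential by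
  one.\<close>

lemma pot_truncate:
  assumes r: "rank_fun r" and A: "finite A" "p \<in> A" and p: "r {p} = 0" and k: "k \<ge> 1" "r A \<le> k"
    and r': "\<And>X. r' X = min (r X) (k - 1) + (if p \<in> X then 1 else 0)"
  shows "1 + pot A r' \<le> pot A r + harm k"
proof (cases "r A = k")
  case True
  obtain V where V: "V \<subseteq> A" "card V = k" "r V = k"
    using rank_fun_basis[OF r A(1)] True by auto
  have rA: "r' A = r A" using A True k by (simp add: r')
  have "(\<Sum>S\<in>Pow A. wt (card A) (card S) * ((real (r A) - real (r (A - S))) + 
        ((if S \<inter> {p} = {} then 0 else 1) - (if S \<inter> V = {} then 0 else 1))))
      \<le> (\<Sum>S\<in>Pow A. wt (card A) (card S) * (real (r' A) - real (r' (A - S))))"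
  proof (intro sum_mono mult_left_mono wt_nonneg)
    fix S assume S: "S \<in> Pow A"
    have le: "r (A - S) \<le> k" using rank_fun_mono[OF r, of "A - S" A] k(2) by auto
    have "r (A - S) = k" if "S \<inter> V = {}"
    proof -
      have "V \<subseteq> A - S" using V(1) that by auto
      from rank_fun_mono[OF r this] show ?thesis using V(3) le by simp
    qed
    then show "(real (r A) - real (r (A - S))) + ((if S \<inter> {p} = {} then 0 else 1) - (if S \<inter> V = {} then 0 else 1))
        \<le> real (r' A) - real (r' (A - S))"
      unfolding rA using le k A True by (auto simp: r'[of "A - S"] min_def of_nat_diff)
  qed
  moreover have "(\<Sum>S\<in>Pow A. wt (card A) (card S) * ((real (r A) - real (r (A - S))) + 
        ((if S \<inter> {p} = {} then 0 else 1) - (if S \<inter> V = {} then 0 else 1)))) =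
      (\<Sum>S\<in>Pow A. wt (card A) (card S) * (real (r A) - real (r (A - S)))) + (harm 1 - harm k)"
    using sum_wt_hit[OF A(1), of "{p}"] sum_wt_hit[OF A(1) V(1)] A(2) V(2)
    by (simp add: distrib_left right_diff_distrib sum.distrib sum_subtractf)
  moreover have "harm 1 = (1 :: real)" by (simp add: harm_def)
  ultimately show ?thesis by (simp add: pot_def rA)
next
  case False
  then have lt: "r X \<le> k - 1" if "X \<subseteq> A" for X
    using k rank_fun_mono[OF r that] by simp
  have rA: "r' A = r A + 1" using A lt[of A] by (simp add: r')
  have "(\<Sum>S\<in>Pow A. wt (card A) (card S) * (real (r' A) - real (r' (A - S)))) =
    (\<Sum>S\<in>Pow A. wt (card A) (card S) * (real (r A) - real (r (A - S))) +
       wt (card A) (card S) * (if S \<inter> {p} = {} then 0 else 1))"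
  proof (intro sum.cong refl)
    fix S assume "S \<in> Pow A"
    show "wt (card A) (card S) * (real (r' A) - real (r' (A - S))) =
      wt (card A) (card S) * (real (r A) - real (r (A - S))) + wt (card A) (card S) * (if S \<inter> {p} = {} then 0 else 1)"
      unfolding rA using lt[of "A - S"] A by (auto simp: r'[of "A - S"] algebra_simps)
  qed
  also have "\<dots> = (\<Sum>S\<in>Pow A. wt (card A) (card S) * (real (r A) - real (r (A - S)))) + 1"
    using sum_wt_hit[OF A(1), of "{p}"] A(2) by (simp add: sum.distrib harm_def)
  finally have "pot A r' = pot A r" by (simp add: pot_def rA)
  moreover have "1 \<le> (harm k :: real)"
    using harm_mono[of 1 k, where 'a = real] k by (simp add: harm_def)
  ultimately show ?thesis by simp
qed

section \<open>Greedy bases for uniformly random orders\<close>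

lemma card_permutations_prefix:
  assumes A: "finite A" "p \<in> A" and X: "X \<subseteq> A - {p}"
  shows "card {xs \<in> permutations_of_set A. set (takeWhile (\<lambda>x. x \<noteq> p) xs) = X} =
    fact (card X) * fact (card A - card X - 1)"
proof -
  let ?Y = "A - X - {p}"
  have fin: "finite X" "finite ?Y" using A X finite_subset by auto
  have tw: "takeWhile (\<lambda>x. x \<noteq> p) (us @ p # vs) = us" if "p \<notin> set us" for us vs
    using that by (subst takeWhile_append2) auto
  have "bij_betw (\<lambda>(us, vs). us @ p # vs) (permutations_of_set X \<times> permutations_of_set ?Y)
      {xs \<in> permutations_of_set A. set (takeWhile (\<lambda>x. x \<noteq> p) xs) = X}"
  proof (rule bij_betw_imageI)
    show "inj_on (\<lambda>(us, vs). us @ p # vs) (permutations_of_set X \<times> permutations_of_set ?Y)"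
    proof (intro inj_onI, clarify)
      fix us vs us' vs'
      assume m: "us \<in> permutations_of_set X" "us' \<in> permutations_of_set X" and eq: "us @ p # vs = us' @ p # vs'"
      have "p \<notin> set us" "p \<notin> set us'" using m X by (auto simp: permutations_of_set_def)
      then have "us = us'" using tw[of us vs] tw[of us' vs'] eq by simp
      with eq show "us = us' \<and> vs = vs'" by simp
    qed
    show "(\<lambda>(us, vs). us @ p # vs) ` (permutations_of_set X \<times> permutations_of_set ?Y) =
        {xs \<in> permutations_of_set A. set (takeWhile (\<lambda>x. x \<noteq> p) xs) = X}" (is "?L = ?R")
    proof
      show "?L \<subseteq> ?R" using A X tw by (auto simp: permutations_of_set_def)
      show "?R \<subseteq> ?L"
      proof
        fix xs assume xs: "xs \<in> ?R"
        then have "p \<in> set xs" "distinct xs" "set xs = A" using A by (auto simp: permutations_of_set_def)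
        then obtain us vs where s: "xs = us @ p # vs" by (meson split_list)
        then have "set us = X" using xs \<open>distinct xs\<close> tw by auto
        moreover have "set vs = ?Y" using s \<open>distinct xs\<close> \<open>set xs = A\<close> \<open>set us = X\<close> by auto
        ultimately show "xs \<in> ?L" using s \<open>distinct xs\<close>
          by (intro image_eqI[of _ _ "(us, vs)"]) (auto simp: permutations_of_set_def)
      qed
    qed
  qed
  then have "card {xs \<in> permutations_of_set A. set (takeWhile (\<lambda>x. x \<noteq> p) xs) = X} =
      fact (card X) * fact (card ?Y)"
    using fin by (simp add: bij_betw_same_card[symmetric] card_cartesian_product)
  moreover have "card ?Y = card A - card X - 1"
  proof -
    have "X \<subseteq> A" "p \<notin> X" using X by auto
    then show ?thesis using A fin by (simp add: card_Diff_subset card_Diff_singleton_if)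
  qed
  ultimately show ?thesis by simp
qed

text \<open>Whether \<open>p\<close> is missed depends only on the set \<open>X\<close> of its
  predecessors. Grouping the permutations by \<open>X\<close> and substituting the suffix
  \<open>S = A - X\<close> turns their counts into the weights \<open>wt\<close>.\<close>

lemma greedy_miss_probability:
  assumes A: "finite A" "p \<in> A" and r: "rank_fun r"
  shows "measure_pmf.expectation (pmf_of_set (permutations_of_set A))
      (\<lambda>xs. if in_greedy r xs p then 0 else 1) =
    (\<Sum>S\<in>Pow A. wt (card A) (card S) * (if p \<in> S \<and> r (insert p (A - S)) = r (A - S) then 1 else 0))"
proof -
  let ?P = "permutations_of_set A" and ?pre = "\<lambda>xs. set (takeWhile (\<lambda>x. x \<noteq> p) xs)"
  let ?g = "\<lambda>X. if r (insert p X) = r X then 1 else (0::real)"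
  have g: "(if in_greedy r xs p then 0 else 1) = ?g (?pre xs)" for xs
    using rank_fun_insert_ge[OF r, of "?pre xs" p] by (auto simp: in_greedy_def)
  have pre: "?pre ` ?P \<subseteq> Pow (A - {p})"
    by (auto simp: permutations_of_set_def dest: set_takeWhileD)
  have "measure_pmf.expectation (pmf_of_set ?P) (\<lambda>xs. if in_greedy r xs p then 0 else 1) =
      (\<Sum>xs\<in>?P. ?g (?pre xs)) / fact (card A)"
    using A unfolding g by (subst integral_pmf_of_set) auto
  also have "(\<Sum>xs\<in>?P. ?g (?pre xs)) = (\<Sum>X\<in>Pow (A - {p}). \<Sum>xs\<in>{xs\<in>?P. ?pre xs = X}. ?g (?pre xs))"
    using A pre by (intro sum.group[symmetric]) auto
  also have "\<dots> = (\<Sum>X\<in>Pow (A - {p}). fact (card X) * fact (card A - card X - 1) * ?g X)"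
    by (intro sum.cong) (auto simp: card_permutations_prefix[OF A])
  also have "\<dots> / fact (card A) = (\<Sum>X\<in>Pow (A - {p}). wt (card A) (card (A - X)) * ?g X)"
    unfolding sum_divide_distrib
  proof (intro sum.cong refl)
    fix X assume "X \<in> Pow (A - {p})"
    then have X: "X \<subseteq> A" "p \<notin> X" "finite X" using A finite_subset by auto
    have "card (A - X) = card A - card X" using X by (simp add: card_Diff_subset)
    moreover have "card X < card A" using X A by (intro psubset_card_mono) auto
    ultimately show "fact (card X) * fact (card A - card X - 1) * ?g X / fact (card A) = wt (card A) (card (A - X)) * ?g X"
      by (simp add: wt_def)
  qed
  also have "\<dots> = (\<Sum>S\<in>{S\<in>Pow A. p \<in> S}. wt (card A) (card S) * ?g (A - S))"
    by (rule sum.reindex_bij_witness[of _ "\<lambda>S. A - S" "\<lambda>X. A - X"]) (use A in \<open>auto simp: Diff_Diff_Int Int_absorb1 subset_Diff_insert\<close>)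
  also have "\<dots> = (\<Sum>S\<in>Pow A. wt (card A) (card S) * (if p \<in> S \<and> r (insert p (A - S)) = r (A - S) then 1 else 0))"
    using A by (intro sum.mono_neutral_cong_left) auto
  finally show ?thesis .
qed

section \<open>Paging algorithms\<close>

fun path_cost :: "nat \<Rightarrow> 'a option list \<Rightarrow> 'a option list list \<Rightarrow> nat" where
  "path_cost k s [] = 0"
| "path_cost k s (C # Cs) = retrievals k s C + path_cost k C Cs"

text \<open>An empty configuration in front of the sequence absorbs the special role of time
  0.\<close>

lemma cost_eq_path_cost: "cost k Cs = path_cost k (replicate k None) Cs"
proof -
  define X :: "config \<Rightarrow> config list \<Rightarrow> (nat \<times> nat \<times> nat) set" where
    "X s Cs = {(t, i, p). t < length Cs \<and> i < k \<and> Cs ! t ! i = Some p \<and> (s # Cs) ! t ! i \<noteq> Some p}" for s Cs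
  have main: "finite (X s Cs) \<and> card (X s Cs) = path_cost k s Cs" for s Cs
  proof (induction Cs arbitrary: s)
    case Nil
    then show ?case by (simp add: X_def case_prod_unfold)
  next
    case (Cons C Cs)
    let ?f = "\<lambda>i. (0 :: nat, i :: nat, the (C ! i))" and ?g = "\<lambda>(t, i :: nat, p :: nat). (Suc t, i, p)"
    let ?R = "{i. i < k \<and> C ! i \<noteq> None \<and> s ! i \<noteq> C ! i}"
    have eq: "X s (C # Cs) = ?f ` ?R \<union> ?g ` X C Cs" (is "?L = ?M")
    proof
      show "?L \<subseteq> ?M"
      proof
        fix z assume z: "z \<in> ?L"
        obtain t i p where [simp]: "z = (t, i, p)" by (cases z)
        show "z \<in> ?M"
        proof (cases t)
          case 0
          then have "z = ?f i" "i \<in> ?R" using z by (auto simp: X_def)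
          then show ?thesis by blast
        next
          case (Suc t')
          then have "z = ?g (t', i, p)" "(t', i, p) \<in> X C Cs" using z by (auto simp: X_def)
          then show ?thesis by blast
        qed
      qed
      show "?M \<subseteq> ?L" by (auto simp: X_def)
    qed
    have "finite (?f ` ?R)" "finite (?g ` X C Cs)" using Cons by auto
    moreover have "?f ` ?R \<inter> ?g ` X C Cs = {}" by auto
    moreover have "card (?f ` ?R) = retrievals k s C"
      unfolding retrievals_def by (intro card_image inj_onI) auto
    moreover have "card (?g ` X C Cs) = card (X C Cs)"
      by (intro card_image inj_onI) auto
    ultimately show ?case using Cons by (simp add: eq card_Un_disjoint)
  qed
  have "{(t, i, p). t < length Cs \<and> i < k \<and> Cs ! t ! i = Some p \<and> (t = 0 \<or> Cs ! (t - 1) ! i \<noteq> Some p)} =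
      X (replicate k None) Cs"
    unfolding X_def by (intro Collect_cong) (auto simp: nth_Cons' split: if_splits)
  then show ?thesis unfolding cost_def using main by simp
qed

fun loops :: "nat \<Rightarrow> ('a \<times> bool) list \<Rightarrow> 'a list \<Rightarrow> nat" where
  "loops k h [] = 0"
| "loops k h (p # ps) = (if rk k h {p} = 0 then 1 else 0) + loops k (mark k h p) ps"

fun set_cost :: "'a set \<Rightarrow> 'a set list \<Rightarrow> nat" where
  "set_cost D [] = 0"
| "set_cost D (D' # Ds) = card (D' - D) + set_cost D' Ds"

abbreviation set_serves :: "nat \<Rightarrow> 'a \<Rightarrow> 'a set \<Rightarrow> bool" where
  "set_serves k \<equiv> \<lambda>p D. finite D \<and> card D \<le> k \<and> p \<in> D"

abbreviation slots_serve :: "nat \<Rightarrow> 'a \<Rightarrow> 'a option list \<Rightarrow> bool" where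
  "slots_serve k \<equiv> \<lambda>p C. length C = k \<and> Some p \<in> set C"

text \<open>Summation of \<open>nullity_step\<close>; the final nullity is nonnegative. The bound
  holds for arbitrary cache sequences that serve the requests, and \<open>off_run\<close> later
  attains it.\<close>

lemma loops_le_set_cost:
  assumes "list_all2 (set_serves k) ps Ds" "valid_hist k h" "finite D"
  shows "loops k h ps + rk k h D \<le> card D + set_cost D Ds"
  using assms
proof (induction ps Ds arbitrary: h D rule: list_all2_induct)
  case Nil
  then show ?case
    using rank_fun_le_add_card[OF rank_fun_rk, of k h D "{}"] rank_fun_empty[OF rank_fun_rk, of k h] by simp
next
  case (Cons p ps D' Ds)
  then have "loops k (mark k h p) ps + rk k (mark k h p) D' \<le> card D' + set_cost D' Ds" by simp
  moreover have "card D' + (if rk k h {p} = 0 then 1 else 0) + rk k h D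
     \<le> card D + rk k (mark k h p) D' + card (D' - D)"
    using Cons by (intro nullity_step) auto
  ultimately show ?case by simp
qed

text \<open>The common form of the online algorithms, parametrized by the kernel \<open>nx\<close>
  that updates the order. The new order \<open>ys\<close> is drawn at the current request but takes
  effect only from the next one on.\<close>

fun prun :: "nat \<Rightarrow> ('a \<Rightarrow> 'a list \<Rightarrow> 'a list pmf) \<Rightarrow> 'a option list \<Rightarrow> ('a \<times> bool) list \<Rightarrow> 'a list \<Rightarrow>
    'a list \<Rightarrow> 'a option list list pmf" where
  "prun k nx s h xs [] = return_pmf []"
| "prun k nx s h xs (p # ps) = bind_pmf (nx p xs)
     (\<lambda>ys. map_pmf (\<lambda>Cs. serve k h xs p s # Cs) (prun k nx (serve k h xs p s) (mark k h p) ys ps))"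

lemma prun_serves:
  assumes nx: "\<And>p xs ys. ys \<in> set_pmf (nx p xs) \<Longrightarrow> reorder p xs ys"
  shows "cache_inv k s h xs \<Longrightarrow> Cs \<in> set_pmf (prun k nx s h xs ps) \<Longrightarrow>
    list_all2 (slots_serve k) ps Cs"
proof (induction ps arbitrary: s h xs Cs)
  case (Cons p ps)
  then obtain ys Cs' where ys: "ys \<in> set_pmf (nx p xs)" and Cs: "Cs = serve k h xs p s # Cs'"
    "Cs' \<in> set_pmf (prun k nx (serve k h xs p s) (mark k h p) ys ps)" by auto
  have "list_all2 (slots_serve k) ps Cs'"
    using Cons.IH[OF cache_inv_serve[OF Cons.prems(1) nx[OF ys]] Cs(2)] .
  moreover have "length s = k" using Cons.prems by (simp add: cache_inv_def)
  ultimately show ?case using serve_mem[OF Cons.prems(1)] by (simp add: Cs)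
qed simp

section \<open>The fault bound for arbitrary orders\<close>

text \<open>The deterministic bound holds for every order: between two loop requests, each fault turns a
  page into a coloop.\<close>

definition coloops :: "('a set \<Rightarrow> nat) \<Rightarrow> 'a set" where
  "coloops r = {e. r (UNIV - {e}) < r UNIV}"

text \<open>By submodularity a coloop remains a coloop when other elements are deleted, so deleting
  \<open>K\<close> element by element lowers the rank each time.\<close>

lemma card_coloops_le:
  assumes r: "rank_fun r" and "finite K" "K \<subseteq> coloops r"
  shows "card K \<le> r UNIV"
proof -
  have "r (UNIV - K) + card K \<le> r UNIV"
    using assms(2,3)
  proof (induction K rule: finite_induct)
    case (insert e K)
    have "r (insert e (UNIV - {e})) + r (UNIV - insert e K) \<le> r (insert e (UNIV - insert e K)) + r (UNIV - {e})"
      by (rule rank_fun_submod[OF r]) auto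
    moreover have "insert e (UNIV - {e}) = UNIV" "insert e (UNIV - insert e K) = UNIV - K"
      using insert by auto
    moreover have "r (UNIV - {e}) < r UNIV" using insert by (auto simp: coloops_def)
    ultimately show ?case using insert by simp
  qed simp
  then show ?thesis by simp
qed

lemma coloops_subset: "coloops (rk k h) \<subseteq> fst ` set h"
proof
  fix e assume e: "e \<in> coloops (rk k h)"
  show "e \<in> fst ` set h"
  proof (rule ccontr)
    assume "e \<notin> fst ` set h"
    from rk_loop[OF this, of k "UNIV - {e}"] e show False
      by (simp add: coloops_def)
  qed
qed

lemma finite_coloops: "finite (coloops (rk k h))"
  using coloops_subset finite_subset by (metis finite_imageI finite_set)

lemma coloops_in_greedy:
  assumes r: "rank_fun r" and "p \<in> coloops r"
  shows "in_greedy r xs p"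
proof -
  let ?A = "set (takeWhile (\<lambda>x. x \<noteq> p) xs)"
  have "?A \<subseteq> UNIV - {p}" by (auto dest: set_takeWhileD)
  from rank_fun_submod[OF r this, of p] have "r UNIV + r ?A \<le> r (insert p ?A) + r (UNIV - {p})"
    by (simp add: insert_Diff_if)
  then show ?thesis using assms(2) by (simp add: in_greedy_def coloops_def)
qed

text \<open>Contraction preserves coloops. Truncation may destroy them, so the second part is
  restricted to non-loops.\<close>

lemma mark_coloops:
  assumes h: "valid_hist k h"
  shows "p \<in> coloops (rk k (mark k h p))"
    and "rk k h {p} \<noteq> 0 \<Longrightarrow> coloops (rk k h) \<subseteq> coloops (rk k (mark k h p))"
proof -
  have "insert p (UNIV - {p}) = UNIV" by auto
  with rk_mark_coloop[OF h, of p "UNIV - {p}"] show p: "p \<in> coloops (rk k (mark k h p))"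
    by (simp add: coloops_def)
  assume nl: "rk k h {p} \<noteq> 0"
  show "coloops (rk k h) \<subseteq> coloops (rk k (mark k h p))"
  proof
    fix e assume e: "e \<in> coloops (rk k h)"
    show "e \<in> coloops (rk k (mark k h p))"
    proof (cases "e = p")
      case False
      then have "insert p (UNIV - {e}) = UNIV - {e}" by auto
      moreover have "1 \<le> rk k h (UNIV - {e})"
        using rank_fun_mono[OF rank_fun_rk[OF h], of "{p}" "UNIV - {e}"] nl False by auto
      ultimately show ?thesis using e nl False by (simp add: coloops_def mark_def)
    qed (simp add: p)
  qed
qed

lemma prun_cost_le:
  assumes nx: "\<And>p xs ys. ys \<in> set_pmf (nx p xs) \<Longrightarrow> reorder p xs ys"
  shows "cache_inv k s h xs \<Longrightarrow> Cs \<in> set_pmf (prun k nx s h xs ps) \<Longrightarrow>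
    path_cost k s Cs + card (coloops (rk k h)) \<le> k * loops k h ps + k"
proof (induction ps arbitrary: s h xs Cs)
  case Nil
  then have "valid_hist k h" "k \<ge> 1" by (auto simp: cache_inv_def)
  then show ?case
    using card_coloops_le[OF rank_fun_rk finite_coloops subset_refl, of k h] rk_le[of k h UNIV] Nil by simp
next
  case (Cons p ps)
  let ?s = "serve k h xs p s" and ?K = "coloops (rk k h)" and ?K' = "coloops (rk k (mark k h p))"
  have h: "valid_hist k h" "k \<ge> 1" and hx: "fst ` set h \<subseteq> set xs"
    using Cons.prems by (auto simp: cache_inv_def)
  obtain ys Cs' where ys: "ys \<in> set_pmf (nx p xs)" and Cs: "Cs = ?s # Cs'"
    "Cs' \<in> set_pmf (prun k nx ?s (mark k h p) ys ps)" using Cons.prems by auto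
  have IH: "path_cost k ?s Cs' + card ?K' \<le> k * loops k (mark k h p) ps + k"
    using Cons.IH[OF cache_inv_serve[OF Cons.prems(1) nx[OF ys]] Cs(2)] .
  have K: "card ?K \<le> k"
    using card_coloops_le[OF rank_fun_rk[OF h(1)] finite_coloops subset_refl] rk_le[OF h(2), of h UNIV] by simp
  have ret: "retrievals k s ?s \<le> (if Some p \<in> set s then 0 else 1)"
    by (rule retrievals_serve[OF Cons.prems(1)])
  have "retrievals k s ?s + card ?K \<le> card ?K' + k * (if rk k h {p} = 0 then 1 else 0)"
  proof (cases "rk k h {p} = 0")
    case True
    \<comment> \<open>A loop request may destroy up to \<open>k\<close> coloops, but
      \<open>p\<close> becomes one; this pays for the fault itself, so the charge is
      \<open>k\<close> instead of \<open>k + 1\<close>.\<close>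
    have "1 \<le> card ?K'"
      using mark_coloops(1)[OF h(1)] finite_coloops[of k "mark k h p"] by (auto simp: Suc_le_eq card_gt_0_iff)
    then show ?thesis using True K ret by (auto split: if_splits)
  next
    case False
    have sub: "?K \<subseteq> ?K'" by (rule mark_coloops(2)[OF h(1) False])
    show ?thesis
    proof (cases "Some p \<in> set s")
      case True
      then show ?thesis using ret card_mono[OF finite_coloops sub] by simp
    next
      case fault: False
      have "p \<in> set xs" using rk_nonloop_mem[OF False h(1)] hx by auto
      \<comment> \<open>Coloops belong to every greedy basis and are therefore cached, so a page
        that faults was none and becomes a new one.\<close>
      then have "p \<notin> ?K"
        using serve_fault_not_greedy[OF Cons.prems(1) fault] coloops_in_greedy[OF rank_fun_rk[OF h(1)]] by blast
      then have "?K \<subset> ?K'" using sub mark_coloops(1)[OF h(1)] by auto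
      from psubset_card_mono[OF finite_coloops this] ret fault show ?thesis by simp
    qed
  qed
  then show ?case using IH by (auto simp: Cs algebra_simps split: if_splits)
qed

lemma reorder_tl: "p \<in> set xs \<Longrightarrow> reorder p (p # xs) xs"
  and reorder_Cons: "reorder p xs (p # xs)"
  by (auto simp: reorder_def)

lemma reorder_insertion:
  assumes "p \<notin> set (us @ vs)"
  shows "reorder p (us @ vs) (us @ p # vs)"
  unfolding reorder_def
proof (intro conjI allI impI)
  fix e assume "e \<noteq> p"
  then show "set (takeWhile (\<lambda>x. x \<noteq> e) (us @ p # vs)) - {p} = set (takeWhile (\<lambda>x. x \<noteq> e) (us @ vs)) - {p}"
    by (cases "e \<in> set us") (auto simp: takeWhile_snoc_mem takeWhile_append)
qed auto

lemma reorder_self: "p \<in> set xs \<Longrightarrow> reorder p xs xs"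
  by (auto simp: reorder_def)

text \<open>The order is consumed along with the requests. It is started with a second copy of the
  whole sequence behind the first, so that a page does not vanish from the order after its last
  request.\<close>

fun off_run :: "nat \<Rightarrow> 'a option list \<Rightarrow> ('a \<times> bool) list \<Rightarrow> 'a list \<Rightarrow> 'a list \<Rightarrow> 'a option list list" where
  "off_run k s h xs [] = []"
| "off_run k s h xs (p # ps) =
     serve k h xs p s # off_run k (serve k h xs p s) (mark k h p) (tl xs) ps"

text \<open>With the remaining requests as the order, the requested page comes first, so that the greedy
  basis contains it unless it is a loop.\<close>

lemma off_run_correct:
  assumes "cache_inv k s h (ps @ zs)" "set ps \<subseteq> set zs"
  shows "list_all2 (slots_serve k) ps (off_run k s h (ps @ zs) ps) \<and>
    path_cost k s (off_run k s h (ps @ zs) ps) \<le> loops k h ps"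
  using assms
proof (induction ps arbitrary: s h)
  case (Cons p ps)
  let ?s = "serve k h (p # ps @ zs) p s"
  have I: "cache_inv k s h (p # ps @ zs)" using Cons.prems by simp
  have len: "length s = k" and r: "rank_fun (rk k h)" using I rank_fun_rk by (auto simp: cache_inv_def)
  have "reorder p (p # ps @ zs) (ps @ zs)" using Cons.prems by (intro reorder_tl) auto
  from Cons.IH[OF cache_inv_serve[OF I this]] Cons.prems
  have IH: "list_all2 (slots_serve k) ps (off_run k ?s (mark k h p) (ps @ zs) ps)"
    "path_cost k ?s (off_run k ?s (mark k h p) (ps @ zs) ps) \<le> loops k (mark k h p) ps" by auto
  have "retrievals k s ?s \<le> (if rk k h {p} = 0 then 1 else 0)"
  proof (cases "Some p \<in> set s")
    case True
    then show ?thesis using retrievals_serve[OF I, of p] by simp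
  next
    case False
    then have "\<not> in_greedy (rk k h) (p # ps @ zs) p"
      by (intro serve_fault_not_greedy[OF I]) auto
    then have "rk k h {p} = 0" using rank_fun_empty[OF r] by (simp add: in_greedy_def)
    then show ?thesis using retrievals_serve[OF I, of p] False by simp
  qed
  then show ?case using IH serve_mem[OF I, of p] len by simp
qed simp

section \<open>The randomized algorithm: a page is inserted at a random position at its first
  request\<close>

definition ins_kernel :: "'a \<Rightarrow> 'a list \<Rightarrow> 'a list pmf" where
  "ins_kernel p xs = (if p \<in> set xs then return_pmf xs
     else map_pmf (\<lambda>i. take i xs @ p # drop i xs) (pmf_of_set {..<Suc (length xs)}))"

lemma ins_kernel_reorder: "ys \<in> set_pmf (ins_kernel p xs) \<Longrightarrow> reorder p xs ys"
proof (cases "p \<in> set xs")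
  case False
  assume "ys \<in> set_pmf (ins_kernel p xs)"
  then obtain i where "ys = take i xs @ p # drop i xs"
    using False by (auto simp: ins_kernel_def)
  then show ?thesis using False reorder_insertion[of p "take i xs" "drop i xs"] by simp
qed (simp add: ins_kernel_def reorder_self)

lemma finite_ins_kernel: "finite (set_pmf (ins_kernel p xs))"
  by (simp add: ins_kernel_def set_pmf_of_set lessThan_empty_iff)

text \<open>An order of \<open>insert p A\<close> with \<open>p\<close> new corresponds to exactly
  one pair of an order of \<open>A\<close> and a gap in it.\<close>

lemma ins_kernel_uniform:
  assumes A: "finite A"
  shows "bind_pmf (pmf_of_set (permutations_of_set A)) (ins_kernel p) =
    pmf_of_set (permutations_of_set (insert p A))"
proof (cases "p \<in> A")
  case True
  have "bind_pmf (pmf_of_set (permutations_of_set A)) (ins_kernel p) =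
      bind_pmf (pmf_of_set (permutations_of_set A)) return_pmf"
    using True A by (intro bind_pmf_cong) (auto simp: ins_kernel_def dest: permutations_of_setD)
  then show ?thesis using True by (simp add: bind_return_pmf' insert_absorb)
next
  case False
  let ?n = "card A" and ?f = "\<lambda>(xs, i). take i xs @ p # drop i xs"
  have len: "length xs = ?n" if "xs \<in> permutations_of_set A" for xs
    using that by (auto simp: permutations_of_set_def distinct_card)
  have "bind_pmf (pmf_of_set (permutations_of_set A)) (ins_kernel p) =
      bind_pmf (pmf_of_set (permutations_of_set A))
        (\<lambda>xs. map_pmf (\<lambda>i. ?f (xs, i)) (pmf_of_set {..<Suc ?n}))"
    using False A len by (intro bind_pmf_cong) (auto simp: ins_kernel_def dest: permutations_of_setD)
  also have "\<dots> = map_pmf ?f (pair_pmf (pmf_of_set (permutations_of_set A)) (pmf_of_set {..<Suc ?n}))"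
    by (simp add: pair_pmf_def map_bind_pmf map_pmf_def[symmetric] bind_map_pmf map_pmf_comp)
  also have "pair_pmf (pmf_of_set (permutations_of_set A)) (pmf_of_set {..<Suc ?n}) =
      pmf_of_set (permutations_of_set A \<times> {..<Suc ?n})"
    using A by (intro pmf_eqI)
      (auto simp: pmf_pair pmf_of_set card_cartesian_product lessThan_empty_iff indicator_def algebra_simps split: prod.splits)
  also have "map_pmf ?f \<dots> = pmf_of_set (permutations_of_set (insert p A))"
  proof (intro map_pmf_of_set_bij_betw bij_betw_imageI)
    show "inj_on ?f (permutations_of_set A \<times> {..<Suc ?n})"
    proof (intro inj_onI, clarify)
      fix xs i ys j
      assume m: "xs \<in> permutations_of_set A" "ys \<in> permutations_of_set A" "i < Suc ?n" "j < Suc ?n"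
        and eq: "take i xs @ p # drop i xs = take j ys @ p # drop j ys"
      have "p \<notin> set (take i xs)" "p \<notin> set (take j ys)"
        using m False by (auto simp: permutations_of_set_def dest: in_set_takeD)
      then have "takeWhile (\<lambda>x. x \<noteq> p) (take i xs @ p # drop i xs) = take i xs"
        "takeWhile (\<lambda>x. x \<noteq> p) (take j ys @ p # drop j ys) = take j ys"
        by (subst takeWhile_append2; auto)+
      then have t: "take i xs = take j ys" using eq by simp
      then have "length (take i xs) = length (take j ys)" by simp
      then have "i = j" using m len[of xs] len[of ys] by simp
      moreover have "drop i xs = drop j ys" using eq t by simp
      ultimately show "xs = ys \<and> i = j" using t by (metis append_take_drop_id)
    qed
    show "?f ` (permutations_of_set A \<times> {..<Suc ?n}) = permutations_of_set (insert p A)" (is "?L = ?R")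
    proof
      show "?L \<subseteq> ?R"
      proof clarify
        fix xs i assume xs: "xs \<in> permutations_of_set A"
        have "set (take i xs) \<union> set (drop i xs) = A"
          using xs by (metis append_take_drop_id permutations_of_setD(1) set_append)
        moreover have "distinct xs" using xs by (rule permutations_of_setD)
        moreover have "set (take i xs) \<inter> set (drop i xs) = {}"
          using \<open>distinct xs\<close> by (intro set_take_disj_set_drop_if_distinct) auto
        ultimately show "take i xs @ p # drop i xs \<in> ?R"
          using False by (auto simp: permutations_of_set_def)
      qed
      show "?R \<subseteq> ?L"
      proof
        fix ys assume ys: "ys \<in> ?R"
        then have "p \<in> set ys" by (auto simp: permutations_of_set_def)
        then obtain us vs where s: "ys = us @ p # vs" by (meson split_list)
        have xs: "us @ vs \<in> permutations_of_set A"
          using ys False by (auto simp: s permutations_of_set_def)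
        then have "length us < Suc ?n" using len[OF xs] by simp
        then show "ys \<in> ?L" using xs by (intro image_eqI[of _ _ "(us @ vs, length us)"]) (auto simp: s)
      qed
    qed
  qed (use A in auto)
  finally show ?thesis .
qed

lemma expectation_bind:
  fixes g :: "'b \<Rightarrow> real"
  assumes "finite (set_pmf M)" "\<And>x. x \<in> set_pmf M \<Longrightarrow> finite (set_pmf (f x))"
  shows "measure_pmf.expectation (bind_pmf M f) g =
    measure_pmf.expectation M (\<lambda>x. measure_pmf.expectation (f x) g)"
  by (subst pmf_expectation_bind[OF assms subset_refl])
    (auto simp: integral_measure_pmf[OF assms(1)] mult.commute)

lemma finite_prun:
  assumes "\<And>p xs. finite (set_pmf (nx p xs))"
  shows "finite (set_pmf (prun k nx s h xs ps))"
  using assms by (induction ps arbitrary: s h xs) auto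

text \<open>\<open>M\<close> is the joint distribution of cache and order. Only the order has to be
  uniform: at a non-loop, a fault implies that the order leaves \<open>p\<close> out of the greedy
  basis, however the cache is correlated with it. The ground set \<open>A\<close> grows with the
  requests, whereas \<open>U\<close> fixes the additive constant in advance.\<close>

lemma prun_ins_expected_cost:
  fixes M :: "('a option list \<times> 'a list) pmf"
  assumes U: "finite U"
  shows "finite (set_pmf M) \<Longrightarrow> finite A \<Longrightarrow> A \<union> set ps \<subseteq> U \<Longrightarrow> k \<ge> 1 \<Longrightarrow> valid_hist k h \<Longrightarrow>
    map_pmf snd M = pmf_of_set (permutations_of_set A) \<Longrightarrow> fst ` set h \<subseteq> A \<Longrightarrow>
    (\<And>s xs. (s, xs) \<in> set_pmf M \<Longrightarrow> cache_inv k s h xs) \<Longrightarrow>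
    measure_pmf.expectation M (\<lambda>(s, xs). measure_pmf.expectation (prun k ins_kernel s h xs ps)
      (\<lambda>Cs. real (path_cost k s Cs)))
    \<le> harm k * real (loops k h ps) + pot A (rk k h) + real k * 2 ^ card U"
proof (induction ps arbitrary: M A h)
  case Nil
  have "- (real k * 2 ^ card A) \<le> pot A (rk k h)"
    using Nil by (intro pot_ge rk_le) auto
  moreover have "real k * 2 ^ card A \<le> real k * 2 ^ card U"
    using Nil U by (intro mult_left_mono power_increasing card_mono) auto
  ultimately show ?case by (simp add: case_prod_unfold)
next
  case (Cons p ps)
  let ?E = "measure_pmf.expectation"
  let ?s = "\<lambda>s xs. serve k h xs p s" and ?A = "insert p A"
  define M' where "M' = bind_pmf M (\<lambda>(s, xs). map_pmf (\<lambda>ys. (?s s xs, ys)) (ins_kernel p xs))"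
  define G where "G = (\<lambda>(s, xs). ?E (prun k ins_kernel s (mark k h p) xs ps) (\<lambda>Cs. real (path_cost k s Cs)))"
  note finM = Cons.prems(1) and finA = Cons.prems(2) and k = Cons.prems(4) and h = Cons.prems(5)
    and unif = Cons.prems(6) and hA = Cons.prems(7) and I = Cons.prems(8)
  note r = rank_fun_rk[OF h]
  have finM': "finite (set_pmf M')"
    using finM by (auto simp: M'_def finite_ins_kernel)
  have E': "?E M' G = ?E M (\<lambda>(s, xs). ?E (ins_kernel p xs) (\<lambda>ys. G (?s s xs, ys)))"
    unfolding M'_def by (subst expectation_bind) (use finM in \<open>auto simp: case_prod_unfold finite_ins_kernel\<close>)
  have IH: "?E M' G \<le> harm k * real (loops k (mark k h p) ps) + pot ?A (rk k (mark k h p)) + real k * 2 ^ card U"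
    unfolding G_def
  proof (rule Cons.IH[OF finM'])
    have "map_pmf snd M' = bind_pmf M (\<lambda>z. ins_kernel p (snd z))"
      unfolding M'_def by (simp add: map_bind_pmf case_prod_unfold map_pmf_comp)
    also have "\<dots> = bind_pmf (map_pmf snd M) (ins_kernel p)" by (simp add: bind_map_pmf)
    also have "\<dots> = pmf_of_set (permutations_of_set ?A)"
      unfolding unif by (rule ins_kernel_uniform[OF finA])
    finally show "map_pmf snd M' = pmf_of_set (permutations_of_set ?A)" .
    fix s' ys assume "(s', ys) \<in> set_pmf M'"
    then obtain s xs where "(s, xs) \<in> set_pmf M" "s' = ?s s xs" "ys \<in> set_pmf (ins_kernel p xs)"
      by (auto simp: M'_def)
    then show "cache_inv k s' (mark k h p) ys"
      using cache_inv_serve[OF I ins_kernel_reorder] by blast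
  qed (use Cons.prems in auto)
  have step: "?E (prun k ins_kernel s h xs (p # ps)) (\<lambda>Cs. real (path_cost k s Cs)) \<le>
      (if Some p \<in> set s then 0 else 1) + ?E (ins_kernel p xs) (\<lambda>ys. G (?s s xs, ys))"
    if "(s, xs) \<in> set_pmf M" for s xs
  proof -
    have fin: "finite (set_pmf (prun k ins_kernel a b c d))" for a b d and c :: "'a list"
      by (intro finite_prun finite_ins_kernel)
    have "?E (prun k ins_kernel s h xs (p # ps)) (\<lambda>Cs. real (path_cost k s Cs)) =
        ?E (ins_kernel p xs) (\<lambda>ys. real (retrievals k s (?s s xs)) + G (?s s xs, ys))"
      by (subst prun.simps, subst expectation_bind)
        (auto simp: finite_ins_kernel fin G_def integrable_measure_pmf_finite)
    also have "\<dots> = real (retrievals k s (?s s xs)) + ?E (ins_kernel p xs) (\<lambda>ys. G (?s s xs, ys))"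
      by (simp add: finite_ins_kernel integrable_measure_pmf_finite)
    also have "real (retrievals k s (?s s xs)) \<le> (if Some p \<in> set s then 0 else 1)"
      using retrievals_serve[OF I[OF that], of p] by (auto split: if_splits)
    finally show ?thesis by simp
  qed
  have "?E M (\<lambda>(s, xs). ?E (prun k ins_kernel s h xs (p # ps)) (\<lambda>Cs. real (path_cost k s Cs)))
    \<le> ?E M (\<lambda>(s, xs). (if Some p \<in> set s then 0 else 1) + ?E (ins_kernel p xs) (\<lambda>ys. G (?s s xs, ys)))"
    by (intro integral_mono_AE integrable_measure_pmf_finite finM AE_pmfI) (use step in auto)
  also have "\<dots> = ?E M (\<lambda>(s, xs). if Some p \<in> set s then 0 else 1) + ?E M' G"
    unfolding E' by (subst Bochner_Integration.integral_add[symmetric])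
      (auto simp: case_prod_unfold integrable_measure_pmf_finite finM)
  finally have total: "?E M (\<lambda>(s, xs). ?E (prun k ins_kernel s h xs (p # ps)) (\<lambda>Cs. real (path_cost k s Cs)))
    \<le> ?E M (\<lambda>(s, xs). if Some p \<in> set s then 0 else 1) + ?E M' G" .
  \<comment> \<open>A loop costs at most one and is paid for by \<open>pot_truncate\<close>. At a
    non-loop the expected cost is at most the probability of missing \<open>p\<close>, which is
    exactly the drop of the potential.\<close>
  have pot_step: "?E M (\<lambda>(s, xs). if Some p \<in> set s then 0 else 1) + pot ?A (rk k (mark k h p))
    \<le> pot A (rk k h) + harm k * (if rk k h {p} = 0 then 1 else 0)"
  proof (cases "rk k h {p} = 0")
    case True
    have "?E M (\<lambda>(s, xs). if Some p \<in> set s then 0 else 1) \<le> ?E M (\<lambda>_. 1 :: real)"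
      by (intro integral_mono_AE integrable_measure_pmf_finite finM AE_pmfI) auto
    moreover have "1 + pot ?A (rk k (mark k h p)) \<le> pot ?A (rk k h) + harm k"
      using True finA k by (intro pot_truncate[OF r, of ?A p]) (auto simp: rk_le mark_def)
    moreover have "pot ?A (rk k h) = pot A (rk k h)"
      by (intro pot_insert_loop finA rank_fun_loop[OF r True])
    ultimately show ?thesis using True by simp
  next
    case False
    have pA: "p \<in> A" using rk_nonloop_mem[OF False h] hA by auto
    have "?E M (\<lambda>(s, xs). if Some p \<in> set s then 0 else 1) \<le>
        ?E M (\<lambda>z. if in_greedy (rk k h) (snd z) p then 0 else (1 :: real))"
    proof (intro integral_mono_AE integrable_measure_pmf_finite finM AE_pmfI)
      fix z assume z: "z \<in> set_pmf M"
      obtain s xs where [simp]: "z = (s, xs)" by (cases z)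
      have "xs \<in> set_pmf (map_pmf snd M)" using z by force
      then have "p \<in> set xs" using pA finA unfolding unif by (auto dest: permutations_of_setD)
      then show "(case z of (s, xs) \<Rightarrow> if Some p \<in> set s then 0 else 1) \<le>
          (if in_greedy (rk k h) (snd z) p then 0 else (1::real))"
        using serve_fault_not_greedy[OF I, of s xs p] z by auto
    qed
    also have "\<dots> = ?E (map_pmf snd M) (\<lambda>xs. if in_greedy (rk k h) xs p then 0 else 1)"
      by simp
    also have "\<dots> = pot A (rk k h) - pot A (rk k (mark k h p))"
      unfolding unif using False
      by (subst greedy_miss_probability[OF finA pA r], subst pot_contract[OF r finA pA False]) (auto simp: mark_def)
    finally show ?thesis using False pA by (simp add: insert_absorb)
  qed
  show ?case using total pot_step IH by (simp add: algebra_simps split: if_splits)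
qed

section \<open>Resolving set requests to pages\<close>

text \<open>The default \<open>Min P\<close> makes the initial answers coherent: if
  \<open>Min Q\<close> lies in a subset \<open>P\<close> of \<open>Q\<close>, it is also
  \<open>Min P\<close>.\<close>

fun lookup :: "(nat set \<times> nat) list \<Rightarrow> nat set \<Rightarrow> nat" where
  "lookup [] P = Min P"
| "lookup ((Q, q) # rh) P = (if Q \<subseteq> P then q else lookup rh P)"

fun resolve :: "(nat set \<times> nat) list \<Rightarrow> nat set list \<Rightarrow> nat list" where
  "resolve rh [] = []"
| "resolve rh (P # \<pi>) = lookup rh P # resolve ((P, lookup rh P) # rh) \<pi>"

text \<open>The height enters as \<open>depth\<close>: in a laminar family the sets around a page
  form a chain.\<close>

locale laminar_family =
  fixes \<P> :: "nat set set" and h :: nat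
  assumes fin: "finite \<P>" and nonempty: "\<And>P. P \<in> \<P> \<Longrightarrow> finite P \<and> P \<noteq> {}"
    and lam: "laminar \<P>" and depth: "\<And>y. card {P\<in>\<P>. y \<in> P} \<le> h"
begin

lemma nested: "P \<in> \<P> \<Longrightarrow> Q \<in> \<P> \<Longrightarrow> x \<in> P \<Longrightarrow> x \<in> Q \<Longrightarrow> P \<subseteq> Q \<or> Q \<subseteq> P"
  using lam by (auto simp: laminar_def)

definition served :: "nat set \<Rightarrow> nat set set" where
  "served C = {P\<in>\<P>. P \<inter> C \<noteq> {}}"

definition roots :: "nat set \<Rightarrow> nat set set" where
  "roots C = {P\<in>served C. \<forall>Q\<in>\<P>. \<not> P \<subset> Q}"

text \<open>Coherence makes the answers of a chain of sets constant on intervals of the chain.\<close>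

definition coherent :: "(nat set \<Rightarrow> nat) \<Rightarrow> bool" where
  "coherent r \<longleftrightarrow> (\<forall>P\<in>\<P>. r P \<in> P) \<and> (\<forall>P\<in>\<P>. \<forall>Q\<in>\<P>. P \<subseteq> Q \<longrightarrow> r Q \<in> P \<longrightarrow> r P = r Q)"

definition ownership :: "nat set \<Rightarrow> (nat set \<Rightarrow> nat) \<Rightarrow> bool" where
  "ownership C own \<longleftrightarrow> (\<forall>P\<in>served C. own P \<in> C \<inter> P)"

text \<open>Sets with the same owner contain it and hence form a chain, so each owner has a single
  top set. The answers of the top sets therefore fit into a cache of the size of
  \<open>C\<close>.\<close>

definition tops :: "nat set \<Rightarrow> (nat set \<Rightarrow> nat) \<Rightarrow> nat set set" where
  "tops C own = {P\<in>served C. \<forall>Q\<in>served C. P \<subset> Q \<longrightarrow> own Q \<noteq> own P}"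

definition pairs :: "nat set \<Rightarrow> (nat set \<Rightarrow> nat) \<Rightarrow> (nat set \<Rightarrow> nat) \<Rightarrow> (nat \<times> nat) set" where
  "pairs C r own = (\<lambda>P. (own P, r P)) ` served C"

text \<open>Loading a page can create \<open>h\<close> pairs and one newly cached answer,
  \<open>h + 1\<close> in total, only if the page also reaches a new root; counting roots negatively
  gives that one back.\<close>

definition pot_own :: "nat set \<Rightarrow> (nat set \<Rightarrow> nat) \<Rightarrow> (nat set \<Rightarrow> nat) \<Rightarrow> int" where
  "pot_own C r own = int (card (pairs C r own)) - int (card (roots C))"

lemma finite_served [simp]: "finite (served C)"
  using fin by (simp add: served_def)

lemma finite_tops [simp]: "finite (tops C own)"
  by (simp add: tops_def)

lemma finite_pairs [simp]: "finite (pairs C r own)"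
  by (simp add: pairs_def)

lemma finite_roots [simp]: "finite (roots C)"
  by (simp add: roots_def)

lemma served_in: "P \<in> served C \<Longrightarrow> P \<in> \<P>"
  by (simp add: served_def)

lemma tops_eqI:
  assumes "ownership C own" "P \<in> tops C own" "Q \<in> tops C own" "own P = own Q"
  shows "P = Q"
proof -
  have "own P \<in> P" "own P \<in> Q" "P \<in> \<P>" "Q \<in> \<P>"
    using assms by (auto simp: ownership_def tops_def served_in)
  from nested[OF this(3,4,1,2)] show ?thesis
    using assms by (auto simp: tops_def psubset_eq)
qed

lemma card_tops_le:
  assumes "ownership C own" "finite C"
  shows "card (r ` tops C own) \<le> card C"
proof -
  have "card (r ` tops C own) \<le> card (tops C own)" by (rule card_image_le) simp
  also have "\<dots> = card (own ` tops C own)"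
    using tops_eqI[OF assms(1)] by (intro card_image[symmetric] inj_onI)
  also have "\<dots> \<le> card C"
    using assms by (intro card_mono) (auto simp: ownership_def tops_def)
  finally show ?thesis .
qed

section \<open>The potential when a page is dropped, loaded or requested\<close>

lemma exists_above:
  assumes "P \<in> A" "finite A"
  shows "\<exists>T\<in>A. P \<subseteq> T \<and> (\<forall>Q\<in>A. \<not> T \<subset> Q)"
  using finite_has_maximal2[OF assms(2,1)] by (metis order_less_le)

text \<open>Distinct roots are disjoint, so their owners and hence their pairs differ.\<close>

lemma pot_own_nonneg:
  assumes "ownership C own"
  shows "0 \<le> pot_own C r own"
proof -
  have "inj_on (\<lambda>P. (own P, r P)) (roots C)"
  proof (intro inj_onI)
    fix P Q assume PQ: "P \<in> roots C" "Q \<in> roots C" "(own P, r P) = (own Q, r Q)"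
    then have "own P \<in> P" "own P \<in> Q" "P \<in> \<P>" "Q \<in> \<P>"
      using assms by (auto simp: ownership_def roots_def served_in)
    from nested[OF this(3,4,1,2)] show "P = Q"
      using PQ by (auto simp: roots_def served_def)
  qed
  then have "card (roots C) = card ((\<lambda>P. (own P, r P)) ` roots C)" by (simp add: card_image)
  also have "\<dots> \<le> card (pairs C r own)"
    unfolding pairs_def by (intro card_mono) (auto simp: roots_def)
  finally show ?thesis by (simp add: pot_own_def)
qed

text \<open>The sets owned by \<open>x\<close> that remain served form a chain. A remaining page
  \<open>z\<close> in the smallest of them lies in all, so it can inherit everything; merging owners
  creates no new top set or pair. If a root \<open>R\<close> is lost, \<open>x\<close> was its only
  page and no remaining set was owned by \<open>x\<close>, so the loss of the pair
  \<open>(x, r R)\<close> compensates.\<close>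

lemma drop_page:
  assumes own: "ownership C own" and x: "x \<in> C"
  shows "\<exists>own'. ownership (C - {x}) own' \<and> r ` tops (C - {x}) own' \<subseteq> r ` tops C own \<and>
    pot_own (C - {x}) r own' \<le> pot_own C r own"
proof -
  let ?C = "C - {x}"
  have sub: "served ?C \<subseteq> served C" by (auto simp: served_def)
  let ?O = "{P\<in>served ?C. own P = x}"
  have "\<exists>z. \<forall>P\<in>?O. z \<in> P \<inter> ?C"
  proof (cases "?O = {}")
    case False
    then obtain M where M: "M \<in> ?O" "\<forall>P\<in>?O. P \<subseteq> M \<longrightarrow> M = P"
      using finite_has_minimal[of ?O] by auto
    then obtain z where z: "z \<in> M \<inter> ?C" by (auto simp: served_def)
    have "z \<in> P \<inter> ?C" if P: "P \<in> ?O" for P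
    proof -
      have "x \<in> P" "x \<in> M" using P M(1) own subsetD[OF sub, of P] subsetD[OF sub, of M] unfolding ownership_def by fastforce+
      from nested[OF _ _ this] P M have "M \<subseteq> P" by (auto simp: served_in)
      then show ?thesis using z by auto
    qed
    then show ?thesis by blast
  qed auto
  then obtain z where z: "\<And>P. P \<in> served ?C \<Longrightarrow> own P = x \<Longrightarrow> z \<in> P \<inter> ?C" by blast
  define own' where "own' = (\<lambda>P. if own P = x then z else own P)"
  have "ownership ?C own'"
    using own z sub by (auto simp: ownership_def own'_def)
  moreover have "tops ?C own' \<subseteq> tops C own"
  proof
    fix P assume P: "P \<in> tops ?C own'"
    have "own Q \<noteq> own P" if "Q \<in> served C" "P \<subset> Q" for Q
    proof -
      have "Q \<in> served ?C" using that P by (auto simp: served_def tops_def)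
      then have "own' Q \<noteq> own' P" using P that(2) unfolding tops_def by blast
      then show ?thesis unfolding own'_def by metis
    qed
    then show "P \<in> tops C own" using P sub by (auto simp: tops_def)
  qed
  moreover have "card (pairs ?C r own') + card (roots C) \<le> card (pairs C r own) + card (roots ?C)"
  proof -
    let ?p = "(\<lambda>P. (own P, r P)) ` served ?C"
    have "pairs ?C r own' = (\<lambda>(a, v). (if a = x then z else a, v)) ` ?p"
      by (auto simp: pairs_def own'_def image_image)
    then have 1: "card (pairs ?C r own') \<le> card ?p" by (simp add: card_image_le)
    have psub: "?p \<subseteq> pairs C r own" using sub by (auto simp: pairs_def)
    show ?thesis
    proof (cases "roots C \<subseteq> roots ?C")
      case True
      then show ?thesis using 1 card_mono[OF finite_pairs psub] card_mono[OF finite_roots True] by simp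
    next
      case False
      then obtain R where R: "R \<in> roots C" "R \<notin> roots ?C" by auto
      then have nR: "R \<notin> served ?C" and RC: "R \<in> served C" "R \<in> \<P>" by (auto simp: roots_def served_in)
      have oR: "own R = x" "x \<in> R"
        using own RC nR by (auto simp: ownership_def served_def)
      have "roots C \<subseteq> insert R (roots ?C)"
      proof
        fix Q assume Q: "Q \<in> roots C"
        show "Q \<in> insert R (roots ?C)"
        proof (cases "Q \<in> served ?C")
          case True
          then show ?thesis using Q by (auto simp: roots_def)
        next
          case False
          then have "x \<in> Q" "Q \<in> \<P>" using Q by (auto simp: roots_def served_def)
          from nested[OF this(2) RC(2) this(1) oR(2)] have "Q = R"
            using Q R RC \<open>Q \<in> \<P>\<close> by (auto simp: roots_def)
          then show ?thesis by simp
        qed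
      qed
      then have "card (roots C) \<le> card (insert R (roots ?C))" by (intro card_mono) auto
      also have "\<dots> \<le> Suc (card (roots ?C))" by (rule card_insert_le_m1) auto
      finally have 2: "card (roots C) \<le> Suc (card (roots ?C))" .
      have "(x, r R) \<notin> ?p"
      proof
        assume "(x, r R) \<in> ?p"
        then obtain P where P: "P \<in> served ?C" "own P = x" by auto
        then have "x \<in> P" "P \<in> \<P>" using own sub by (auto simp: ownership_def served_in)
        from nested[OF this(2) RC(2) this(1) oR(2)] have "P \<subseteq> R"
          using R(1) \<open>P \<in> \<P>\<close> by (auto simp: roots_def)
        then show False using P nR RC by (auto simp: served_def)
      qed
      moreover have "(x, r R) \<in> pairs C r own" using RC oR by (auto simp: pairs_def)
      ultimately have "?p \<subset> pairs C r own" using psub by auto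
      from psubset_card_mono[OF finite_pairs this] show ?thesis using 1 2 by simp
    qed
  qed
  ultimately show ?thesis
    by (intro exI[of _ own']) (auto simp: pot_own_def)
qed

text \<open>The new page \<open>y\<close> becomes the owner of exactly the sets \<open>N\<close>
  that only it serves. Other owners stay, so at most one new top set arises. If \<open>N\<close> has
  \<open>h\<close> members, it contains the root above \<open>y\<close>, which is then a new
  root.\<close>

lemma add_page:
  assumes own: "ownership C own"
  shows "\<exists>own'. ownership (insert y C) own' \<and>
    int (card (r ` tops (insert y C) own' - r ` tops C own)) + pot_own (insert y C) r own'
      \<le> pot_own C r own + int h"
proof -
  let ?C = "insert y C"
  define N where "N = {P\<in>\<P>. y \<in> P \<and> P \<inter> C = {}}"
  have S: "served ?C = served C \<union> N" by (auto simp: served_def N_def)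
  have disj: "served C \<inter> N = {}" by (auto simp: served_def N_def)
  have finN: "finite N" using fin by (simp add: N_def)
  define own' where "own' = (\<lambda>P. if P \<in> served C then own P else y)"
  have own': "ownership ?C own'"
    using own by (auto simp: ownership_def own'_def S N_def)
  have "r ` tops ?C own' - r ` tops C own \<subseteq> r ` (N \<inter> tops ?C own')"
  proof -
    have "P \<in> tops C own" if "P \<in> tops ?C own'" "P \<notin> N" for P
      using that by (auto simp: tops_def S own'_def)
    then show ?thesis by blast
  qed
  then have "card (r ` tops ?C own' - r ` tops C own) \<le> card (r ` (N \<inter> tops ?C own'))"
    by (intro card_mono) (auto simp: finN)
  also have "\<dots> \<le> card (N \<inter> tops ?C own')" by (intro card_image_le) (simp add: finN)
  also have "\<dots> \<le> (if N = {} then 0 else 1)"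
  proof -
    have "P = Q" if "P \<in> N \<inter> tops ?C own'" "Q \<in> N \<inter> tops ?C own'" for P Q
      using that disj by (intro tops_eqI[OF own']) (auto simp: own'_def)
    then have "card (N \<inter> tops ?C own') \<le> Suc 0"
      using finN by (subst card_le_Suc0_iff_eq) auto
    then show ?thesis by auto
  qed
  finally have 1: "card (r ` tops ?C own' - r ` tops C own) \<le> (if N = {} then 0 else 1)" .
  have "pairs ?C r own' = pairs C r own \<union> (\<lambda>P. (y, r P)) ` N"
  proof -
    have "(\<lambda>P. (own' P, r P)) ` N = (\<lambda>P. (y, r P)) ` N"
      using disj by (intro image_cong) (auto simp: own'_def)
    moreover have "(\<lambda>P. (own' P, r P)) ` served C = pairs C r own"
      unfolding pairs_def by (intro image_cong) (auto simp: own'_def)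
    ultimately show ?thesis by (simp add: pairs_def S image_Un)
  qed
  then have "card (pairs ?C r own') \<le> card (pairs C r own) + card ((\<lambda>P. (y, r P)) ` N)"
    by (simp add: card_Un_le)
  then have 2: "card (pairs ?C r own') \<le> card (pairs C r own) + card N"
    using card_image_le[OF finN, of "\<lambda>P. (y, r P)"] by simp
  have rsub: "roots C \<subseteq> roots ?C" by (auto simp: roots_def S)
  have 3: "card (roots C) \<le> card (roots ?C)" by (rule card_mono[OF finite_roots rsub])
  have fy: "finite {P\<in>\<P>. y \<in> P}" using fin by simp
  have "(if N = {} then 0 else 1) + card N + card (roots C) \<le> card (roots ?C) + h"
  proof (cases "N = {}")
    case True
    then show ?thesis using 3 by simp
  next
    case False
    then obtain P where P: "P \<in> N" by auto
    then obtain R where R: "R \<in> \<P>" "P \<subseteq> R" "\<forall>Q\<in>\<P>. \<not> R \<subset> Q"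
      using exists_above[OF _ fin, of P] by (auto simp: N_def)
    have yR: "y \<in> R" using P R by (auto simp: N_def)
    show ?thesis
    proof (cases "R \<in> N")
      case True
      then have "insert R (roots C) \<subseteq> roots ?C" "R \<notin> roots C"
        using rsub R disj by (auto simp: roots_def S)
      then have "Suc (card (roots C)) \<le> card (roots ?C)"
        using card_mono[OF finite_roots, of "insert R (roots C)" ?C] by simp
      moreover have "card N \<le> h"
        by (rule order_trans[OF card_mono[OF fy] depth[of y]]) (auto simp: N_def)
      ultimately show ?thesis using False by simp
    next
      case notin: False
      have "insert R N \<subseteq> {P\<in>\<P>. y \<in> P}" using R yR by (auto simp: N_def)
      from card_mono[OF fy this] depth[of y] have "Suc (card N) \<le> h"
        using notin finN by simp
      then show ?thesis using 3 False by simp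
    qed
  qed
  then show ?thesis
    using own' 1 2 by (intro exI[of _ own']) (auto simp: pot_own_def)
qed

text \<open>If the new answer \<open>r P\<close> of \<open>R\<close> lies in \<open>Q\<close>, then
  \<open>Q\<close> meets \<open>P\<close>: either \<open>Q\<close> contains \<open>P\<close> and
  receives the same answer, or \<open>Q\<close> lies inside \<open>P\<close> and the old coherence
  applies.\<close>

lemma coherent_request:
  assumes r: "coherent r" and P: "P \<in> \<P>"
  shows "coherent (\<lambda>R. if P \<subseteq> R then r P else r R)"
proof -
  have mem: "\<And>Q. Q \<in> \<P> \<Longrightarrow> r Q \<in> Q" and conv: "\<And>Q R. Q \<in> \<P> \<Longrightarrow> R \<in> \<P> \<Longrightarrow> Q \<subseteq> R \<Longrightarrow> r R \<in> Q \<Longrightarrow> r Q = r R"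
    using r unfolding coherent_def by blast+
  show ?thesis
    unfolding coherent_def
  proof (intro conjI ballI impI)
    fix Q assume "Q \<in> \<P>"
    from mem[OF this] mem[OF P] show "(if P \<subseteq> Q then r P else r Q) \<in> Q" by auto
  next
    fix Q R assume Q: "Q \<in> \<P>" and R: "R \<in> \<P>" and sub: "Q \<subseteq> R" and m: "(if P \<subseteq> R then r P else r R) \<in> Q"
    show "(if P \<subseteq> Q then r P else r Q) = (if P \<subseteq> R then r P else r R)"
    proof (cases "P \<subseteq> R")
      case True
      then have "r P \<in> Q" using m by simp
      with nested[OF P Q mem[OF P]] have "P \<subseteq> Q \<or> Q \<subseteq> P" by simp
      moreover have "r Q = r P" if "Q \<subseteq> P" by (rule conv[OF Q P that \<open>r P \<in> Q\<close>])
      ultimately show ?thesis using True by auto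
    next
      case False
      then have "r Q = r R" using m by (intro conv[OF Q R sub]) simp
      then show ?thesis using False sub by auto
    qed
  qed
qed

text \<open>All served sets around \<open>P\<close> are handed to the owner \<open>z\<close> of
  \<open>P\<close>, so their pairs collapse to \<open>(z, r P)\<close>, which existed before. A top
  set whose answer was not cached costs a fault, but then its owner loses the pair with its old top
  answer. Distinct top sets have distinct owners, so the lost pairs are distinct.\<close>

lemma request_page:
  assumes own: "ownership C own" and r: "coherent r" and P: "P \<in> served C"
  defines "r' \<equiv> \<lambda>R. if P \<subseteq> R then r P else r R"
  shows "\<exists>own'. ownership C own' \<and> r P \<in> r' ` tops C own' \<and>
    int (card (r' ` tops C own' - r ` tops C own)) + pot_own C r' own' \<le> pot_own C r own"
proof -
  have mem: "\<And>Q. Q \<in> \<P> \<Longrightarrow> r Q \<in> Q" and conv: "\<And>Q R. Q \<in> \<P> \<Longrightarrow> R \<in> \<P> \<Longrightarrow> Q \<subseteq> R \<Longrightarrow> r R \<in> Q \<Longrightarrow> r Q = r R"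
    using r unfolding coherent_def by blast+
  have PP: "P \<in> \<P>" using P by (rule served_in)
  define z where "z = own P"
  have zP: "z \<in> P" "z \<in> C" using own P by (auto simp: ownership_def z_def)
  define own' where "own' = (\<lambda>R. if P \<subseteq> R then z else own R)"
  let ?D = "r ` tops C own" and ?D' = "r' ` tops C own'"
  have own': "ownership C own'"
    using own zP by (auto simp: ownership_def own'_def)
  have top_max: "Q \<subseteq> T" if "T \<in> tops C w" "ownership C w" "Q \<in> served C" "w Q = w T" for T Q w
  proof -
    have "w Q \<in> Q" "w Q \<in> T" "Q \<in> \<P>" "T \<in> \<P>" using that by (auto simp: ownership_def tops_def served_in)
    from nested[OF this(3,4,1,2)] show ?thesis using that by (auto simp: tops_def)
  qed
  have top_ex: "\<exists>T\<in>tops C own. own T = own Q" if "Q \<in> served C" for Q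
  proof -
    have "Q \<in> {R\<in>served C. own R = own Q}" using that by simp
    from exists_above[OF this] obtain T where "T \<in> served C" "own T = own Q"
      "\<forall>R\<in>{R\<in>served C. own R = own Q}. \<not> T \<subset> R" by auto
    then show ?thesis by (intro bexI[of _ T]) (auto simp: tops_def)
  qed
  obtain R where R: "R \<in> served C" "P \<subseteq> R" "\<forall>Q\<in>served C. \<not> R \<subset> Q"
    using exists_above[OF P] by auto
  then have "R \<in> tops C own'" by (auto simp: tops_def)
  moreover have "r' R = r P" using R by (simp add: r'_def)
  ultimately have rP: "r P \<in> ?D'" by force
  have psub: "pairs C r' own' \<subseteq> pairs C r own"
    using P by (auto simp: pairs_def r'_def own'_def z_def)
  define T where "T = (\<lambda>a. SOME T. T \<in> tops C own \<and> own T = a)"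
  have T: "T a \<in> tops C own \<and> own (T a) = a" if "Q \<in> served C" "own Q = a" for Q a
    unfolding T_def using someI_ex[of "\<lambda>T. T \<in> tops C own \<and> own T = a"] top_ex[OF that(1)] that(2) by blast
  define X where "X = {Q\<in>tops C own'. r' Q \<notin> ?D}"
  have lost: "(own' Q, r (T (own' Q))) \<in> pairs C r own - pairs C r' own'" if Q: "Q \<in> X" for Q
  proof -
    let ?a = "own' Q"
    let ?T = "T ?a"
    have Qt: "Q \<in> tops C own'" "r' Q \<notin> ?D" "Q \<in> served C" "Q \<in> \<P>"
      using Q by (auto simp: X_def tops_def served_in)
    have "\<exists>Q0\<in>served C. own Q0 = ?a"
      using Qt P by (cases "P \<subseteq> Q") (auto simp: own'_def z_def)
    then have Tt: "?T \<in> tops C own" "own ?T = ?a" using T by auto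
    then have TC: "?T \<in> served C" "?T \<in> \<P>" by (auto simp: tops_def served_in)
    have rT: "r ?T \<in> ?D" using Tt by auto
    have "(?a, r ?T) \<in> pairs C r own" using Tt TC by (force simp: pairs_def)
    moreover have "(?a, r ?T) \<notin> pairs C r' own'"
    proof
      assume "(?a, r ?T) \<in> pairs C r' own'"
      then obtain Q1 where Q1: "Q1 \<in> served C" "own' Q1 = ?a" "r' Q1 = r ?T" by (auto simp: pairs_def)
      have Q1Q: "Q1 \<subseteq> Q" using top_max[OF Qt(1) own' Q1(1,2)] .
      show False
      proof (cases "P \<subseteq> Q")
        case True
        then have a: "?a = z" "r' Q = r P" by (auto simp: own'_def r'_def)
        \<comment> \<open>If the old top answer survived at a set \<open>Q1\<close> not around
          \<open>P\<close>, then \<open>Q1\<close>, sharing \<open>z\<close> with \<open>P\<close>,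
          would lie inside \<open>P\<close>. The answer would be in \<open>P\<close>, and coherence
          would identify it with \<open>r P\<close>, which would thus have been cached.\<close>
        have PT: "P \<subseteq> ?T" using top_max[OF Tt(1) own P] Tt(2) a by (simp add: z_def)
        show False
        proof (cases "P \<subseteq> Q1")
          case True
          then show False using Q1 a Qt rT by (simp add: r'_def)
        next
          case False
          then have e: "own Q1 = z" "r Q1 = r ?T" using Q1 a by (auto simp: own'_def r'_def)
          have "z \<in> Q1" using own Q1 e by (auto simp: ownership_def)
          from nested[OF served_in[OF Q1(1)] PP this zP(1)] False have "Q1 \<subseteq> P" by auto
          then have "r ?T \<in> P" using mem[OF served_in[OF Q1(1)]] e by auto
          from conv[OF PP TC(2) PT this] show False using Qt a rT by simp
        qed
      next
        case False
        then have a: "own Q = ?a" "r' Q = r Q" by (auto simp: own'_def r'_def)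
        have "\<not> P \<subseteq> Q1" using Q1Q False by auto
        then have e: "r Q1 = r ?T" using Q1 by (auto simp: r'_def)
        have QT: "Q \<subseteq> ?T" using top_max[OF Tt(1) own Qt(3)] Tt(2) a by simp
        have "r ?T \<in> Q" using mem[OF served_in[OF Q1(1)]] e Q1Q by auto
        from conv[OF Qt(4) TC(2) QT this] show False using Qt a rT by simp
      qed
    qed
    ultimately show ?thesis by simp
  qed
  have finX: "finite X" by (simp add: X_def)
  have "?D' - ?D \<subseteq> r' ` X" by (auto simp: X_def)
  then have "card (?D' - ?D) \<le> card (r' ` X)" by (intro card_mono) (auto simp: finX)
  also have "\<dots> \<le> card X" by (rule card_image_le[OF finX])
  also have "\<dots> = card ((\<lambda>Q. (own' Q, r (T (own' Q)))) ` X)"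
    using tops_eqI[OF own'] by (intro card_image[symmetric] inj_onI) (auto simp: X_def)
  also have "\<dots> \<le> card (pairs C r own - pairs C r' own')"
    using lost by (intro card_mono) auto
  also have "\<dots> = card (pairs C r own) - card (pairs C r' own')"
    by (rule card_Diff_subset[OF finite_pairs psub])
  finally have "card (?D' - ?D) + card (pairs C r' own') \<le> card (pairs C r own)"
    using card_mono[OF finite_pairs psub] by simp
  then show ?thesis
    using own' rP by (intro exI[of _ own']) (auto simp: pot_own_def)
qed

lemma card_Diff_trans:
  assumes "finite A" "finite B"
  shows "card (A - C) \<le> card (A - B) + card (B - C)"
proof -
  have "card (A - C) \<le> card ((A - B) \<union> (B - C))" using assms by (intro card_mono) auto
  then show ?thesis using card_Un_le order_trans by blast
qed

lemma drop_pages: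
  assumes "finite X" "ownership C own"
  shows "X \<subseteq> C \<Longrightarrow> \<exists>own'. ownership (C - X) own' \<and> r ` tops (C - X) own' \<subseteq> r ` tops C own \<and>
    pot_own (C - X) r own' \<le> pot_own C r own"
  using assms(1)
proof (induction X rule: finite_induct)
  case empty
  then show ?case using assms(2) by auto
next
  case (insert x X)
  then obtain own1 where 1: "ownership (C - X) own1" "r ` tops (C - X) own1 \<subseteq> r ` tops C own"
    "pot_own (C - X) r own1 \<le> pot_own C r own" by auto
  have "x \<in> C - X" using insert by auto
  from drop_page[OF 1(1) this, of r] obtain own2 where 2: "ownership (C - X - {x}) own2"
    "r ` tops (C - X - {x}) own2 \<subseteq> r ` tops (C - X) own1"
    "pot_own (C - X - {x}) r own2 \<le> pot_own (C - X) r own1" by auto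
  have "C - insert x X = C - X - {x}" by auto
  then show ?case using 1 2 by (intro exI[of _ own2]) auto
qed

lemma add_pages:
  assumes "finite X" "ownership C own"
  shows "\<exists>own'. ownership (C \<union> X) own' \<and>
    int (card (r ` tops (C \<union> X) own' - r ` tops C own)) + pot_own (C \<union> X) r own'
      \<le> pot_own C r own + int (h * card X)"
  using assms(1)
proof (induction X rule: finite_induct)
  case empty
  then show ?case using assms(2) by (intro exI[of _ own]) auto
next
  case (insert x X)
  then obtain own1 where 1: "ownership (C \<union> X) own1"
    "int (card (r ` tops (C \<union> X) own1 - r ` tops C own)) + pot_own (C \<union> X) r own1
      \<le> pot_own C r own + int (h * card X)" by auto
  from add_page[OF 1(1), of x r] obtain own2 where 2: "ownership (insert x (C \<union> X)) own2"
    "int (card (r ` tops (insert x (C \<union> X)) own2 - r ` tops (C \<union> X) own1)) + pot_own (insert x (C \<union> X)) r own2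
      \<le> pot_own (C \<union> X) r own1 + int h" by auto
  have "card (r ` tops (insert x (C \<union> X)) own2 - r ` tops C own) \<le>
      card (r ` tops (insert x (C \<union> X)) own2 - r ` tops (C \<union> X) own1) + card (r ` tops (C \<union> X) own1 - r ` tops C own)"
    by (rule card_Diff_trans) auto
  then show ?case using 1 2 insert by (intro exI[of _ own2]) (auto simp: algebra_simps)
qed

lemma reduction_step:
  assumes own: "ownership C own" and r: "coherent r" and C: "finite C" "finite C'" and P: "P \<in> served C'"
  defines "r' \<equiv> \<lambda>R. if P \<subseteq> R then r P else r R"
  shows "\<exists>own'. ownership C' own' \<and> r P \<in> r' ` tops C' own' \<and>
    int (card (r' ` tops C' own' - r ` tops C own)) + pot_own C' r' own' \<le> pot_own C r own + int (h * card (C' - C))"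
proof -
  have "finite (C - C')" using C by simp
  from drop_pages[OF this own, of r] obtain own1 where 1: "ownership (C - (C - C')) own1"
    "r ` tops (C - (C - C')) own1 \<subseteq> r ` tops C own" "pot_own (C - (C - C')) r own1 \<le> pot_own C r own" by auto
  have "finite (C' - C)" using C by simp
  from add_pages[OF this 1(1), of r] obtain own2 where "ownership (C - (C - C') \<union> (C' - C)) own2"
    "int (card (r ` tops (C - (C - C') \<union> (C' - C)) own2 - r ` tops (C - (C - C')) own1)) +
      pot_own (C - (C - C') \<union> (C' - C)) r own2
      \<le> pot_own (C - (C - C')) r own1 + int (h * card (C' - C))" by auto
  moreover have "C - (C - C') \<union> (C' - C) = C'" by auto
  ultimately have 2: "ownership C' own2"
    "int (card (r ` tops C' own2 - r ` tops (C - (C - C')) own1)) + pot_own C' r own2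
      \<le> pot_own (C - (C - C')) r own1 + int (h * card (C' - C))" by simp_all
  from request_page[OF 2(1) r P] obtain own3 where 3: "ownership C' own3" "r P \<in> r' ` tops C' own3"
    "int (card (r' ` tops C' own3 - r ` tops C' own2)) + pot_own C' r' own3 \<le> pot_own C' r own2"
    unfolding r'_def by auto
  have "card (r' ` tops C' own3 - r ` tops C own) \<le> card (r' ` tops C' own3 - r ` tops C' own2) +
      card (r ` tops C' own2 - r ` tops C own)"
    by (rule card_Diff_trans) auto
  moreover have "card (r ` tops C' own2 - r ` tops C own) \<le> card (r ` tops C' own2 - r ` tops (C - (C - C')) own1)"
    using 1(2) by (intro card_mono) auto
  ultimately show ?thesis using 1 2 3 by (intro exI[of _ own3]) auto
qed

lemma coherent_lookup_Nil: "coherent (lookup [])"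
  unfolding coherent_def using nonempty
  by (auto intro!: Min_in intro: antisym Min_antimono Min_le)

lemma reduction:
  assumes "list_all2 (\<lambda>P C. finite C \<and> card C \<le> k \<and> P \<inter> C \<noteq> {}) \<pi> Cs" "set \<pi> \<subseteq> \<P>"
    and "ownership C own" "finite C" "coherent (lookup rh)"
  shows "\<exists>Ds. list_all2 (set_serves k) (resolve rh \<pi>) Ds \<and>
    int (set_cost (lookup rh ` tops C own) Ds) \<le> int (h * set_cost C Cs) + pot_own C (lookup rh) own"
  using assms
proof (induction \<pi> Cs arbitrary: C own rh rule: list_all2_induct)
  case Nil
  then show ?case using pot_own_nonneg by (intro exI[of _ "[]"]) auto
next
  case (Cons P \<pi> C' Cs)
  have PS: "P \<in> served C'" and PP: "P \<in> \<P>" using Cons by (auto simp: served_def)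
  define rh' where "rh' = (P, lookup rh P) # rh"
  have upd: "lookup rh' = (\<lambda>R. if P \<subseteq> R then lookup rh P else lookup rh R)" by (auto simp: rh'_def)
  obtain own' where 1: "ownership C' own'" "lookup rh P \<in> lookup rh' ` tops C' own'"
    "int (card (lookup rh' ` tops C' own' - lookup rh ` tops C own)) +
       pot_own C' (lookup rh') own' \<le> pot_own C (lookup rh) own + int (h * card (C' - C))"
    unfolding upd using reduction_step[OF Cons.prems(2,4,3) _ PS] Cons.hyps by blast
  have coh: "coherent (lookup rh')"
    unfolding upd by (rule coherent_request[OF Cons.prems(4) PP])
  have sub: "set \<pi> \<subseteq> \<P>" and C': "finite C'" "card C' \<le> k" using Cons.prems Cons.hyps by auto
  from Cons.IH[OF sub 1(1) C'(1) coh] obtain Ds where Ds: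
    "list_all2 (set_serves k) (resolve rh' \<pi>) Ds"
    "int (set_cost (lookup rh' ` tops C' own') Ds) \<le> int (h * set_cost C' Cs) + pot_own C' (lookup rh') own'"
    by blast
  have "card (lookup rh' ` tops C' own') \<le> k"
    using card_tops_le[OF 1(1) C'(1)] C'(2) order_trans by blast
  then have "list_all2 (set_serves k) (resolve rh (P # \<pi>)) (lookup rh' ` tops C' own' # Ds)"
    using Ds(1) 1(2) by (simp add: rh'_def[symmetric])
  moreover have "int (set_cost (lookup rh ` tops C own) (lookup rh' ` tops C' own' # Ds)) \<le>
      int (h * set_cost C (C' # Cs)) + pot_own C (lookup rh) own"
    using Ds(2) 1(3) by (simp add: algebra_simps)
  ultimately show ?case by blast
qed

text \<open>The paging solution obtained by the reduction is subject to the nullity bound. From an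
  empty cache the potential starts at zero, so no additive term remains.\<close>

lemma loops_resolve_le:
  assumes "list_all2 (\<lambda>P C. finite C \<and> card C \<le> k \<and> P \<inter> C \<noteq> {}) \<pi> Cs" "set \<pi> \<subseteq> \<P>"
  shows "loops k [] (resolve [] \<pi>) \<le> h * set_cost {} Cs"
proof -
  have "served {} = {}" by (simp add: served_def)
  then have e: "ownership {} own" "tops {} own = {}" "pot_own {} r own = 0" for r own
    by (auto simp: ownership_def tops_def pot_own_def pairs_def roots_def)
  obtain Ds where "list_all2 (set_serves k) (resolve [] \<pi>) Ds"
    "int (set_cost {} Ds) \<le> int (h * set_cost {} Cs)"
    using reduction[OF assms e(1) _ coherent_lookup_Nil] unfolding e by (auto simp del: of_nat_mult)
  then have "list_all2 (set_serves k) (resolve [] \<pi>) Ds"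
    "set_cost {} Ds \<le> h * set_cost {} Cs" by (simp_all only: of_nat_le_iff)
  then show ?thesis using loops_le_set_cost[of k "resolve [] \<pi>" Ds "[]" "{}"] by simp
qed

end

section \<open>From heights and slot configurations to the abstract setting\<close>

lemma card_containing_le_height:
  assumes "finite \<P>" "laminar \<P>"
  shows "card {P\<in>\<P>. y \<in> P} \<le> height \<P>"
proof -
  let ?H = "{length Rs | Rs. set Rs \<subseteq> \<P> \<and> sorted_wrt (\<subset>) Rs}"
  have dist: "distinct Rs" if "sorted_wrt (\<subset>) Rs" for Rs :: "'a set list"
    using that by (induction Rs) auto
  have "?H \<subseteq> {..card \<P>}"
  proof
    fix n assume "n \<in> ?H"
    then obtain Rs where n: "n = length Rs" and Rs: "set Rs \<subseteq> \<P>" "sorted_wrt (\<subset>) Rs" by auto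
    have "length Rs = card (set Rs)" using distinct_card[OF dist[OF Rs(2)]] by simp
    also have "\<dots> \<le> card \<P>" by (rule card_mono[OF assms(1) Rs(1)])
    finally show "n \<in> {..card \<P>}" by (simp add: n)
  qed
  then have finH: "finite ?H" using finite_subset by blast
  have chain: "\<exists>Rs. set Rs = A \<and> sorted_wrt (\<subset>) Rs"
    if "finite A" "\<And>P Q. P \<in> A \<Longrightarrow> Q \<in> A \<Longrightarrow> P \<subseteq> Q \<or> Q \<subseteq> P" for A :: "'a set set"
    using that
  proof (induction "card A" arbitrary: A)
    case 0
    then show ?case by (intro exI[of _ "[]"]) auto
  next
    case (Suc n)
    then have "A \<noteq> {}" by auto
    then obtain M where M: "M \<in> A" "\<forall>Q\<in>A. Q \<subseteq> M \<longrightarrow> M = Q"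
      using finite_has_minimal[of A] Suc.prems by auto
    have "n = card (A - {M})" using Suc M by simp
    with Suc.hyps(1)[of "A - {M}"] Suc.prems obtain Rs where Rs: "set Rs = A - {M}" "sorted_wrt (\<subset>) Rs" by auto
    have "M \<subset> Q" if "Q \<in> A - {M}" for Q using Suc.prems(2)[of M Q] M that by auto
    then show ?case using Rs M by (intro exI[of _ "M # Rs"]) auto
  qed
  obtain Rs where Rs: "set Rs = {P\<in>\<P>. y \<in> P}" "sorted_wrt (\<subset>) Rs"
    using chain[of "{P\<in>\<P>. y \<in> P}"] assms by (force simp: laminar_def)
  then have "card {P\<in>\<P>. y \<in> P} = length Rs" using distinct_card[OF dist[OF Rs(2)]] by simp
  also have "\<dots> \<le> height \<P>"
    unfolding height_def using Rs by (intro Max_ge finH) auto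
  finally show ?thesis .
qed

definition pages :: "'a option list \<Rightarrow> 'a set" where
  "pages C = {p. Some p \<in> set C}"

lemma pages_finite: "finite (pages C)" and card_pages_le: "card (pages C) \<le> length C"
proof -
  have "pages C \<subseteq> the ` set C" by (force simp: pages_def)
  moreover have "card (the ` set C) \<le> length C"
    using card_image_le[of "set C" the] card_length[of C] by simp
  ultimately show "finite (pages C)" "card (pages C) \<le> length C"
    using finite_subset[of "pages C" "the ` set C"] card_mono[of "the ` set C" "pages C"] by auto
qed

lemma set_cost_pages_le:
  assumes "\<forall>C\<in>set (s # Cs). length C = k"
  shows "set_cost (pages s) (map pages Cs) \<le> path_cost k s Cs"
  using assms
proof (induction Cs arbitrary: s)
  case (Cons C Cs)
  let ?R = "{i. i < k \<and> C ! i \<noteq> None \<and> s ! i \<noteq> C ! i}"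
  have "pages C - pages s \<subseteq> (\<lambda>i. the (C ! i)) ` ?R"
  proof
    fix p assume p: "p \<in> pages C - pages s"
    then obtain i where "i < k" "C ! i = Some p" using Cons.prems by (auto simp: pages_def in_set_conv_nth)
    moreover have "s ! i \<in> set s" using \<open>i < k\<close> Cons.prems by (intro nth_mem) simp
    then have "s ! i \<noteq> Some p" using p by (auto simp: pages_def)
    ultimately show "p \<in> (\<lambda>i. the (C ! i)) ` ?R" by (intro image_eqI[of _ _ i]) auto
  qed
  then have "card (pages C - pages s) \<le> card ((\<lambda>i. the (C ! i)) ` ?R)" by (intro card_mono) auto
  also have "\<dots> \<le> card ?R" by (rule card_image_le) auto
  finally show ?case using Cons by (simp add: retrievals_def add_mono)
qed simp

text \<open>Needed for the infimum in \<open>opt\<close> to be attained by an actual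
  solution.\<close>

lemma solution_exists:
  assumes "pl_instance k \<P> \<pi>"
  shows "\<exists>Cs. is_solution k \<pi> Cs"
proof -
  let ?Cs = "map (\<lambda>P. replicate k (Some (SOME p. p \<in> P))) \<pi>"
  have "(SOME p. p \<in> \<pi> ! t) \<in> \<pi> ! t" if "t < length \<pi>" for t
  proof -
    have "\<pi> ! t \<in> \<P>" using assms nth_mem[OF that] by (auto simp: pl_instance_def)
    then have "\<pi> ! t \<noteq> {}" using assms by (simp add: pl_instance_def)
    then show ?thesis by (simp add: some_in_eq)
  qed
  moreover have "0 < k" using assms by (simp add: pl_instance_def)
  ultimately have "is_solution k \<pi> ?Cs" unfolding is_solution_def by fastforce
  then show ?thesis by blast
qed

lemma loops_le_opt:
  assumes I: "pl_instance k \<P> \<pi>"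
  shows "loops k [] (resolve [] \<pi>) \<le> height \<P> * opt k \<pi>"
proof -
  interpret laminar_family \<P> "height \<P>"
    using I by unfold_locales (auto simp: pl_instance_def card_containing_le_height)
  have "opt k \<pi> \<in> cost k ` {Cs. is_solution k \<pi> Cs}"
    unfolding opt_def using solution_exists[OF I] by (intro Inf_nat_def1) auto
  then obtain Cs where Cs: "is_solution k \<pi> Cs" "opt k \<pi> = cost k Cs" by auto
  have len: "\<forall>C\<in>set Cs. length C = k" using Cs(1) by (auto simp: is_solution_def in_set_conv_nth)
  have "list_all2 (\<lambda>P C. finite C \<and> card C \<le> k \<and> P \<inter> C \<noteq> {}) \<pi> (map pages Cs)"
  proof (rule list_all2_all_nthI)
    fix t assume t: "t < length \<pi>"
    then obtain s p where sp: "s < k" "p \<in> \<pi> ! t" "Cs ! t ! s = Some p" "length (Cs ! t) = k" "t < length Cs"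
      using Cs(1) by (auto simp: is_solution_def)
    then have "Some p \<in> set (Cs ! t)" using nth_mem[of s "Cs ! t"] by simp
    then show "finite (map pages Cs ! t) \<and> card (map pages Cs ! t) \<le> k \<and> \<pi> ! t \<inter> map pages Cs ! t \<noteq> {}"
      using sp card_pages_le[of "Cs ! t"] pages_finite[of "Cs ! t"] by (auto simp: pages_def)
  qed (use Cs in \<open>simp add: is_solution_def\<close>)
  moreover have "set \<pi> \<subseteq> \<P>" using I by (simp add: pl_instance_def)
  ultimately have "loops k [] (resolve [] \<pi>) \<le> height \<P> * set_cost {} (map pages Cs)"
    by (rule loops_resolve_le)
  also have "set_cost {} (map pages Cs) \<le> path_cost k (replicate k None) Cs"
    using set_cost_pages_le[of "replicate k None" Cs k] len by (simp add: pages_def)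
  finally show ?thesis using Cs(2) by (simp add: cost_eq_path_cost)
qed

section \<open>The programs\<close>

lemma eval_simps:
  "eval F x Arg = return_spmf (x, 1)"
  "eval F x Nl = return_spmf (VNil, 1)"
  "eval F x (Cns a b) = do {
       (u, i) \<leftarrow> eval F x a;
       (v, j) \<leftarrow> eval F x b;
       return_spmf (VCons u v, i + j + 1) }"
  "eval F x (Hd a) = do { (u, i) \<leftarrow> eval F x a; return_spmf (vhd u, i + 1) }"
  "eval F x (Tl a) = do { (u, i) \<leftarrow> eval F x a; return_spmf (vtl u, i + 1) }"
  "eval F x (Ite a b c) = do {
       (u, i) \<leftarrow> eval F x a;
       (v, j) \<leftarrow> (if u \<noteq> VNil then eval F x b else eval F x c);
       return_spmf (v, i + j + 1) }"
  "eval F x (Call f a) = do {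
       (u, i) \<leftarrow> eval F x a;
       (v, j) \<leftarrow> (if f < length F then eval F u (F ! f) else return_pmf None);
       return_spmf (v, i + j + 1) }"
  "eval F x (Choose a) = do {
       (u, i) \<leftarrow> eval F x a;
       n \<leftarrow> spmf_of_set {..<length (list_of_val u)};
       return_spmf (list_of_val u ! n, i + length (list_of_val u) + 1) }"
  by (subst eval.simps, simp)+

text \<open>Relative to the results \<open>cres\<close> of calls, the value and the time of a choice-free expression are given
  by structural recursion, so that programs can be verified by simplification.\<close>

definition cok :: "program \<Rightarrow> nat \<Rightarrow> val \<Rightarrow> bool" where
  "cok F f u \<longleftrightarrow> f < length F \<and> (\<exists>r. eval F u (F ! f) = return_spmf r)"

definition cres :: "program \<Rightarrow> nat \<Rightarrow> val \<Rightarrow> val \<times> nat" where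
  "cres F f u = (THE r. eval F u (F ! f) = return_spmf r)"

primrec ev_val :: "program \<Rightarrow> val \<Rightarrow> expr \<Rightarrow> val" where
  "ev_val F x Arg = x"
| "ev_val F x Nl = VNil"
| "ev_val F x (Cns a b) = VCons (ev_val F x a) (ev_val F x b)"
| "ev_val F x (Hd a) = vhd (ev_val F x a)"
| "ev_val F x (Tl a) = vtl (ev_val F x a)"
| "ev_val F x (Ite a b c) = (if ev_val F x a \<noteq> VNil then ev_val F x b else ev_val F x c)"
| "ev_val F x (Call f a) = fst (cres F f (ev_val F x a))"
| "ev_val F x (Choose a) = VNil"

primrec ev_time :: "program \<Rightarrow> val \<Rightarrow> expr \<Rightarrow> nat" where
  "ev_time F x Arg = 1"
| "ev_time F x Nl = 1"
| "ev_time F x (Cns a b) = ev_time F x a + ev_time F x b + 1"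
| "ev_time F x (Hd a) = ev_time F x a + 1"
| "ev_time F x (Tl a) = ev_time F x a + 1"
| "ev_time F x (Ite a b c) =
     ev_time F x a + (if ev_val F x a \<noteq> VNil then ev_time F x b else ev_time F x c) + 1"
| "ev_time F x (Call f a) = ev_time F x a + snd (cres F f (ev_val F x a)) + 1"
| "ev_time F x (Choose a) = 0"

primrec ev_ok :: "program \<Rightarrow> val \<Rightarrow> expr \<Rightarrow> bool" where
  "ev_ok F x Arg \<longleftrightarrow> True"
| "ev_ok F x Nl \<longleftrightarrow> True"
| "ev_ok F x (Cns a b) \<longleftrightarrow> ev_ok F x a \<and> ev_ok F x b"
| "ev_ok F x (Hd a) \<longleftrightarrow> ev_ok F x a"
| "ev_ok F x (Tl a) \<longleftrightarrow> ev_ok F x a"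
| "ev_ok F x (Ite a b c) \<longleftrightarrow>
     ev_ok F x a \<and> (if ev_val F x a \<noteq> VNil then ev_ok F x b else ev_ok F x c)"
| "ev_ok F x (Call f a) \<longleftrightarrow> ev_ok F x a \<and> cok F f (ev_val F x a)"
| "ev_ok F x (Choose a) \<longleftrightarrow> False"

lemma cres_eq: "eval F u (F ! f) = return_spmf r \<Longrightarrow> cres F f u = r"
  by (auto simp: cres_def return_pmf_inj)

lemma cok_eval: "cok F f u \<Longrightarrow> eval F u (F ! f) = return_spmf (cres F f u)"
  using cres_eq by (auto simp: cok_def)

lemma eval_det: "ev_ok F x e \<Longrightarrow> eval F x e = return_spmf (ev_val F x e, ev_time F x e)"
proof (induction e)
  case (Call f a)
  then have "f < length F" by (simp add: cok_def)
  with Call cok_eval[of F f "ev_val F x a"] show ?case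
    by (simp add: eval_simps case_prod_unfold)
qed (auto simp: eval_simps split: if_splits)

definition runs :: "program \<Rightarrow> nat \<Rightarrow> val \<Rightarrow> val \<Rightarrow> nat \<Rightarrow> bool" where
  "runs F f x v t \<longleftrightarrow> cok F f x \<and> fst (cres F f x) = v \<and> snd (cres F f x) \<le> t"

lemma runsI:
  assumes "f < length F" "ev_ok F x (F ! f)" "ev_val F x (F ! f) = v" "ev_time F x (F ! f) \<le> t"
  shows "runs F f x v t"
  using assms eval_det[OF assms(2)] cres_eq[OF eval_det[OF assms(2)]] by (auto simp: runs_def cok_def)

lemma runs_mono: "runs F f x v t \<Longrightarrow> t \<le> t' \<Longrightarrow> runs F f x v t'"
  by (auto simp: runs_def)

section \<open>The source code of the functions\<close>

abbreviation Tr :: expr where "Tr \<equiv> Cns Nl Nl"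

text \<open>Calls refer to positions in the list \<open>prog\<close>. Positions 0 and 1 are
  parameters: the entry point and, for the online programs, the update of the order.\<close>

definition e_eq :: expr where
  "e_eq = Ite (Hd Arg)
     (Ite (Tl Arg)
       (Ite (Call 2 (Cns (Hd (Hd Arg)) (Hd (Tl Arg)))) (Call 2 (Cns (Tl (Hd Arg)) (Tl (Tl Arg)))) Nl)
       Nl)
     (Ite (Tl Arg) Nl Tr)"

definition e_mem :: expr where
  "e_mem = Ite (Tl Arg)
     (Ite (Call 2 (Cns (Hd Arg) (Hd (Tl Arg)))) Tr (Call 3 (Cns (Hd Arg) (Tl (Tl Arg)))))
     Nl"

definition e_sub :: expr where
  "e_sub = Ite (Hd Arg)
     (Ite (Call 3 (Cns (Hd (Hd Arg)) (Tl Arg))) (Call 4 (Cns (Tl (Hd Arg)) (Tl Arg))) Nl)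
     Tr"

definition e_lookup :: expr where
  "e_lookup = Ite (Tl Arg)
     (Ite (Call 4 (Cns (Hd (Hd (Tl Arg))) (Hd Arg))) (Tl (Hd (Tl Arg)))
       (Call 5 (Cns (Hd Arg) (Tl (Tl Arg)))))
     (Hd (Hd Arg))"

text \<open>The second argument counts by its length only, so the tail of the cache can serve as the
  unary number \<open>k - 1\<close>.\<close>

definition e_min :: expr where
  "e_min = Ite (Hd Arg) (Ite (Tl Arg) (Cns Nl (Call 6 (Cns (Tl (Hd Arg)) (Tl (Tl Arg))))) Nl) Nl"

text \<open>The argument of \<open>e_rk\<close> and \<open>e_rk_base\<close> is \<open>(slots, (history, pages))\<close>.\<close>

definition e_rk :: expr where
  "e_rk = Ite (Hd (Tl Arg))
     (Ite (Call 3 (Cns (Hd (Hd (Hd (Tl Arg)))) (Tl (Tl Arg)))) (Cns Nl (Call 8 Arg)) (Call 8 Arg))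
     Nl"

definition e_rk_base :: expr where
  "e_rk_base = Ite (Tl (Hd (Hd (Tl Arg))))
     (Tl (Call 7 (Cns (Hd Arg) (Cns (Tl (Hd (Tl Arg))) (Cns (Hd (Hd (Hd (Tl Arg)))) (Tl (Tl Arg)))))))
     (Call 6 (Cns (Call 7 (Cns (Hd Arg) (Cns (Tl (Hd (Tl Arg))) (Tl (Tl Arg))))) (Tl (Hd Arg))))"

definition e_prefix :: expr where
  "e_prefix = Ite (Tl Arg)
     (Ite (Call 2 (Cns (Hd Arg) (Hd (Tl Arg)))) Nl
       (Cns (Hd (Tl Arg)) (Call 9 (Cns (Hd Arg) (Tl (Tl Arg))))))
     Nl"

text \<open>The context passed along below is \<open>((slots, history), (order, page))\<close>.\<close>

definition e_reject :: expr where
  "e_reject = Call 11 (Cns (Call 9 (Cns (Hd Arg) (Hd (Tl (Tl Arg))))) Arg)"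

text \<open>The language has no local binding. Functions with a numbered suffix receive an
  intermediate result inside their argument, so that it is computed only once.\<close>

definition e_reject2 :: expr where
  "e_reject2 = Call 2 (Cns
     (Call 7 (Cns (Hd (Hd (Tl (Tl Arg)))) (Cns (Tl (Hd (Tl (Tl Arg)))) (Hd Arg))))
     (Call 7 (Cns (Hd (Hd (Tl (Tl Arg)))) (Cns (Tl (Hd (Tl (Tl Arg)))) (Cns (Hd (Tl Arg)) (Hd Arg))))))"

definition e_place :: expr where
  "e_place = Ite (Hd Arg)
     (Ite (Hd (Hd Arg))
       (Ite (Call 10 (Cns (Hd (Hd (Hd Arg))) (Tl Arg)))
         (Cns (Cns (Tl (Tl (Tl Arg))) Nl) (Tl (Hd Arg)))
         (Cns (Hd (Hd Arg)) (Call 12 (Cns (Tl (Hd Arg)) (Tl Arg)))))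
       (Cns (Cns (Tl (Tl (Tl Arg))) Nl) (Tl (Hd Arg))))
     Nl"

definition e_step :: expr where
  "e_step = Call 14 (Cns
     (Cns (Hd (Hd Arg))
       (Cns (Cns (Tl (Tl Arg))
           (Ite (Call 7 (Cns (Hd (Hd Arg)) (Cns (Tl (Hd Arg)) (Cns (Tl (Tl Arg)) Nl)))) Tr Nl))
         (Tl (Hd Arg))))
     (Tl Arg))"

definition e_step2 :: expr where
  "e_step2 = Cns
     (Ite (Call 3 (Cns (Cns (Tl (Tl Arg)) Nl) (Hd (Hd Arg))))
       (Hd (Hd Arg))
       (Call 12 (Cns (Hd (Hd Arg)) Arg)))
     (Tl (Hd Arg))"

text \<open>The memory of the online algorithms is \<open>(order, ((slots, history), resolved))\<close>. The initial
  memory, a list of \<open>VNil\<close>, is recognised by its head, because a proper memory has a nonempty order.\<close>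

definition e_prep :: expr where
  "e_prep = Call 16 (Cns
     (Ite (Hd (Hd Arg)) (Hd Arg) (Cns Nl (Cns (Cns (Hd Arg) Nl) Nl)))
     (Tl Arg))"

definition e_prep2 :: expr where
  "e_prep2 = Call 17 (Cns (Hd Arg) (Cns (Tl Arg) (Call 5 (Cns (Tl Arg) (Tl (Tl (Hd Arg)))))))"

definition e_prep3 :: expr where
  "e_prep3 = Cns
     (Cns (Tl (Tl Arg)) (Hd (Hd Arg)))
     (Cns
       (Call 13 (Cns (Hd (Tl (Hd Arg))) (Cns (Hd (Hd Arg)) (Tl (Tl Arg)))))
       (Cns (Tl Arg) (Tl (Tl (Hd Arg)))))"

definition e_fin :: expr where
  "e_fin = Cns Arg (Hd (Hd (Tl Arg)))"

text \<open>A split is kept as a zipper with reversed prefix, so all splits together take linear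
  time; \<open>e_combine\<close> undoes the reversal for the chosen one only.\<close>

definition e_splits :: expr where
  "e_splits = Cns Arg
     (Ite (Tl Arg) (Call 19 (Cns (Cns (Hd (Tl Arg)) (Hd Arg)) (Tl (Tl Arg)))) Nl)"

definition e_revapp :: expr where
  "e_revapp = Ite (Hd Arg) (Call 20 (Cns (Tl (Hd Arg)) (Cns (Hd (Hd Arg)) (Tl Arg)))) (Tl Arg)"

definition e_combine :: expr where
  "e_combine = Call 20 (Cns (Hd (Hd Arg)) (Cns (Tl Arg) (Tl (Hd Arg))))"

definition e_resolve :: expr where
  "e_resolve = Ite (Tl Arg) (Call 23 (Cns (Call 5 (Cns (Hd (Tl Arg)) (Hd Arg))) Arg)) Nl"

definition e_resolve2 :: expr where
  "e_resolve2 = Cns (Hd Arg)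
     (Call 22 (Cns (Cns (Cns (Hd (Tl (Tl Arg))) (Hd Arg)) (Hd (Tl Arg))) (Tl (Tl (Tl Arg)))))"

definition e_append :: expr where
  "e_append = Ite (Hd Arg) (Cns (Hd (Hd Arg)) (Call 24 (Cns (Tl (Hd Arg)) (Tl Arg)))) (Tl Arg)"

definition e_run :: expr where
  "e_run = Ite (Tl Arg)
     (Call 26 (Cns (Call 13 (Cns (Hd (Hd Arg)) (Cns (Tl (Hd Arg)) (Hd (Tl Arg))))) Arg))
     Nl"

definition e_run2 :: expr where
  "e_run2 = Cns (Hd (Hd Arg))
     (Call 25 (Cns (Cns (Hd Arg) (Tl (Tl (Hd (Tl Arg))))) (Tl (Tl (Tl Arg)))))"

definition e_offline2 :: expr where
  "e_offline2 = Call 25 (Cns (Cns (Cns (Hd Arg) Nl) (Call 24 (Cns (Tl Arg) (Tl Arg)))) (Tl Arg))"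

definition e_offline :: expr where
  "e_offline = Call 27 (Cns (Hd Arg) (Call 22 (Cns Nl (Tl Arg))))"

definition e_online :: expr where
  "e_online = Call 18 (Call 1 (Call 15 Arg))"

definition e_order_rand :: expr where
  "e_order_rand = Ite (Call 3 (Hd Arg))
     (Cns (Tl (Hd Arg)) (Tl Arg))
     (Cns (Call 21 (Cns (Choose (Call 19 (Cns Nl (Tl (Hd Arg))))) (Hd (Hd Arg)))) (Tl Arg))"

definition prog :: "expr \<Rightarrow> expr \<Rightarrow> program" where
  "prog a b = [a, b, e_eq, e_mem, e_sub, e_lookup, e_min, e_rk, e_rk_base, e_prefix, e_reject, e_reject2,
     e_place, e_step, e_step2, e_prep, e_prep2, e_prep3, e_fin, e_splits, e_revapp, e_combine,
     e_resolve, e_resolve2, e_append, e_run, e_run2, e_offline2]"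

lemma length_prog [simp]: "length (prog a b) = 28"
  by (simp add: prog_def)

lemma prog_nth [simp]:
  "prog a b ! 0 = a" "prog a b ! Suc 0 = b" "prog a b ! 2 = e_eq" "prog a b ! 3 = e_mem"
  "prog a b ! 4 = e_sub" "prog a b ! 5 = e_lookup" "prog a b ! 6 = e_min" "prog a b ! 7 = e_rk"
  "prog a b ! 8 = e_rk_base" "prog a b ! 9 = e_prefix" "prog a b ! 10 = e_reject"
  "prog a b ! 11 = e_reject2" "prog a b ! 12 = e_place" "prog a b ! 13 = e_step"
  "prog a b ! 14 = e_step2" "prog a b ! 15 = e_prep" "prog a b ! 16 = e_prep2"
  "prog a b ! 17 = e_prep3" "prog a b ! 18 = e_fin" "prog a b ! 19 = e_splits"
  "prog a b ! 20 = e_revapp" "prog a b ! 21 = e_combine" "prog a b ! 22 = e_resolve"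
  "prog a b ! 23 = e_resolve2" "prog a b ! 24 = e_append" "prog a b ! 25 = e_run"
  "prog a b ! 26 = e_run2" "prog a b ! 27 = e_offline2"
  by (simp_all add: prog_def)

section \<open>Encodings of the data and their sizes\<close>

definition eb :: "bool \<Rightarrow> val" where
  "eb b = (if b then VCons VNil VNil else VNil)"

lemma eb_simps [simp]: "eb True = VCons VNil VNil" "eb False = VNil" "eb b = VNil \<longleftrightarrow> \<not> b"
  by (auto simp: eb_def)

lemma val_of_list_simps [simp]:
  "val_of_list [] = VNil" "val_of_list (v # vs) = VCons v (val_of_list vs)"
  by (simp_all add: val_of_list_def)

lemma enc_slots_simps [simp]: "enc_slots 0 = VNil" "enc_slots (Suc n) = VCons VNil (enc_slots n)"
  by (simp_all add: enc_slots_def)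

lemma vtl_enc_slots [simp]: "vtl (enc_slots n) = enc_slots (n - 1)"
  by (cases n) simp_all

lemma vsize_enc_slots: "vsize (enc_slots n) = 2 * n + 1"
  by (induction n) simp_all

lemma enc_slots_inj [simp]: "enc_slots m = enc_slots n \<longleftrightarrow> m = n"
  by (metis add_right_cancel mult_left_cancel vsize_enc_slots zero_neq_numeral)

lemma enc_slots_eq_VNil [simp]: "enc_slots n = VNil \<longleftrightarrow> n = 0"
  using enc_slots_inj[of n 0] by simp

lemma vsize_ge1: "1 \<le> vsize v"
  by (cases v) simp_all

lemma length_le_vsize: "Suc (length vs) \<le> vsize (val_of_list vs)"
  by (induction vs) simp_all

lemma vsize_mem: "v \<in> set vs \<Longrightarrow> vsize v < vsize (val_of_list vs)"
  by (induction vs) auto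

lemma enc_page_0: "enc_page 0 = VNil"
  by (subst enc_page.simps) simp

lemma enc_page_pos:
  "n \<noteq> 0 \<Longrightarrow> enc_page n = VCons (if odd n then VCons VNil VNil else VNil) (enc_page (n div 2))"
  by (subst enc_page.simps) simp

lemma enc_page_inj [simp]: "enc_page m = enc_page n \<longleftrightarrow> m = n"
proof
  show "enc_page m = enc_page n \<Longrightarrow> m = n"
  proof (induction m arbitrary: n rule: less_induct)
    case (less m)
    show ?case
    proof (cases "m = 0 \<or> n = 0")
      case True
      then show ?thesis using less.prems enc_page_pos[of m] enc_page_pos[of n] enc_page_0
        by (cases "m = 0"; cases "n = 0") auto
    next
      case False
      then have "odd m = odd n" "enc_page (m div 2) = enc_page (n div 2)"
        using less.prems enc_page_pos[of m] enc_page_pos[of n] by (auto split: if_splits)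
      moreover from this False have "m div 2 = n div 2" by (intro less.IH) auto
      ultimately show ?thesis by (metis even_two_times_div_two odd_two_times_div_two_succ)
    qed
  qed
qed simp

definition elist :: "nat list \<Rightarrow> val" where
  "elist xs = val_of_list (map enc_page xs)"

definition ehist :: "(nat \<times> bool) list \<Rightarrow> val" where
  "ehist h = val_of_list (map (\<lambda>(p, b). VCons (enc_page p) (eb b)) h)"

definition eresolved :: "(nat set \<times> nat) list \<Rightarrow> val" where
  "eresolved rh = val_of_list (map (\<lambda>(P, p). VCons (enc_request P) (enc_page p)) rh)"

lemma elist_simps [simp]: "elist [] = VNil" "elist (x # xs) = VCons (enc_page x) (elist xs)"
  by (simp_all add: elist_def)

lemma ehist_simps [simp]: "ehist [] = VNil" "ehist ((p, b) # h) = VCons (VCons (enc_page p) (eb b)) (ehist h)"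
  by (simp_all add: ehist_def)

lemma eresolved_simps [simp]: "eresolved [] = VNil"
  "eresolved ((P, p) # rh) = VCons (VCons (enc_request P) (enc_page p)) (eresolved rh)"
  by (simp_all add: eresolved_def)

lemma enc_config_simps [simp]: "enc_config [] = VNil" "enc_config (c # s) = VCons (enc_slot_content c) (enc_config s)"
  by (simp_all add: enc_config_def)

context
  fixes a b :: expr
begin

text \<open>The comparison descends only as far as \<open>w\<close> does, so the size of
  \<open>w\<close> alone bounds the time. This makes the costs of comparing one value with all
  members of a list add up to the size of the list.\<close>

lemma runs_eq: "runs (prog a b) 2 (VCons u w) (eb (u = w)) (40 * vsize w)"
proof (induction u arbitrary: w)
  case VNil
  show ?case by (rule runsI; cases w) (simp_all add: e_eq_def)
next
  case (VCons u1 u2)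
  show ?case
  proof (cases w)
    case VNil
    show ?thesis unfolding VNil by (rule runsI) (simp_all add: e_eq_def)
  next
    case w: (VCons w1 w2)
    from VCons[of w1] VCons[of w2] show ?thesis
      unfolding w by (intro runsI) (auto simp: e_eq_def runs_def)
  qed
qed

lemma runs_mem: "runs (prog a b) 3 (VCons x (val_of_list vs)) (eb (x \<in> set vs)) (80 * vsize (val_of_list vs))"
proof (induction vs)
  case Nil
  show ?case by (rule runsI) (simp_all add: e_mem_def)
next
  case (Cons v vs)
  from Cons runs_eq[of x v] show ?case
    by (intro runsI) (auto simp: e_mem_def runs_def)
qed

lemma runs_mem_pages: "runs (prog a b) 3 (VCons (enc_page p) (elist xs)) (eb (p \<in> set xs)) (80 * vsize (elist xs))"
  using runs_mem[of "enc_page p" "map enc_page xs"] unfolding elist_def by (simp add: image_iff)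

lemma runs_sub:
  "runs (prog a b) 4 (VCons (elist xs) (elist ys)) (eb (set xs \<subseteq> set ys)) (200 * (vsize (elist xs) * vsize (elist ys)))"
proof (induction xs)
  case Nil
  show ?case using vsize_ge1[of "elist ys"] by (intro runsI) (simp_all add: e_sub_def)
next
  case (Cons x xs)
  show ?case
    using Cons runs_mem_pages[of x ys] vsize_ge1[of "elist ys"]
    by (intro runsI) (auto simp: e_sub_def runs_def algebra_simps)
qed

lemma runs_lookup:
  assumes "finite P" "P \<noteq> {}" "\<And>Q q. (Q, q) \<in> set rh \<Longrightarrow> finite Q"
  shows "runs (prog a b) 5 (VCons (enc_request P) (eresolved rh)) (enc_page (lookup rh P))
    (400 * (vsize (eresolved rh) * vsize (enc_request P)))"
  using assms(3)
proof (induction rh)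
  case Nil
  obtain x xs where "sorted_list_of_set P = x # xs" using assms by (cases "sorted_list_of_set P") auto
  moreover from this have "x = Min P" using assms by (simp add: sorted_list_of_set_nonempty)
  ultimately show ?case using vsize_ge1[of "enc_request P"]
    by (intro runsI) (simp_all add: e_lookup_def enc_request_def)
next
  case (Cons z rh)
  obtain Q q where z: "z = (Q, q)" by (cases z)
  have Q: "finite Q" using Cons.prems z by auto
  have req: "enc_request R = elist (sorted_list_of_set R)" for R by (simp add: enc_request_def elist_def)
  have sub: "runs (prog a b) 4 (VCons (enc_request Q) (enc_request P)) (eb (Q \<subseteq> P)) (200 * (vsize (enc_request Q) * vsize (enc_request P)))"
    using runs_sub[of "sorted_list_of_set Q" "sorted_list_of_set P"] Q assms(1) by (simp add: req)
  have IH: "runs (prog a b) 5 (VCons (enc_request P) (eresolved rh)) (enc_page (lookup rh P))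
    (400 * (vsize (eresolved rh) * vsize (enc_request P)))" using Cons by auto
  show ?case unfolding z
    using sub IH vsize_ge1[of "enc_request P"]
    by (intro runsI) (auto simp: e_lookup_def runs_def algebra_simps)
qed

lemma runs_min: "runs (prog a b) 6 (VCons (enc_slots m) (val_of_list vs)) (enc_slots (min m (length vs))) (40 * vsize (val_of_list vs))"
proof (induction vs arbitrary: m)
  case Nil
  show ?case by (rule runsI; cases m) (simp_all add: e_min_def)
next
  case (Cons v vs)
  show ?case
  proof (cases m)
    case 0
    then show ?thesis by (intro runsI) (simp_all add: e_min_def)
  next
    case (Suc m')
    with Cons[of m'] show ?thesis by (intro runsI) (auto simp: e_min_def runs_def)
  qed
qed

lemma runs_rk:
  assumes "length s = k" "vsize (enc_config s) \<le> n" "vsize (ehist h) + vsize (elist xs) \<le> n"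
  shows "runs (prog a b) 7 (VCons (enc_config s) (VCons (ehist h) (elist xs))) (enc_slots (rk k h (set xs)))
    (1000 * (n * Suc (length h)))"
  using assms
proof (induction h arbitrary: xs)
  case Nil
  then show ?case by (intro runsI) (simp_all add: e_rk_def)
next
  case (Cons z h)
  obtain p m where z: "z = (p, m)" by (cases z)
  \<comment> \<open>A contraction moves a page from the history into the queried set, so the
    combined size does not grow along the recursion.\<close>
  have size: "vsize (ehist h) + vsize (elist xs) \<le> n" "vsize (ehist h) + vsize (elist (p # xs)) \<le> n"
    using Cons.prems z by auto
  note IH1 = Cons.IH[OF Cons.prems(1,2) size(1)] and IH2 = Cons.IH[OF Cons.prems(1,2) size(2)]
  have tl: "vtl (enc_config s) = val_of_list (map enc_slot_content (tl s))" "length (tl s) = k - 1"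
    using Cons.prems(1) by (cases s; simp add: enc_config_def)+
  have vtl: "vsize (val_of_list (map enc_slot_content (tl s))) \<le> n"
    using Cons.prems(2) by (cases s) (simp_all add: enc_config_def)
  have min: "runs (prog a b) 6 (VCons (enc_slots (rk k h (set xs))) (vtl (enc_config s))) (enc_slots (min (rk k h (set xs)) (k - 1))) (40 * n)"
    using runs_min[of "rk k h (set xs)" "map enc_slot_content (tl s)"] vtl tl
    by (auto intro: runs_mono)
  have base: "runs (prog a b) 8 (VCons (enc_config s) (VCons (ehist ((p, m) # h)) (elist xs)))
    (enc_slots (if m then rk k h (insert p (set xs)) - 1 else min (rk k h (set xs)) (k - 1)))
    (1000 * (n * Suc (length h)) + 40 * n + 60)"
    using IH1 IH2 min by (intro runsI) (auto simp: e_rk_base_def runs_def)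
  have "1 \<le> n" "vsize (elist xs) \<le> n" using size(1) vsize_ge1[of "ehist h"] by auto
  then show ?case unfolding z
    using base runs_mem_pages[of p xs] by (intro runsI) (auto simp: e_rk_def runs_def algebra_simps)
qed

lemma runs_prefix:
  "runs (prog a b) 9 (VCons (enc_page e) (elist xs)) (elist (takeWhile (\<lambda>x. x \<noteq> e) xs)) (80 * vsize (elist xs))"
proof (induction xs)
  case Nil
  show ?case by (intro runsI) (simp_all add: e_prefix_def)
next
  case (Cons x xs)
  with runs_eq[of "enc_page e" "enc_page x"] show ?case
    by (intro runsI) (auto simp: e_prefix_def runs_def)
qed

lemma vsize_takeWhile_le: "vsize (elist (takeWhile Q xs)) \<le> vsize (elist xs)"
  by (induction xs) auto

end

text \<open>Kept opaque, so that linear arithmetic can treat products in time bounds as atoms.\<close>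

definition sq :: "nat \<Rightarrow> nat" where "sq n = n * n"

definition cb :: "nat \<Rightarrow> nat" where "cb n = n * n * n"

lemma sq_ge: "1 \<le> n \<Longrightarrow> 1 \<le> sq n" "1 \<le> n \<Longrightarrow> n \<le> sq n"
  by (simp_all add: sq_def)

lemma cb_ge: "1 \<le> n \<Longrightarrow> 1 \<le> cb n" "1 \<le> n \<Longrightarrow> sq n \<le> cb n"
  by (simp_all add: sq_def cb_def)

lemma vsize_enc_config_ge: "2 * length s + 1 \<le> vsize (enc_config s)"
proof (induction s)
  case (Cons c s)
  then show ?case using vsize_ge1[of "enc_slot_content c"] by simp
qed simp

lemma length_ehist_le: "Suc (length h) \<le> vsize (ehist h)"
  using length_le_vsize[of "map (\<lambda>(p, b). VCons (enc_page p) (eb b)) h"] by (simp add: ehist_def)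

lemma length_elist_le: "Suc (length xs) \<le> vsize (elist xs)"
  using length_le_vsize[of "map enc_page xs"] by (simp add: elist_def)

lemma vsize_page_config: "Some e \<in> set s \<Longrightarrow> vsize (enc_page e) < vsize (enc_config s)"
  by (induction s) auto

definition ectx :: "config \<Rightarrow> (nat \<times> bool) list \<Rightarrow> nat list \<Rightarrow> nat \<Rightarrow> val" where
  "ectx s h xs p = VCons (VCons (enc_config s) (ehist h)) (VCons (elist xs) (enc_page p))"

context
  fixes a b :: expr
begin

lemma runs_reject2:
  assumes "length s = k" "k \<ge> 1" "vsize (enc_config s) \<le> n" "vsize (ehist h) + vsize (elist (e # ws)) \<le> n"
  shows "runs (prog a b) 11 (VCons (elist ws) (VCons (enc_page e) (ectx s h xs p)))
    (eb (rk k h (set ws) = rk k h (insert e (set ws)))) (3000 * sq n)"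
proof -
  have "vsize (ehist h) + vsize (elist ws) \<le> n" using assms(4) by simp
  note 1 = runs_rk[OF assms(1,3) this, of a b] and 2 = runs_rk[OF assms(1,3,4), of a b]
  have "Suc (length h) \<le> n" using length_ehist_le[of h] assms(4) by simp
  then have t: "1000 * (n * Suc (length h)) \<le> 1000 * sq n" unfolding sq_def by (intro mult_le_mono2)
  note 1 = runs_mono[OF 1 t] and 2 = runs_mono[OF 2 t]
  have "vsize (enc_slots (rk k h (insert e (set ws)))) \<le> n"
    using rk_le[OF assms(2), of h "insert e (set ws)"] vsize_enc_config_ge[of s] assms by (simp add: vsize_enc_slots)
  moreover have n: "1 \<le> n" using assms(3) vsize_ge1[of "enc_config s"] by simp
  ultimately show ?thesis
    using 1 2 sq_ge[OF n] runs_eq[of a b "enc_slots (rk k h (set ws))" "enc_slots (rk k h (insert e (set ws)))"]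
    by (intro runsI) (auto simp: e_reject2_def runs_def ectx_def)
qed

lemma runs_reject:
  assumes "length s = k" "k \<ge> 1" "valid_hist k h" "vsize (enc_config s) \<le> n"
    "vsize (ehist h) + vsize (elist xs) + vsize (enc_page e) + 1 \<le> n"
  shows "runs (prog a b) 10 (VCons (enc_page e) (ectx s h xs p)) (eb (\<not> in_greedy (rk k h) xs e)) (4000 * sq n)"
proof -
  let ?ws = "takeWhile (\<lambda>x. x \<noteq> e) xs"
  have "vsize (ehist h) + vsize (elist (e # ?ws)) \<le> n"
    using assms(5) vsize_takeWhile_le[of "\<lambda>x. x \<noteq> e" xs] by simp
  note 1 = runs_reject2[OF assms(1,2,4) this, of xs p]
  have iff: "rk k h (set ?ws) = rk k h (insert e (set ?ws)) \<longleftrightarrow> \<not> in_greedy (rk k h) xs e"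
    using rank_fun_insert_ge[OF rank_fun_rk[OF assms(3)], of "set ?ws" e] by (auto simp: in_greedy_def)
  have "1 \<le> n" using assms(5) by simp
  note n = this sq_ge[OF this]
  from n show ?thesis
    using 1 runs_prefix[of a b e xs] assms(5) unfolding iff
    by (intro runsI) (auto simp: e_reject_def runs_def ectx_def)
qed

lemma runs_place:
  assumes "length s = k" "k \<ge> 1" "valid_hist k h" "vsize (enc_config s) \<le> n"
    and "\<And>e. Some e \<in> set c \<Longrightarrow> vsize (ehist h) + vsize (elist xs) + vsize (enc_page e) + 1 \<le> n"
  shows "runs (prog a b) 12 (VCons (enc_config c) (ectx s h xs p))
    (enc_config (place (in_greedy (rk k h) xs) p c)) (5000 * sq n * Suc (length c))"
  using assms(5)
proof (induction c)
  case Nil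
  have "1 \<le> n" using assms(4) vsize_ge1[of "enc_config s"] by simp
  from sq_ge[OF this] show ?case by (intro runsI) (auto simp: e_place_def)
next
  case (Cons d c)
  have "1 \<le> n" using assms(4) vsize_ge1[of "enc_config s"] by simp
  note n = this sq_ge[OF this]
  have IH: "runs (prog a b) 12 (VCons (enc_config c) (ectx s h xs p))
    (enc_config (place (in_greedy (rk k h) xs) p c)) (5000 * sq n * Suc (length c))"
    using Cons by auto
  show ?case
  proof (cases d)
    case None
    then show ?thesis using n by (intro runsI) (auto simp: e_place_def ectx_def)
  next
    case (Some e)
    have "runs (prog a b) 10 (VCons (enc_page e) (ectx s h xs p)) (eb (\<not> in_greedy (rk k h) xs e)) (4000 * sq n)"
      using runs_reject[OF assms(1-4) Cons.prems] Some by simp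
    then show ?thesis using Some n IH
      by (intro runsI) (auto simp: e_place_def runs_def ectx_def)
  qed
qed

lemma runs_step2:
  assumes "length s = k" "k \<ge> 1" "valid_hist k h"
    "vsize (enc_config s) + vsize (ehist h) + vsize (elist xs) + 1 \<le> n"
  shows "runs (prog a b) 14 (ectx s h xs p)
    (VCons (enc_config (if Some p \<in> set s then s else place (in_greedy (rk k h) xs) p s)) (ehist h)) (5200 * cb n)"
proof -
  have place: "runs (prog a b) 12 (VCons (enc_config s) (ectx s h xs p))
    (enc_config (place (in_greedy (rk k h) xs) p s)) (5000 * sq n * Suc (length s))"
    using assms(4) vsize_page_config[of _ s] by (intro runs_place[OF assms(1-3)]) force+
  have "Suc (length s) \<le> n" using vsize_enc_config_ge[of s] assms(4) by simp
  then have "5000 * sq n * Suc (length s) \<le> 5000 * sq n * n" by (rule mult_le_mono2)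
  also have "\<dots> = 5000 * cb n" by (simp add: sq_def cb_def)
  finally have place: "runs (prog a b) 12 (VCons (enc_config s) (ectx s h xs p))
    (enc_config (place (in_greedy (rk k h) xs) p s)) (5000 * cb n)"
    using place runs_mono by blast
  have "VCons (enc_page p) VNil = enc_slot_content c \<longleftrightarrow> c = Some p" for c by (cases c) auto
  then have m: "VCons (enc_page p) VNil \<in> set (map enc_slot_content s) \<longleftrightarrow> Some p \<in> set s"
    by (auto simp: image_iff)
  have mem: "runs (prog a b) 3 (VCons (VCons (enc_page p) VNil) (enc_config s)) (eb (Some p \<in> set s)) (80 * vsize (enc_config s))"
    using runs_mem[of a b "VCons (enc_page p) VNil" "map enc_slot_content s"] unfolding m enc_config_def .
  have "1 \<le> n" using assms(4) by simp
  note n = this sq_ge[OF this] cb_ge[OF this]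
  from n show ?thesis using place mem assms(4)
    by (intro runsI) (auto simp: e_step2_def runs_def ectx_def)
qed

lemma runs_step:
  assumes "length s = k" "k \<ge> 1" "valid_hist k h"
    "vsize (enc_config s) + vsize (ehist h) + vsize (elist xs) + vsize (enc_page p) + 10 \<le> n"
  shows "runs (prog a b) 13 (ectx s h xs p)
    (VCons (enc_config (serve k h xs p s)) (ehist (mark k h p))) (7000 * cb n)"
proof -
  have "vsize (ehist (mark k h p)) \<le> vsize (ehist h) + vsize (enc_page p) + 5"
    by (simp add: mark_def eb_def)
  then have "runs (prog a b) 14 (ectx s (mark k h p) xs p)
    (VCons (enc_config (if Some p \<in> set s then s else place (in_greedy (rk k (mark k h p)) xs) p s)) (ehist (mark k h p)))
    (5200 * cb n)"
    using assms by (intro runs_step2) auto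
  then have step2: "runs (prog a b) 14 (ectx s (mark k h p) xs p)
    (VCons (enc_config (serve k h xs p s)) (ehist (mark k h p))) (5200 * cb n)"
    by (simp add: serve_def)
  have rk: "runs (prog a b) 7 (VCons (enc_config s) (VCons (ehist h) (elist [p]))) (enc_slots (rk k h {p})) (1000 * (n * Suc (length h)))"
    using runs_rk[OF assms(1), of n h "[p]" a b] assms(4) by simp
  have "Suc (length h) \<le> n" using length_ehist_le[of h] assms(4) by simp
  then have "1000 * (n * Suc (length h)) \<le> 1000 * sq n" unfolding sq_def by (intro mult_le_mono2)
  note rk = runs_mono[OF rk this]
  have "1 \<le> n" using assms(4) by simp
  note n = this sq_ge[OF this] cb_ge[OF this]
  from n show ?thesis using step2 rk assms(4)
    by (intro runsI) (auto simp: e_step_def runs_def ectx_def mark_def)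
qed

end

definition emem :: "config \<Rightarrow> (nat \<times> bool) list \<Rightarrow> (nat set \<times> nat) list \<Rightarrow> nat list \<Rightarrow> val" where
  "emem s h rh xs = VCons (elist xs) (VCons (VCons (enc_config s) (ehist h)) (eresolved rh))"

definition memory :: "val \<Rightarrow> config \<Rightarrow> (nat \<times> bool) list \<Rightarrow> (nat set \<times> nat) list \<Rightarrow> nat list \<Rightarrow> bool" where
  "memory m s h rh xs \<longleftrightarrow> m = emem s h rh xs \<and> xs \<noteq> [] \<or>
     m = enc_slots (length s) \<and> s = replicate (length s) None \<and> s \<noteq> [] \<and> h = [] \<and> rh = [] \<and> xs = []"

text \<open>The unary number \<open>k\<close> in the initial memory doubles as the encoding of the
  empty cache.\<close>

lemma enc_config_replicate: "enc_config (replicate k None) = enc_slots k"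
  by (induction k) simp_all

lemma runs_prep:
  assumes "length s = k" "k \<ge> 1" "valid_hist k h" and m: "memory m s h rh xs"
    and P: "finite P" "P \<noteq> {}" "\<And>Q q. (Q, q) \<in> set rh \<Longrightarrow> finite Q"
    and n: "vsize (enc_config s) + vsize (ehist h) + vsize (elist xs) + vsize (enc_page (lookup rh P)) + 10 \<le> n"
      "vsize (eresolved rh) \<le> n" "vsize (enc_request P) \<le> n"
  shows "runs (prog a b) 15 (VCons m (enc_request P))
    (VCons (VCons (enc_page (lookup rh P)) (elist xs))
      (VCons (VCons (enc_config (serve k h xs (lookup rh P) s)) (ehist (mark k h (lookup rh P))))
        (eresolved ((P, lookup rh P) # rh))))
    (8000 * cb n)"
proof -
  let ?p = "lookup rh P"
  let ?v = "VCons (VCons (enc_page ?p) (elist xs))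
      (VCons (VCons (enc_config (serve k h xs ?p s)) (ehist (mark k h ?p))) (eresolved ((P, ?p) # rh)))"
  have "1 \<le> n" using n by simp
  note n3 = this sq_ge[OF this] cb_ge[OF this]
  have 17: "runs (prog a b) 17 (VCons (emem s h rh xs) (VCons (enc_request P) (enc_page ?p))) ?v (7000 * cb n + 60)"
    using runs_step[OF assms(1-3) n(1), of a b]
    by (intro runsI) (auto simp: e_prep3_def runs_def emem_def ectx_def)
  have "vsize (eresolved rh) * vsize (enc_request P) \<le> sq n" unfolding sq_def using n by (intro mult_le_mono)
  then have "runs (prog a b) 5 (VCons (enc_request P) (eresolved rh)) (enc_page ?p) (400 * sq n)"
    by (intro runs_mono[OF runs_lookup[OF P]]) auto
  with 17 have 16: "runs (prog a b) 16 (VCons (emem s h rh xs) (enc_request P)) ?v (7000 * cb n + 400 * sq n + 100)"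
    by (intro runsI) (auto simp: e_prep2_def runs_def emem_def)
  from m consider "m = emem s h rh xs" "xs \<noteq> []" |
    "m = enc_slots (length s)" "s = replicate (length s) None" "s \<noteq> []" "h = []" "rh = []" "xs = []"
    by (auto simp: memory_def)
  then show ?thesis
  proof cases
    case 1
    then obtain y ys where "xs = y # ys" by (cases xs) auto
    then have "elist xs \<noteq> VNil" by simp
    with 16 n3 show ?thesis unfolding 1(1)
      by (intro runsI) (auto simp: e_prep_def runs_def emem_def)
  next
    case 2
    have "enc_config s = m" using 2 enc_config_replicate by metis
    moreover have "vhd m = VNil" using 2 by (cases s) auto
    ultimately show ?thesis using 16 n3 2(4-6)
      by (intro runsI) (auto simp: e_prep_def runs_def emem_def)
  qed
qed

context
  fixes a b :: expr
begin

lemma runs_splits: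
  "runs (prog a b) 19 (VCons (elist us) (elist vs))
    (val_of_list (map (\<lambda>i. VCons (elist (rev (take i vs) @ us)) (elist (drop i vs))) [0..<Suc (length vs)]))
    (40 * vsize (elist vs))"
proof (induction vs arbitrary: us)
  case Nil
  show ?case by (intro runsI) (auto simp: e_splits_def)
next
  case (Cons v vs)
  have "map (\<lambda>i. VCons (elist (rev (take i (v # vs)) @ us)) (elist (drop i (v # vs)))) [0..<Suc (length (v # vs))] =
      VCons (elist us) (elist (v # vs)) #
      map (\<lambda>i. VCons (elist (rev (take i vs) @ v # us)) (elist (drop i vs))) [0..<Suc (length vs)]"
    by (subst upt_conv_Cons) (simp_all add: map_Suc_upt[symmetric] comp_def del: upt_Suc)
  with Cons[of "v # us"] show ?case
    by (intro runsI) (auto simp: e_splits_def runs_def simp del: upt_Suc)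
qed

lemma runs_revapp: "runs (prog a b) 20 (VCons (elist us) (elist vs)) (elist (rev us @ vs)) (40 * Suc (length us))"
proof (induction us arbitrary: vs)
  case Nil
  show ?case by (intro runsI) (auto simp: e_revapp_def)
next
  case (Cons u us)
  from Cons[of "u # vs"] show ?case by (intro runsI) (auto simp: e_revapp_def runs_def)
qed

lemma runs_combine:
  "runs (prog a b) 21 (VCons (VCons (elist us) (elist vs)) (enc_page p)) (elist (rev us @ p # vs)) (40 * Suc (length us) + 20)"
  using runs_revapp[of us "p # vs"] by (intro runsI) (auto simp: e_combine_def runs_def)

end

lemma list_of_val_of_list [simp]: "list_of_val (val_of_list vs) = vs"
  by (induction vs) simp_all

text \<open>The expression \<open>b\<close> computes the next order, given \<open>((page, order), rest)\<close>.\<close>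

definition realizes :: "expr \<Rightarrow> (nat \<Rightarrow> nat list \<Rightarrow> nat list pmf) \<Rightarrow> bool" where
  "realizes b nx \<longleftrightarrow> (\<forall>a p xs R. \<exists>M. map_pmf fst M = nx p xs \<and>
     (\<forall>ys t. (ys, t) \<in> set_pmf M \<longrightarrow> t \<le> 1000 * vsize (elist xs)) \<and>
     eval (prog a b) (VCons (VCons (enc_page p) (elist xs)) R) b =
       spmf_of_pmf (map_pmf (\<lambda>(ys, t). (VCons (elist ys) R, t)) M))"

text \<open>The order by recency. Older occurrences of \<open>p\<close> are not deleted, because
  only the first occurrence of a page determines its prefix; the list thus grows by one per
  request.\<close>

lemma realizes_det: "realizes Arg (\<lambda>p xs. return_pmf (p # xs))"
  unfolding realizes_def
proof (intro allI)
  fix a p xs R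
  show "\<exists>M. map_pmf fst M = return_pmf (p # xs) \<and>
     (\<forall>ys t. (ys, t) \<in> set_pmf M \<longrightarrow> t \<le> 1000 * vsize (elist xs)) \<and>
     eval (prog a Arg) (VCons (VCons (enc_page p) (elist xs)) R) Arg =
       spmf_of_pmf (map_pmf (\<lambda>(ys, t). (VCons (elist ys) R, t)) M)"
    using vsize_ge1[of "elist xs"] by (intro exI[of _ "return_pmf (p # xs, 1)"]) (auto simp: eval_simps)
qed

lemma realizes_rand: "realizes e_order_rand ins_kernel"
  unfolding realizes_def
proof (intro allI)
  fix a p xs R
  define F where "F = prog a e_order_rand"
  have F: "length F = 28" "F ! 21 = e_combine" by (simp_all add: F_def)
  let ?x = "VCons (VCons (enc_page p) (elist xs)) R"
  have mem: "eval F ?x (Call 3 (Hd Arg)) = return_spmf (eb (p \<in> set xs), ev_time F ?x (Call 3 (Hd Arg)))"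
    using runs_mem_pages[of a e_order_rand p xs, folded F_def] by (subst eval_det) (auto simp: runs_def)
  have mem2: "ev_time F ?x (Call 3 (Hd Arg)) \<le> 80 * vsize (elist xs) + 10"
    using runs_mem_pages[of a e_order_rand p xs, folded F_def] by (simp add: runs_def)
  define t0 where "t0 = ev_time F ?x (Call 3 (Hd Arg))"
  have vx: "1 \<le> vsize (elist xs)" by (rule vsize_ge1)
  show "\<exists>M. map_pmf fst M = ins_kernel p xs \<and>
     (\<forall>ys t. (ys, t) \<in> set_pmf M \<longrightarrow> t \<le> 1000 * vsize (elist xs)) \<and>
     eval (prog a e_order_rand) ?x e_order_rand = spmf_of_pmf (map_pmf (\<lambda>(ys, t). (VCons (elist ys) R, t)) M)"
  proof (cases "p \<in> set xs")
    case True
    have "eval F ?x e_order_rand = return_spmf (VCons (elist xs) R, t0 + 7)"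
      unfolding e_order_rand_def eval_simps(6) mem t0_def[symmetric] using True by (simp add: eval_simps)
    then show ?thesis using True mem2 vx
      by (intro exI[of _ "return_pmf (xs, t0 + 7)"]) (auto simp: ins_kernel_def t0_def F_def[symmetric])
  next
    case False
    let ?n = "Suc (length xs)"
    let ?L = "map (\<lambda>i. VCons (elist (rev (take i xs))) (elist (drop i xs))) [0..<?n]"
    have sp: "runs F 19 (VCons VNil (elist xs)) (val_of_list ?L) (40 * vsize (elist xs))"
      using runs_splits[of a e_order_rand "[]" xs, folded F_def] by simp
    define t1 where "t1 = snd (cres F 19 (VCons VNil (elist xs)))"
    have ch: "eval F (VCons VNil (elist xs)) (F ! 19) = return_spmf (val_of_list ?L, t1)"
      using cok_eval[of F 19 "VCons VNil (elist xs)"] sp by (simp add: runs_def t1_def prod_eq_iff del: upt_Suc)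
    have t1: "t1 \<le> 40 * vsize (elist xs)"
      unfolding t1_def using sp by (simp add: runs_def)
    define c where "c = (\<lambda>i. snd (cres F 21 (VCons (?L ! i) (enc_page p))))"
    have comb: "runs F 21 (VCons (?L ! i) (enc_page p)) (elist (take i xs @ p # drop i xs)) (40 * Suc i + 20)"
      if "i < ?n" for i
      using runs_combine[of a e_order_rand "rev (take i xs)" "drop i xs" p, folded F_def] that by (simp del: upt_Suc)
    have ev21: "eval F (VCons (?L ! i) (enc_page p)) e_combine = return_spmf (elist (take i xs @ p # drop i xs), c i)"
      and c: "c i \<le> 40 * Suc i + 20" if "i < ?n" for i
    proof -
      have "cok F 21 (VCons (?L ! i) (enc_page p))" using comb[OF that] by (simp add: runs_def)
      from cok_eval[OF this] comb[OF that]
      show "eval F (VCons (?L ! i) (enc_page p)) e_combine = return_spmf (elist (take i xs @ p # drop i xs), c i)"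
        by (simp add: runs_def c_def prod_eq_iff F del: upt_Suc)
      show "c i \<le> 40 * Suc i + 20" using comb[OF that] by (simp add: runs_def c_def)
    qed
    \<comment> \<open>The running time depends on the chosen position, since reversing the prefix
      takes time proportional to its length.\<close>
    define T where "T = (\<lambda>i. t0 + t1 + ?n + c i + 16)"
    have "eval F ?x e_order_rand = bind_spmf (spmf_of_set {..<?n})
        (\<lambda>i. return_spmf (VCons (elist (take i xs @ p # drop i xs)) R, T i))"
    proof -
      have "eval F ?x e_order_rand = bind_spmf (spmf_of_set {..<?n})
        (\<lambda>i. bind_spmf (eval F (VCons (?L ! i) (enc_page p)) e_combine)
           (\<lambda>(v, j). return_spmf (VCons v R, t0 + t1 + ?n + j + 16)))"
        unfolding e_order_rand_def eval_simps(6) mem t0_def[symmetric]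
        using False by (simp add: eval_simps F ch case_prod_unfold del: upt_Suc)
          (simp add: algebra_simps eval_nat_numeral del: upt_Suc)
      also have "\<dots> = bind_spmf (spmf_of_set {..<?n}) (\<lambda>i. return_spmf (VCons (elist (take i xs @ p # drop i xs)) R, T i))"
        by (intro bind_spmf_cong refl) (subst ev21, auto simp: T_def simp del: upt_Suc)
      finally show ?thesis .
    qed
    also have "\<dots> = spmf_of_pmf (map_pmf (\<lambda>i. (VCons (elist (take i xs @ p # drop i xs)) R, T i)) (pmf_of_set {..<?n}))"
      by (subst spmf_of_pmf_pmf_of_set[symmetric])
        (auto simp: lessThan_empty_iff map_spmf_of_pmf[symmetric] map_spmf_conv_bind_spmf simp del: map_spmf_of_pmf spmf_of_pmf_pmf_of_set)
    finally have ev: "eval F ?x e_order_rand =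
        spmf_of_pmf (map_pmf (\<lambda>i. (VCons (elist (take i xs @ p # drop i xs)) R, T i)) (pmf_of_set {..<?n}))" .
    have "T i \<le> 1000 * vsize (elist xs)" if "i < ?n" for i
      using mem2 t1 c[OF that] that vx length_elist_le[of xs] by (simp add: T_def t0_def)
    then show ?thesis
      by (intro exI[of _ "map_pmf (\<lambda>i. (take i xs @ p # drop i xs, T i)) (pmf_of_set {..<?n})"])
        (auto simp: F_def[symmetric] ev False ins_kernel_def map_pmf_comp set_pmf_of_set lessThan_empty_iff)
  qed
qed

section \<open>The three algorithms\<close>

lemma bind_pmf_return_spmf: "bind_pmf p (\<lambda>x. return_spmf (f x)) = spmf_of_pmf (map_pmf f p)"
  by (simp add: spmf_of_pmf_def map_pmf_def bind_assoc_pmf bind_return_pmf)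

lemma exec_online:
  assumes b: "realizes b nx"
    and "length s = k" "k \<ge> 1" "valid_hist k h" "memory m s h rh xs"
    and "finite P" "P \<noteq> {}" "\<And>Q q. (Q, q) \<in> set rh \<Longrightarrow> finite Q"
    and n: "vsize (enc_config s) + vsize (ehist h) + vsize (elist xs) + vsize (enc_page (lookup rh P)) + 10 \<le> n"
      "vsize (eresolved rh) \<le> n" "vsize (enc_request P) \<le> n"
  shows "\<exists>M. map_pmf fst M = nx (lookup rh P) xs \<and> (\<forall>ys t. (ys, t) \<in> set_pmf M \<longrightarrow> t \<le> 10000 * cb n) \<and>
    exec (prog e_online b) (VCons m (enc_request P)) = spmf_of_pmf (map_pmf
      (\<lambda>(ys, t). (VCons (emem (serve k h xs (lookup rh P) s) (mark k h (lookup rh P)) ((P, lookup rh P) # rh) ys)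
         (enc_config (serve k h xs (lookup rh P) s)), t)) M)"
proof -
  define F where "F = prog e_online b"
  have F: "length F = 28" "F ! 0 = e_online" "F ! Suc 0 = b" "F ! 18 = e_fin" by (simp_all add: F_def)
  let ?p = "lookup rh P"
  let ?s = "serve k h xs ?p s"
  let ?R = "VCons (VCons (enc_config ?s) (ehist (mark k h ?p))) (eresolved ((P, ?p) # rh))"
  let ?v = "VCons (VCons (enc_page ?p) (elist xs)) ?R"
  let ?x = "VCons m (enc_request P)"
  have prep: "runs F 15 ?x ?v (8000 * cb n)"
    unfolding F_def by (rule runs_prep[OF assms(2-11)])
  define t15 where "t15 = snd (cres F 15 ?x)"
  have ev15: "eval F ?x (F ! 15) = return_spmf (?v, t15)" and t15: "t15 \<le> 8000 * cb n"
    using cok_eval[of F 15 ?x] prep by (simp_all add: runs_def t15_def prod_eq_iff)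
  obtain M where M: "map_pmf fst M = nx ?p xs" "\<And>ys t. (ys, t) \<in> set_pmf M \<Longrightarrow> t \<le> 1000 * vsize (elist xs)"
    "eval F ?v b = spmf_of_pmf (map_pmf (\<lambda>(ys, t). (VCons (elist ys) ?R, t)) M)"
    using b unfolding realizes_def F_def by blast
  define M' where "M' = map_pmf (\<lambda>(ys, t). (ys, 12 + (t15 + t))) M"
  have fin: "eval F v e_fin = return_spmf (VCons v (vhd (vhd (vtl v))), 6)" for v
    by (simp add: e_fin_def eval_simps)
  have "exec F ?x = bind_pmf M (\<lambda>(ys, t). return_spmf (VCons (VCons (elist ys) ?R) (enc_config ?s), 12 + (t15 + t)))"
    unfolding exec_def
    by (simp add: eval_simps F e_online_def ev15 M(3)[unfolded eresolved_simps] fin case_prod_unfold bind_map_pmf)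
  also have "\<dots> = spmf_of_pmf (map_pmf (\<lambda>(ys, t). (VCons (VCons (elist ys) ?R) (enc_config ?s), 12 + (t15 + t))) M)"
    by (simp add: case_prod_unfold bind_pmf_return_spmf)
  also have "\<dots> = spmf_of_pmf (map_pmf (\<lambda>(ys, t). (VCons (emem ?s (mark k h ?p) ((P, ?p) # rh) ys) (enc_config ?s), t)) M')"
    by (simp add: M'_def map_pmf_comp case_prod_unfold emem_def)
  finally have "exec F ?x = spmf_of_pmf (map_pmf (\<lambda>(ys, t). (VCons (emem ?s (mark k h ?p) ((P, ?p) # rh) ys) (enc_config ?s), t)) M')" .
  moreover have "map_pmf fst M' = nx ?p xs"
    unfolding M'_def M(1)[symmetric] by (simp add: map_pmf_comp case_prod_unfold)
  moreover have "t \<le> 10000 * cb n" if mem: "(ys, t) \<in> set_pmf M'" for ys t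
  proof -
    obtain z where z: "z \<in> set_pmf M" "(ys, t) = (case z of (ys, t) \<Rightarrow> (ys, 12 + (t15 + t)))"
      using mem unfolding M'_def set_map_pmf by blast
    then have t': "(ys, snd z) \<in> set_pmf M" "t = 12 + (t15 + snd z)" by (auto split: prod.splits)
    have "1 \<le> n" "vsize (elist xs) \<le> n" using n(1) by auto
    then have "vsize (elist xs) \<le> cb n" "1 \<le> cb n"
      using sq_ge[of n] cb_ge[of n] by auto
    then show ?thesis using t' t15 M(2)[OF t'(1)] by simp
  qed
  ultimately show ?thesis unfolding F_def by blast
qed

text \<open>\<open>S\<close> will be a bound derived from the input size, and \<open>l\<close> is
  the number of requests still to come. Adding \<open>l\<close> to the lengths of the lists, which
  grow by at most one per request, makes the bound invariant.\<close>

definition small :: "nat \<Rightarrow> config \<Rightarrow> (nat \<times> bool) list \<Rightarrow> (nat set \<times> nat) list \<Rightarrow> nat list \<Rightarrow> nat \<Rightarrow> bool" where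
  "small S s h rh xs l \<longleftrightarrow> length s \<le> S \<and> length h + l \<le> S \<and> length rh + l \<le> S \<and> length xs + l \<le> S \<and>
     (\<forall>e. Some e \<in> set s \<longrightarrow> vsize (enc_page e) \<le> S) \<and> (\<forall>p\<in>fst ` set h. vsize (enc_page p) \<le> S) \<and>
     (\<forall>(Q, q)\<in>set rh. finite Q \<and> vsize (enc_request Q) \<le> S \<and> vsize (enc_page q) \<le> S) \<and>
     (\<forall>x\<in>set xs. vsize (enc_page x) \<le> S)"

lemma set_place: "set (place Q p s) \<subseteq> insert (Some p) (set s)"
  by (induction s) auto

lemma set_serve: "set (serve k h xs p s) \<subseteq> insert (Some p) (set s)"
  unfolding serve_def by (simp add: set_place subset_insertI)

lemma small_step:
  assumes "small S s h rh xs (Suc l)" "vsize (enc_page p) \<le> S" "set ys \<subseteq> insert p (set xs)"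
    "length ys \<le> Suc (length xs)"
  shows "finite P \<Longrightarrow> vsize (enc_request P) \<le> S \<Longrightarrow> small S (serve k h xs p s) (mark k h p) ((P, p) # rh) ys l"
    and "small S (serve k h xs p s) (mark k h p) rh ys l"
  using assms set_serve[of k h xs p s] unfolding small_def by (auto simp: mark_def)

lemma vsize_val_of_list_le:
  "(\<And>v. v \<in> set vs \<Longrightarrow> vsize v \<le> M) \<Longrightarrow> vsize (val_of_list vs) \<le> Suc (length vs * Suc M)"
proof (induction vs)
  case (Cons v vs)
  from Cons.IH Cons.prems have "vsize (val_of_list vs) \<le> Suc (length vs * Suc M)" by auto
  moreover have "vsize v \<le> M" using Cons.prems by simp
  ultimately show ?case by simp
qed simp

lemma small_vsize:
  assumes "small S s h rh xs l" "1 \<le> S"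
  shows "vsize (enc_config s) \<le> 8 * sq S" "vsize (ehist h) \<le> 8 * sq S" "vsize (elist xs) \<le> 8 * sq S"
    "vsize (eresolved rh) \<le> 8 * sq S"
proof -
  have gen: "vsize (val_of_list vs) \<le> 8 * sq S"
    if "\<And>v. v \<in> set vs \<Longrightarrow> vsize v \<le> 2 * S + 4" "length vs \<le> S" for vs
  proof -
    have "vsize (val_of_list vs) \<le> Suc (length vs * Suc (2 * S + 4))"
      by (rule vsize_val_of_list_le) (rule that(1))
    also have "\<dots> \<le> Suc (S * Suc (2 * S + 4))" using that(2) by simp
    also have "\<dots> = 1 + 5 * S + 2 * sq S" by (simp add: sq_def algebra_simps)
    also have "\<dots> \<le> 8 * sq S" using sq_ge[OF assms(2)] by linarith
    finally show ?thesis .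
  qed
  have "vsize (enc_slot_content c) \<le> 2 * S + 4" if "c \<in> set s" for c
  proof (cases c)
    case (Some e)
    then have "vsize (enc_page e) \<le> S" using that assms(1) unfolding small_def by blast
    then show ?thesis using Some by simp
  qed simp
  then show "vsize (enc_config s) \<le> 8 * sq S"
    unfolding enc_config_def using assms(1) by (intro gen) (auto simp: small_def)
  show "vsize (ehist h) \<le> 8 * sq S"
    unfolding ehist_def using assms(1) by (intro gen) (fastforce simp: small_def eb_def)+
  show "vsize (elist xs) \<le> 8 * sq S"
    unfolding elist_def using assms(1) by (intro gen) (fastforce simp: small_def)+
  show "vsize (eresolved rh) \<le> 8 * sq S"
    unfolding eresolved_def using assms(1) by (intro gen) (fastforce simp: small_def)+
qed

lemma vsize_page_request: "finite P \<Longrightarrow> p \<in> P \<Longrightarrow> vsize (enc_page p) \<le> vsize (enc_request P)"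
  unfolding enc_request_def by (intro less_imp_le vsize_mem) simp

lemma vsize_lookup:
  assumes "small S s h rh xs l" "finite P" "P \<noteq> {}" "vsize (enc_request P) \<le> S"
  shows "vsize (enc_page (lookup rh P)) \<le> S"
proof -
  have "lookup rh P \<in> insert (Min P) (snd ` set rh)"
  proof (induction rh)
    case (Cons z rh)
    then show ?case by (cases z; cases "fst z \<subseteq> P") auto
  qed simp
  then show ?thesis
    using assms vsize_page_request[OF assms(2) Min_in[OF assms(2,3)]] unfolding small_def by fastforce
qed

text \<open>The witness \<open>N\<close> couples outputs with running times, since both depend on
  the same random choices; forgetting the time leaves the abstract process
  \<open>prun\<close>.\<close>

lemma online_run_prun:
  assumes b: "realizes b nx"
    and nx: "\<And>p xs ys. ys \<in> set_pmf (nx p xs) \<Longrightarrow> reorder p xs ys \<and> length ys \<le> Suc (length xs)"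
  shows "memory m s h rh xs \<Longrightarrow> cache_inv k s h xs \<Longrightarrow> small S s h rh xs (length \<pi>) \<Longrightarrow>
    (\<And>P. P \<in> set \<pi> \<Longrightarrow> finite P \<and> P \<noteq> {} \<and> vsize (enc_request P) \<le> S) \<Longrightarrow>
    \<exists>N. online_run (prog e_online b) m \<pi> = spmf_of_pmf (map_pmf (\<lambda>(Cs, t). (map enc_config Cs, t)) N) \<and>
      map_pmf fst N = prun k nx s h xs (resolve rh \<pi>) \<and>
      (\<forall>Cs t. (Cs, t) \<in> set_pmf N \<longrightarrow> t \<le> length \<pi> * (10000 * cb (60 * sq S)))"
proof (induction \<pi> arbitrary: m s h rh xs)
  case Nil
  show ?case by (intro exI[of _ "return_pmf ([], 0)"]) auto
next
  case (Cons P \<pi>)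
  define F where "F = prog e_online b"
  define p where "p = lookup rh P"
  define s' where "s' = serve k h xs p s"
  define h' where "h' = mark k h p"
  define rh' where "rh' = (P, p) # rh"
  \<comment> \<open>Cache, history and order take at most \<open>8 * sq S\<close> each, the page at
    most \<open>S\<close>; together with the constant 10 this is at most
    \<open>35 * sq S\<close>.\<close>
  let ?n = "60 * sq S"
  have inv: "length s = k" "k \<ge> 1" "valid_hist k h" using Cons.prems(2) by (auto simp: cache_inv_def)
  have P: "finite P" "P \<noteq> {}" "vsize (enc_request P) \<le> S" using Cons.prems(4) by auto
  have sm: "small S s h rh xs (Suc (length \<pi>))" using Cons.prems(3) by simp
  have S1: "1 \<le> S" using sm inv by (auto simp: small_def)
  have vp: "vsize (enc_page p) \<le> S" unfolding p_def by (rule vsize_lookup[OF sm P])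
  have finrh: "finite Q" if "(Q, q) \<in> set rh" for Q q using sm that by (auto simp: small_def)
  note sz = small_vsize[OF sm S1] and S2 = sq_ge[OF S1]
  have "\<exists>M. map_pmf fst M = nx p xs \<and> (\<forall>ys t. (ys, t) \<in> set_pmf M \<longrightarrow> t \<le> 10000 * cb ?n) \<and>
    exec F (VCons m (enc_request P)) =
       spmf_of_pmf (map_pmf (\<lambda>(ys, t). (VCons (emem s' h' rh' ys) (enc_config s'), t)) M)"
    unfolding F_def s'_def h'_def rh'_def p_def
  proof (rule exec_online[OF b inv Cons.prems(1) P(1,2)])
    show "vsize (enc_config s) + vsize (ehist h) + vsize (elist xs) + vsize (enc_page (lookup rh P)) + 10 \<le> ?n"
      using sz S2 vp unfolding p_def by linarith
    show "vsize (eresolved rh) \<le> ?n" "vsize (enc_request P) \<le> ?n" using sz S2 P(3) by linarith+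
  qed (rule finrh)
  then obtain M where M: "map_pmf fst M = nx p xs" "\<And>ys t. (ys, t) \<in> set_pmf M \<Longrightarrow> t \<le> 10000 * cb ?n"
    "exec F (VCons m (enc_request P)) =
       spmf_of_pmf (map_pmf (\<lambda>(ys, t). (VCons (emem s' h' rh' ys) (enc_config s'), t)) M)"
    by blast
  have "\<exists>N. online_run F (emem s' h' rh' ys) \<pi> = spmf_of_pmf (map_pmf (\<lambda>(Cs, t). (map enc_config Cs, t)) N) \<and>
      map_pmf fst N = prun k nx s' h' ys (resolve rh' \<pi>) \<and>
      (\<forall>Cs t. (Cs, t) \<in> set_pmf N \<longrightarrow> t \<le> length \<pi> * (10000 * cb ?n))" if "ys \<in> set_pmf (nx p xs)" for ys
    unfolding F_def
  proof (rule Cons.IH)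
    have re: "reorder p xs ys" "length ys \<le> Suc (length xs)" using nx[OF that] by auto
    then have ys: "set ys = insert p (set xs)" by (simp add: reorder_def)
    then show "memory (emem s' h' rh' ys) s' h' rh' ys" by (auto simp: memory_def)
    show "cache_inv k s' h' ys" unfolding s'_def h'_def by (rule cache_inv_serve[OF Cons.prems(2) re(1)])
    show "small S s' h' rh' ys (length \<pi>)"
      unfolding s'_def h'_def rh'_def by (rule small_step(1)[OF sm vp _ re(2) P(1,3)]) (simp add: ys)
  qed (use Cons.prems(4) in auto)
  then obtain N where N: "\<And>ys. ys \<in> set_pmf (nx p xs) \<Longrightarrow>
      online_run F (emem s' h' rh' ys) \<pi> = spmf_of_pmf (map_pmf (\<lambda>(Cs, t). (map enc_config Cs, t)) (N ys)) \<and>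
      map_pmf fst (N ys) = prun k nx s' h' ys (resolve rh' \<pi>) \<and>
      (\<forall>Cs t. (Cs, t) \<in> set_pmf (N ys) \<longrightarrow> t \<le> length \<pi> * (10000 * cb ?n))"
    by metis
  have inM: "fst z \<in> set_pmf (nx p xs)" if "z \<in> set_pmf M" for z
    using that unfolding M(1)[symmetric] by auto
  define N' where "N' = bind_pmf M (\<lambda>z. map_pmf (\<lambda>(Cs, t'). (s' # Cs, snd z + t')) (N (fst z)))"
  have "online_run F m (P # \<pi>) = bind_pmf M (\<lambda>z. bind_spmf (online_run F (emem s' h' rh' (fst z)) \<pi>)
      (\<lambda>(vs, j). return_spmf (enc_config s' # vs, snd z + j)))"
    by (simp add: M(3) case_prod_unfold bind_map_pmf)
  also have "\<dots> = bind_pmf M (\<lambda>z. spmf_of_pmf (map_pmf (\<lambda>(Cs, t). (enc_config s' # map enc_config Cs, snd z + t)) (N (fst z))))"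
  proof (intro bind_pmf_cong refl)
    fix z assume "z \<in> set_pmf M"
    from N[OF inM[OF this]]
    show "bind_spmf (online_run F (emem s' h' rh' (fst z)) \<pi>) (\<lambda>(vs, j). return_spmf (enc_config s' # vs, snd z + j)) =
      spmf_of_pmf (map_pmf (\<lambda>(Cs, t). (enc_config s' # map enc_config Cs, snd z + t)) (N (fst z)))"
      by (simp add: case_prod_unfold bind_map_pmf bind_pmf_return_spmf map_pmf_comp)
  qed
  also have "\<dots> = spmf_of_pmf (map_pmf (\<lambda>(Cs, t). (map enc_config Cs, t)) N')"
    by (simp add: N'_def spmf_of_pmf_bind map_bind_pmf map_pmf_comp case_prod_unfold)
  finally have 1: "online_run F m (P # \<pi>) = spmf_of_pmf (map_pmf (\<lambda>(Cs, t). (map enc_config Cs, t)) N')" .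
  have "map_pmf fst N' = bind_pmf M (\<lambda>z. map_pmf (\<lambda>Cs. s' # Cs) (map_pmf fst (N (fst z))))"
    by (simp add: N'_def map_bind_pmf map_pmf_comp case_prod_unfold)
  also have "\<dots> = bind_pmf M (\<lambda>z. map_pmf (\<lambda>Cs. s' # Cs) (prun k nx s' h' (fst z) (resolve rh' \<pi>)))"
    using N inM by (intro bind_pmf_cong) auto
  also have "\<dots> = bind_pmf (map_pmf fst M) (\<lambda>ys. map_pmf (\<lambda>Cs. s' # Cs) (prun k nx s' h' ys (resolve rh' \<pi>)))"
    by (simp add: bind_map_pmf)
  also have "\<dots> = prun k nx s h xs (resolve rh (P # \<pi>))"
    unfolding M(1) by (simp add: s'_def h'_def rh'_def p_def)
  finally have 2: "map_pmf fst N' = prun k nx s h xs (resolve rh (P # \<pi>))" .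
  have 3: "t \<le> length (P # \<pi>) * (10000 * cb ?n)" if "(Cs, t) \<in> set_pmf N'" for Cs t
  proof -
    from that obtain z Cs' t' where z: "z \<in> set_pmf M" "(Cs', t') \<in> set_pmf (N (fst z))" "t = snd z + t'"
      unfolding N'_def by auto
    have "snd z \<le> 10000 * cb ?n" using M(2)[of "fst z" "snd z"] z(1) by simp
    moreover have "t' \<le> length \<pi> * (10000 * cb ?n)" using N[OF inM[OF z(1)]] z(2) by blast
    ultimately show ?thesis using z(3) by simp
  qed
  from 1 2 3 show ?case unfolding F_def by blast
qed

section \<open>The offline program\<close>

context
  fixes a b :: expr
begin

lemma runs_append: "runs (prog a b) 24 (VCons (elist us) (elist vs)) (elist (us @ vs)) (40 * Suc (length us))"
proof (induction us)
  case Nil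
  show ?case by (intro runsI) (auto simp: e_append_def)
next
  case (Cons u us)
  then show ?case by (intro runsI) (auto simp: e_append_def runs_def)
qed

lemma runs_resolve:
  assumes "\<And>P. P \<in> set \<pi> \<Longrightarrow> finite P \<and> P \<noteq> {} \<and> vsize (enc_request P) \<le> S" "1 \<le> S"
    "small S [] [] rh [] (length \<pi>)"
  shows "runs (prog a b) 22 (VCons (eresolved rh) (val_of_list (map enc_request \<pi>))) (elist (resolve rh \<pi>))
    (Suc (length \<pi>) * (500 * cb (60 * sq S)))"
  using assms
proof (induction \<pi> arbitrary: rh)
  case Nil
  have "1 \<le> 60 * sq S" using sq_ge[OF Nil(2)] by simp
  from cb_ge(1)[OF this] show ?case by (intro runsI) (auto simp: e_resolve_def)
next
  case (Cons P \<pi>)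
  let ?p = "lookup rh P" and ?n = "60 * sq S"
  have P: "finite P" "P \<noteq> {}" "vsize (enc_request P) \<le> S" using Cons.prems(1) by auto
  have sm: "small S [] [] rh [] (Suc (length \<pi>))" using Cons.prems(3) by simp
  have vp: "vsize (enc_page ?p) \<le> S" by (rule vsize_lookup[OF sm P])
  have "small S [] [] ((P, ?p) # rh) [] (length \<pi>)" using sm P vp by (auto simp: small_def)
  then have IH: "runs (prog a b) 22 (VCons (eresolved ((P, ?p) # rh)) (val_of_list (map enc_request \<pi>)))
     (elist (resolve ((P, ?p) # rh) \<pi>)) (Suc (length \<pi>) * (500 * cb ?n))"
    using Cons.prems by (intro Cons.IH) auto
  have n1: "1 \<le> ?n" using sq_ge[OF Cons.prems(2)] by simp
  have "vsize (eresolved rh) \<le> ?n" "vsize (enc_request P) \<le> ?n"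
    using small_vsize(4)[OF sm Cons.prems(2)] sq_ge[OF Cons.prems(2)] P(3) by auto
  then have "vsize (eresolved rh) * vsize (enc_request P) \<le> ?n * ?n" by (intro mult_le_mono)
  also have "\<dots> \<le> cb ?n" using cb_ge(2)[OF n1] by (simp add: sq_def)
  finally have "400 * (vsize (eresolved rh) * vsize (enc_request P)) \<le> 400 * cb ?n" by simp
  note lk = runs_mono[OF runs_lookup[OF P(1,2)] this]
  have lk: "runs (prog a b) 5 (VCons (enc_request P) (eresolved rh)) (enc_page ?p) (400 * cb ?n)"
    using sm by (intro lk) (auto simp: small_def)
  have 23: "runs (prog a b) 23 (VCons (enc_page ?p) (VCons (eresolved rh) (val_of_list (map enc_request (P # \<pi>)))))
    (elist (resolve rh (P # \<pi>))) (Suc (length \<pi>) * (500 * cb ?n) + 40)"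
    using IH by (intro runsI) (auto simp: e_resolve2_def runs_def)
  have "100 \<le> 100 * cb ?n" using cb_ge(1)[OF n1] by simp
  then show ?case using 23 lk by (intro runsI) (auto simp: e_resolve_def runs_def)
qed

lemma runs_run:
  assumes "length s = k" "k \<ge> 1" "valid_hist k h" "small S s h [] xs (length ps)" "1 \<le> S"
    "\<And>p. p \<in> set ps \<Longrightarrow> vsize (enc_page p) \<le> S"
  shows "runs (prog a b) 25 (VCons (VCons (VCons (enc_config s) (ehist h)) (elist xs)) (elist ps))
    (val_of_list (map enc_config (off_run k s h xs ps))) (Suc (length ps) * (7100 * cb (60 * sq S)))"
  using assms
proof (induction ps arbitrary: s h xs)
  case Nil
  have "1 \<le> 60 * sq S" using sq_ge[OF Nil(5)] by simp
  from cb_ge(1)[OF this] show ?case by (intro runsI) (auto simp: e_run_def)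
next
  case (Cons p ps)
  let ?n = "60 * sq S" and ?s = "serve k h xs p s" and ?h = "mark k h p"
  have sm: "small S s h [] xs (Suc (length ps))" using Cons.prems(4) by simp
  have vp: "vsize (enc_page p) \<le> S" using Cons.prems(6) by simp
  have "small S ?s ?h [] (tl xs) (length ps)"
    by (rule small_step(2)[OF sm vp]) (auto dest: list.set_sel(2)[rotated] simp: tl_def split: list.splits)
  then have IH: "runs (prog a b) 25 (VCons (VCons (VCons (enc_config ?s) (ehist ?h)) (elist (tl xs))) (elist ps))
    (val_of_list (map enc_config (off_run k ?s ?h (tl xs) ps))) (Suc (length ps) * (7100 * cb ?n))"
    using Cons.prems by (intro Cons.IH) auto
  have S2: "1 \<le> sq S" "S \<le> sq S" using sq_ge[OF Cons.prems(5)] by auto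
  have step: "runs (prog a b) 13 (ectx s h xs p) (VCons (enc_config ?s) (ehist ?h)) (7000 * cb ?n)"
    using small_vsize[OF sm Cons.prems(5)] S2 vp by (intro runs_step[OF Cons.prems(1-3)]) auto
  have tl: "vtl (elist xs) = elist (tl xs)" by (cases xs) simp_all
  have 26: "runs (prog a b) 26 (VCons (VCons (enc_config ?s) (ehist ?h))
      (VCons (VCons (VCons (enc_config s) (ehist h)) (elist xs)) (elist (p # ps))))
    (val_of_list (map enc_config (off_run k s h xs (p # ps)))) (Suc (length ps) * (7100 * cb ?n) + 40)"
    using IH by (intro runsI) (auto simp: e_run2_def runs_def tl)
  have "1 \<le> ?n" using S2 by simp
  from cb_ge(1)[OF this] have "100 \<le> 100 * cb ?n" by simp
  then show ?case using 26 step by (intro runsI) (auto simp: e_run_def runs_def ectx_def)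
qed

end

lemma lookup_mem:
  assumes "finite P" "P \<noteq> {}" "\<And>Q q. (Q, q) \<in> set rh \<Longrightarrow> q \<in> Q"
  shows "lookup rh P \<in> P"
  using assms(3)
proof (induction rh)
  case Nil
  then show ?case using Min_in[OF assms(1,2)] by simp
next
  case (Cons z rh)
  obtain Q q where z: "z = (Q, q)" by (cases z)
  have "q \<in> Q" "lookup rh P \<in> P" using Cons z by auto
  then show ?case by (auto simp: z)
qed

lemma resolve_mem:
  assumes "\<And>P. P \<in> set \<pi> \<Longrightarrow> finite P \<and> P \<noteq> {}" "\<And>Q q. (Q, q) \<in> set rh \<Longrightarrow> q \<in> Q"
  shows "list_all2 (\<lambda>P p. p \<in> P) \<pi> (resolve rh \<pi>)"
  using assms
proof (induction \<pi> arbitrary: rh)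
  case (Cons P \<pi>)
  have "lookup rh P \<in> P" using Cons.prems by (intro lookup_mem) auto
  moreover from this have "list_all2 (\<lambda>P p. p \<in> P) \<pi> (resolve ((P, lookup rh P) # rh) \<pi>)"
    using Cons.prems by (intro Cons.IH) auto
  ultimately show ?case by simp
qed simp

lemma list_all2_mem2: "list_all2 R xs ys \<Longrightarrow> y \<in> set ys \<Longrightarrow> \<exists>x\<in>set xs. R x y"
  by (induction rule: list_all2_induct) auto

lemma length_resolve: "length (resolve rh \<pi>) = length \<pi>"
  by (induction \<pi> arbitrary: rh) auto

lemma pl_instance_simps:
  assumes "pl_instance k \<P> \<pi>"
  shows "k \<ge> 1" "\<And>P. P \<in> set \<pi> \<Longrightarrow> finite P \<and> P \<noteq> {} \<and> P \<in> \<P>"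
  using assms by (auto simp: pl_instance_def)

lemma resolve_solution:
  assumes I: "pl_instance k \<P> \<pi>"
    and Cs: "list_all2 (slots_serve k) (resolve [] \<pi>) Cs"
  shows "is_solution k \<pi> Cs"
proof -
  have m: "list_all2 (\<lambda>P p. p \<in> P) \<pi> (resolve [] \<pi>)"
    using pl_instance_simps(2)[OF I] by (intro resolve_mem) auto
  show ?thesis
    unfolding is_solution_def
  proof (intro conjI allI impI)
    show "length Cs = length \<pi>" using Cs by (simp add: list_all2_conv_all_nth length_resolve)
    fix t assume t: "t < length \<pi>"
    then have 1: "length (Cs ! t) = k" "Some (resolve [] \<pi> ! t) \<in> set (Cs ! t)"
      using Cs by (auto simp: list_all2_conv_all_nth length_resolve)
    then show "length (Cs ! t) = k" by simp
    from 1 obtain i where "i < k" "Cs ! t ! i = Some (resolve [] \<pi> ! t)" by (auto simp: in_set_conv_nth)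
    moreover have "resolve [] \<pi> ! t \<in> \<pi> ! t" using m t by (simp add: list_all2_conv_all_nth)
    ultimately show "\<exists>s<k. \<exists>p\<in>\<pi> ! t. Cs ! t ! s = Some p" by blast
  qed
qed

lemma cache_inv_init: "k \<ge> 1 \<Longrightarrow> cache_inv k (replicate k None) [] xs"
  by (auto simp: cache_inv_def in_greedy_def)

lemma input_bounds:
  assumes I: "pl_instance k \<P> \<pi>"
  defines "S \<equiv> vsize (enc_input k \<pi>)"
  shows "k \<le> S" "length \<pi> \<le> S" "\<And>P. P \<in> set \<pi> \<Longrightarrow> vsize (enc_request P) \<le> S" "1 \<le> S"
proof -
  show "k \<le> S" by (simp add: S_def enc_input_def vsize_enc_slots)
  show "length \<pi> \<le> S"
    using length_le_vsize[of "map enc_request \<pi>"] by (simp add: S_def enc_input_def)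
  show "1 \<le> S" unfolding S_def by (rule vsize_ge1)
  fix P assume "P \<in> set \<pi>"
  then show "vsize (enc_request P) \<le> S"
    using vsize_mem[of "enc_request P" "map enc_request \<pi>"] by (simp add: S_def enc_input_def)
qed

section \<open>Running times and ratios of the three programs\<close>

lemma online_behaviour:
  assumes b: "realizes b nx"
    and nx: "\<And>p xs ys. ys \<in> set_pmf (nx p xs) \<Longrightarrow> reorder p xs ys \<and> length ys \<le> Suc (length xs)"
    and I: "pl_instance k \<P> \<pi>"
  defines "S \<equiv> vsize (enc_input k \<pi>)"
  shows "\<exists>N. online (prog e_online b) k \<pi> = spmf_of_pmf (map_pmf (\<lambda>(Cs, t). (map enc_config Cs, t)) N) \<and>
      map_pmf fst N = prun k nx (replicate k None) [] [] (resolve [] \<pi>) \<and>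
      (\<forall>Cs t. (Cs, t) \<in> set_pmf N \<longrightarrow> t \<le> length \<pi> * (10000 * cb (60 * sq S)))"
  unfolding online_def
proof (rule online_run_prun[OF b nx])
  note k = pl_instance_simps(1)[OF I] and in_b = input_bounds[OF I, folded S_def]
  show "memory (enc_slots k) (replicate k None) [] [] []" using k by (simp add: memory_def)
  show "cache_inv k (replicate k None) [] []" using k by (rule cache_inv_init)
  show "small S (replicate k None) [] [] [] (length \<pi>)" using in_b by (auto simp: small_def)
  show "finite P \<and> P \<noteq> {} \<and> vsize (enc_request P) \<le> S" if "P \<in> set \<pi>" for P
    using pl_instance_simps(2)[OF I that] in_b(3)[OF that] by simp
qed

lemma poly_time_online:
  assumes b: "realizes b nx"
    and nx: "\<And>p xs ys. ys \<in> set_pmf (nx p xs) \<Longrightarrow> reorder p xs ys \<and> length ys \<le> Suc (length xs)"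
  shows "poly_time (online (prog e_online b))"
  unfolding poly_time_def
\<comment> \<open>There are at most \<open>S\<close> requests, each within
  \<open>10000 * cb (60 * sq S)\<close> steps, and \<open>cb (60 * sq S)\<close> is
  \<open>60 ^ 3 * S ^ 6\<close>.\<close>
proof (intro exI[of _ "monom 2160000000 7"] allI impI ballI)
  fix k \<P> \<pi> z assume I: "pl_instance k \<P> \<pi>" and z: "z \<in> set_spmf (online (prog e_online b) k \<pi>)"
  define S where "S = vsize (enc_input k \<pi>)"
  obtain N where N: "online (prog e_online b) k \<pi> = spmf_of_pmf (map_pmf (\<lambda>(Cs, t). (map enc_config Cs, t)) N)"
      "\<And>Cs t. (Cs, t) \<in> set_pmf N \<Longrightarrow> t \<le> length \<pi> * (10000 * cb (60 * sq S))"
    using online_behaviour[OF b nx I] unfolding S_def by blast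
  from z obtain Cs t where Cs: "(Cs, t) \<in> set_pmf N" "z = (map enc_config Cs, t)" by (auto simp: N(1))
  have "t \<le> length \<pi> * (10000 * cb (60 * sq S))" by (rule N(2)[OF Cs(1)])
  also have "\<dots> \<le> S * (10000 * cb (60 * sq S))"
    using input_bounds(2)[OF I] unfolding S_def by (rule mult_le_mono1)
  also have "\<dots> = 2160000000 * S ^ 7" by (simp add: cb_def sq_def algebra_simps power_numeral_reduce)
  finally show "case z of (vs, i) \<Rightarrow> i \<le> poly (monom 2160000000 7) (vsize (enc_input k \<pi>))"
    using Cs(2) by (simp add: poly_monom S_def)
qed

lemma online_solves:
  assumes b: "realizes b nx"
    and nx: "\<And>p xs ys. ys \<in> set_pmf (nx p xs) \<Longrightarrow> reorder p xs ys \<and> length ys \<le> Suc (length xs)"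
    and I: "pl_instance k \<P> \<pi>"
    and r: "measure_pmf.expectation (prun k nx (replicate k None) [] [] (resolve [] \<pi>)) (\<lambda>Cs. real (cost k Cs)) \<le> r"
  shows "solves_within (online (prog e_online b)) k \<pi> r"
proof -
  obtain N where N: "online (prog e_online b) k \<pi> = spmf_of_pmf (map_pmf (\<lambda>(Cs, t). (map enc_config Cs, t)) N)"
      "map_pmf fst N = prun k nx (replicate k None) [] [] (resolve [] \<pi>)"
    using online_behaviour[OF b nx I] by blast
  have "is_solution k \<pi> Cs" if "Cs \<in> set_pmf (prun k nx (replicate k None) [] [] (resolve [] \<pi>))" for Cs
    using prun_serves[OF _ cache_inv_init[OF pl_instance_simps(1)[OF I]] that] nx
    by (intro resolve_solution[OF I]) blast
  moreover have "map_spmf fst (online (prog e_online b) k \<pi>) = spmf_of_pmf (map_pmf (map enc_config) (map_pmf fst N))"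
    by (simp add: N(1) map_pmf_comp case_prod_unfold)
  ultimately show ?thesis unfolding solves_within_def using r N(2) by metis
qed

lemma offline_runs:
  assumes I: "pl_instance k \<P> \<pi>"
  defines "S \<equiv> 3 * vsize (enc_input k \<pi>)" and "\<sigma> \<equiv> resolve [] \<pi>"
  shows "runs (prog e_offline Nl) 0 (enc_input k \<pi>)
    (val_of_list (map enc_config (off_run k (replicate k None) [] (\<sigma> @ \<sigma>) \<sigma>))) (20000 * (S * cb (60 * sq S)))"
proof -
  let ?C = "cb (60 * sq S)"
  note in_b = input_bounds[OF I] and k = pl_instance_simps(1)[OF I]
  have S: "1 \<le> S" using in_b(4) by (simp add: S_def)
  \<comment> \<open>The factor 3 in \<open>S\<close> is for the order, which starts with two copies
    of the resolved sequence, and for the requests still to come.\<close>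
  have T: "3 * length \<pi> \<le> S" "Suc (length \<pi>) \<le> S" using in_b by (auto simp: S_def)
  have "1 \<le> 60 * sq S" using sq_ge[OF S] by simp
  then have C: "1 \<le> ?C" by (rule cb_ge)
  have SC: "S \<le> S * ?C" using C by simp
  have req: "finite P \<and> P \<noteq> {} \<and> vsize (enc_request P) \<le> S" if "P \<in> set \<pi>" for P
    using pl_instance_simps(2)[OF I that] in_b(3)[OF that] by (simp add: S_def)
  have len: "length \<sigma> = length \<pi>" by (simp add: \<sigma>_def length_resolve)
  have vs: "vsize (enc_page p) \<le> S" if p: "p \<in> set \<sigma>" for p
  proof -
    have "list_all2 (\<lambda>P p. p \<in> P) \<pi> \<sigma>" unfolding \<sigma>_def using req by (intro resolve_mem) auto
    then obtain P where P: "P \<in> set \<pi>" "p \<in> P" using list_all2_mem2[OF _ p] by blast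
    then show ?thesis using vsize_page_request[of P p] req[OF P(1)] by simp
  qed
  have "small S [] [] [] [] (length \<pi>)" using T by (auto simp: small_def)
  from runs_resolve[OF req S this, of e_offline Nl]
  have 22: "runs (prog e_offline Nl) 22 (VCons VNil (val_of_list (map enc_request \<pi>))) (elist \<sigma>) (Suc (length \<pi>) * (500 * ?C))"
    by (simp add: \<sigma>_def)
  have "Suc (length \<pi>) * (500 * ?C) \<le> S * (500 * ?C)" using T(2) by (rule mult_le_mono1)
  then have 22: "runs (prog e_offline Nl) 22 (VCons VNil (val_of_list (map enc_request \<pi>))) (elist \<sigma>) (500 * (S * ?C))"
    by (intro runs_mono[OF 22]) simp
  have sm: "small S (replicate k None) [] [] (\<sigma> @ \<sigma>) (length \<sigma>)"
    using T in_b vs by (auto simp: small_def len S_def)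
  have 25: "runs (prog e_offline Nl) 25 (VCons (VCons (VCons (enc_config (replicate k None)) (ehist [])) (elist (\<sigma> @ \<sigma>))) (elist \<sigma>))
    (val_of_list (map enc_config (off_run k (replicate k None) [] (\<sigma> @ \<sigma>) \<sigma>))) (Suc (length \<sigma>) * (7100 * ?C))"
    by (rule runs_run[OF _ k _ sm S vs]) auto
  have "Suc (length \<sigma>) * (7100 * ?C) \<le> S * (7100 * ?C)" unfolding len using T(2) by (rule mult_le_mono1)
  then have 25: "runs (prog e_offline Nl) 25 (VCons (VCons (VCons (enc_slots k) VNil) (elist (\<sigma> @ \<sigma>))) (elist \<sigma>))
    (val_of_list (map enc_config (off_run k (replicate k None) [] (\<sigma> @ \<sigma>) \<sigma>))) (7100 * (S * ?C))"
    using runs_mono[OF 25, of "7100 * (S * ?C)"] by (simp add: enc_config_replicate algebra_simps)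
  have 24: "runs (prog e_offline Nl) 24 (VCons (elist \<sigma>) (elist \<sigma>)) (elist (\<sigma> @ \<sigma>)) (40 * S)"
    using T(2) len by (intro runs_mono[OF runs_append]) simp
  have 27: "runs (prog e_offline Nl) 27 (VCons (enc_slots k) (elist \<sigma>))
    (val_of_list (map enc_config (off_run k (replicate k None) [] (\<sigma> @ \<sigma>) \<sigma>))) (7100 * (S * ?C) + 40 * S + 40)"
    using 24 25 by (intro runsI) (auto simp: e_offline2_def runs_def)
  define X where "X = S * ?C"
  have X: "S \<le> X" "1 \<le> X" using SC S by (auto simp: X_def)
  show ?thesis
    using 22 27 X unfolding X_def[symmetric]
    by (intro runsI) (auto simp: e_offline_def runs_def enc_input_def)
qed

lemma offline_behaviour:
  assumes I: "pl_instance k \<P> \<pi>"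
  defines "S \<equiv> 3 * vsize (enc_input k \<pi>)" and "\<sigma> \<equiv> resolve [] \<pi>"
  shows "\<exists>t\<le>30000 * (S * cb (60 * sq S)). offline (prog e_offline Nl) k \<pi> =
    return_spmf (map enc_config (off_run k (replicate k None) [] (\<sigma> @ \<sigma>) \<sigma>), t)"
proof -
  define F where "F = prog e_offline Nl"
  have F: "length F = 28" by (simp add: F_def)
  have runs: "runs F 0 (enc_input k \<pi>)
    (val_of_list (map enc_config (off_run k (replicate k None) [] (\<sigma> @ \<sigma>) \<sigma>))) (20000 * (S * cb (60 * sq S)))"
    unfolding F_def S_def \<sigma>_def by (rule offline_runs[OF I])
  have ev: "eval F (enc_input k \<pi>) (F ! 0) = return_spmf (val_of_list (map enc_config (off_run k (replicate k None) [] (\<sigma> @ \<sigma>) \<sigma>)),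
      snd (cres F 0 (enc_input k \<pi>)))"
    using cok_eval[of F 0 "enc_input k \<pi>"] runs by (simp add: runs_def prod_eq_iff)
  have S: "1 \<le> S" using input_bounds(4)[OF I] by (simp add: S_def)
  have "1 \<le> 60 * sq S" using sq_ge[OF S] by simp
  then have "1 \<le> S * cb (60 * sq S)" using S cb_ge(1) by (metis mult_le_mono nat_mult_1)
  then have "Suc (Suc (snd (cres F 0 (enc_input k \<pi>)))) \<le> 30000 * (S * cb (60 * sq S))"
    using runs unfolding runs_def by linarith
  moreover have "offline F k \<pi> = return_spmf (map enc_config (off_run k (replicate k None) [] (\<sigma> @ \<sigma>) \<sigma>),
      Suc (Suc (snd (cres F 0 (enc_input k \<pi>)))))"
    by (simp add: offline_def exec_def eval_simps F ev)
  ultimately show ?thesis unfolding F_def by blast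
qed

lemma poly_time_offline: "poly_time (offline (prog e_offline Nl))"
  unfolding poly_time_def
\<comment> \<open>The coefficient is \<open>30000 * 3 * 60 ^ 3 * 9 ^ 3\<close>, where the factors 3
  and 9 come from tripling the input size.\<close>
proof (intro exI[of _ "monom 14171760000000 7"] allI impI ballI)
  fix k \<P> \<pi> z assume I: "pl_instance k \<P> \<pi>" and z: "z \<in> set_spmf (offline (prog e_offline Nl) k \<pi>)"
  define S where "S = vsize (enc_input k \<pi>)"
  obtain t vs where t: "t \<le> 30000 * ((3 * S) * cb (60 * sq (3 * S)))" "offline (prog e_offline Nl) k \<pi> = return_spmf (vs, t)"
    using offline_behaviour[OF I] unfolding S_def by blast
  note t(1)
  also have "30000 * ((3 * S) * cb (60 * sq (3 * S))) = 14171760000000 * S ^ 7"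
    by (simp add: cb_def sq_def algebra_simps power_numeral_reduce)
  finally show "case z of (vs, i) \<Rightarrow> i \<le> poly (monom 14171760000000 7) (vsize (enc_input k \<pi>))"
    using z t(2) by (simp add: poly_monom S_def)
qed

lemma offline_approximation_prog: "offline_approximation (prog e_offline Nl) (\<lambda>k h. real h)"
  unfolding offline_approximation_def
proof (intro allI impI)
  fix k \<P> \<pi> assume I: "pl_instance k \<P> \<pi>"
  define \<sigma> where "\<sigma> = resolve [] \<pi>"
  define Cs where "Cs = off_run k (replicate k None) [] (\<sigma> @ \<sigma>) \<sigma>"
  obtain t where "offline (prog e_offline Nl) k \<pi> = return_spmf (map enc_config Cs, t)"
    using offline_behaviour[OF I] unfolding Cs_def \<sigma>_def by blast
  then have 1: "map_spmf fst (offline (prog e_offline Nl) k \<pi>) = spmf_of_pmf (map_pmf (map enc_config) (return_pmf Cs))"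
    by simp
  have run: "list_all2 (slots_serve k) \<sigma> Cs" "path_cost k (replicate k None) Cs \<le> loops k [] \<sigma>"
    unfolding Cs_def using off_run_correct[OF cache_inv_init[OF pl_instance_simps(1)[OF I]], of \<sigma> \<sigma>] by auto
  have "cost k Cs \<le> height \<P> * opt k \<pi>"
    using run(2) loops_le_opt[OF I] by (simp add: cost_eq_path_cost \<sigma>_def)
  then have "real (cost k Cs) \<le> real (height \<P> * opt k \<pi>)" by (simp only: of_nat_le_iff)
  moreover have "is_solution k \<pi> Cs" using run(1) unfolding \<sigma>_def by (rule resolve_solution[OF I])
  ultimately show "solves_within (offline (prog e_offline Nl)) k \<pi> (real (height \<P>) * real (opt k \<pi>))"
    unfolding solves_within_def using 1 by (intro exI[of _ "return_pmf Cs"]) simp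
qed

abbreviation det_kernel :: "nat \<Rightarrow> nat list \<Rightarrow> nat list pmf" where
  "det_kernel \<equiv> \<lambda>p xs. return_pmf (p # xs)"

lemma det_kernel_ok: "ys \<in> set_pmf (det_kernel p xs) \<Longrightarrow> reorder p xs ys \<and> length ys \<le> Suc (length xs)"
  by (simp add: reorder_Cons)

lemma ins_kernel_ok: "ys \<in> set_pmf (ins_kernel p xs) \<Longrightarrow> reorder p xs ys \<and> length ys \<le> Suc (length xs)"
  using ins_kernel_reorder[of ys p xs]
  by (auto simp: ins_kernel_def set_pmf_of_set lessThan_empty_iff split: if_splits)

lemma competitive_det: "competitive (prog e_online Arg) (\<lambda>k h. real h * real k)"
  unfolding competitive_def
\<comment> \<open>The additive constant stays schematic until the last step makes it
  \<open>real k\<close>, the bound on the number of coloops.\<close>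
proof (intro allI, rule exI, intro allI impI)
  fix k \<P> \<pi> assume I: "pl_instance k \<P> \<pi>"
  let ?D = "prun k det_kernel (replicate k None) [] [] (resolve [] \<pi>)"
  have "cost k Cs \<le> k * (height \<P> * opt k \<pi>) + k" if "Cs \<in> set_pmf ?D" for Cs
  proof -
    have "cost k Cs \<le> k * loops k [] (resolve [] \<pi>) + k"
      using prun_cost_le[OF _ cache_inv_init[OF pl_instance_simps(1)[OF I]] that] det_kernel_ok
      by (force simp: cost_eq_path_cost)
    also have "\<dots> \<le> k * (height \<P> * opt k \<pi>) + k" using loops_le_opt[OF I] by simp
    finally show ?thesis .
  qed
  then have "real (cost k Cs) \<le> real (k * (height \<P> * opt k \<pi>) + k)" if "Cs \<in> set_pmf ?D" for Cs
    using that by (simp only: of_nat_le_iff)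
  then have "measure_pmf.expectation ?D (\<lambda>Cs. real (cost k Cs)) \<le>
      measure_pmf.expectation ?D (\<lambda>_. real (k * (height \<P> * opt k \<pi>) + k))"
    by (intro integral_mono_AE integrable_measure_pmf_finite finite_prun AE_pmfI) auto
  then show "solves_within (online (prog e_online Arg)) k \<pi> (real (height \<P>) * real k * real (opt k \<pi>) + real k)"
    by (intro online_solves[OF realizes_det det_kernel_ok I]) (auto simp: algebra_simps)
qed

lemma competitive_rand: "competitive (prog e_online e_order_rand) (\<lambda>k h. real h * harm k)"
  unfolding competitive_def
proof (intro allI, rule exI, intro allI impI)
  fix k \<P> \<pi> assume I: "pl_instance k \<P> \<pi>"
  let ?\<sigma> = "resolve [] \<pi>" and ?U = "\<Union>\<P>"
  let ?D = "prun k ins_kernel (replicate k None) [] [] ?\<sigma>"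
  note k = pl_instance_simps(1)[OF I]
  have U: "finite ?U" using I by (auto simp: pl_instance_def)
  have m: "list_all2 (\<lambda>P p. p \<in> P) \<pi> ?\<sigma>"
    using pl_instance_simps(2)[OF I] by (intro resolve_mem) auto
  have "set ?\<sigma> \<subseteq> ?U"
  proof
    fix p assume "p \<in> set ?\<sigma>"
    then obtain P where "P \<in> set \<pi>" "p \<in> P"
      using list_all2_mem2[OF m] by blast
    then show "p \<in> ?U" using pl_instance_simps(2)[OF I] by auto
  qed
  \<comment> \<open>The start is a point mass at the empty cache and the empty order, the only order
    of the empty set. Since \<open>?U\<close> depends on the family but not on the requests, so does
    the additive constant.\<close>
  then have "measure_pmf.expectation (return_pmf (replicate k None, [])) (\<lambda>(s, xs).
      measure_pmf.expectation (prun k ins_kernel s [] xs ?\<sigma>) (\<lambda>Cs. real (path_cost k s Cs)))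
    \<le> harm k * real (loops k [] ?\<sigma>) + pot ({} :: nat set) (rk k []) + real k * 2 ^ card ?U"
    using k cache_inv_init[OF k] by (intro prun_ins_expected_cost[OF U]) (auto simp: pmf_of_set_singleton)
  then have "measure_pmf.expectation ?D (\<lambda>Cs. real (cost k Cs)) \<le> harm k * real (loops k [] ?\<sigma>) + real k * 2 ^ card ?U"
    by (simp add: cost_eq_path_cost pot_def)
  also have "harm k * real (loops k [] ?\<sigma>) \<le> harm k * real (height \<P> * opt k \<pi>)"
    using loops_le_opt[OF I] by (intro mult_left_mono harm_nonneg) (simp only: of_nat_le_iff)
  finally show "solves_within (online (prog e_online e_order_rand)) k \<pi>
      (real (height \<P>) * harm k * real (opt k \<pi>) + real k * 2 ^ card ?U)"
    by (intro online_solves[OF realizes_rand ins_kernel_ok I]) (auto simp: algebra_simps)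
qed

lemma deterministic_prog: "choice_free a \<Longrightarrow> choice_free b \<Longrightarrow> deterministic (prog a b)"
  by (simp add: deterministic_def prog_def e_eq_def e_mem_def e_sub_def e_lookup_def e_min_def e_rk_def
      e_rk_base_def e_prefix_def e_reject_def e_reject2_def e_place_def e_step_def e_step2_def e_prep_def
      e_prep2_def e_prep3_def e_fin_def e_splits_def e_revapp_def e_combine_def e_resolve_def
      e_resolve2_def e_append_def e_run_def e_run2_def e_offline2_def)

theorem theorem4:
  shows "(\<exists>A. deterministic A \<and> poly_time (online A) \<and>
              competitive A (\<lambda>k h. real h * real k)) \<and>
         (\<exists>A. poly_time (online A) \<and>
              competitive A (\<lambda>k h. real h * harm k)) \<and>
         (\<exists>A. deterministic A \<and> poly_time (offline A) \<and>
              offline_approximation A (\<lambda>k h. real h))"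
proof (intro conjI)
  have "deterministic (prog e_online Arg)" "deterministic (prog e_offline Nl)"
    by (simp_all add: deterministic_prog e_online_def e_offline_def)
  then show "\<exists>A. deterministic A \<and> poly_time (online A) \<and> competitive A (\<lambda>k h. real h * real k)"
    "\<exists>A. deterministic A \<and> poly_time (offline A) \<and> offline_approximation A (\<lambda>k h. real h)"
    using poly_time_online[OF realizes_det det_kernel_ok] competitive_det poly_time_offline
      offline_approximation_prog by blast+
  show "\<exists>A. poly_time (online A) \<and> competitive A (\<lambda>k h. real h * harm k)"
    using poly_time_online[OF realizes_rand ins_kernel_ok] competitive_rand by blast
qed

end
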